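(* Let $R$ be a one dimensional Gorenstein (commutative Noetherian) local ring with finite normalization, i.e. $\overline R$ is a finitely generated $R$-module. Then $$\mathrm{ca}(R)\subseteq \mathcal C(R).$$
   Context: The cohomology annihilator of a commutative Noetherian ring $R$ is $\mathrm{ca}(R)=\bigcup_{n\ge 0}\mathrm{ca}^n(R)$, where $\mathrm{ca}^n(R)=\bigcap_{M,N}\mathrm{ann}_R\mathrm{Ext}_R^n(M,N)$, the intersection running over all finitely generated $R$-modules $M,N$. The normalization $\overline{R}$ is the integral closure of $R$ in its total quotient ring, and the conductor is $\mathcal C(R)=\{r\in R : rq\in R \text{ for all } q\in\overline R\}=\mathrm{ann}_R(\overline R/R)$. Gorenstein means of finite injective dimension as a module over itself. *)

theory Defs
  imports "HOL-Algebra.Module" "HOL-Algebra.Polynomials" "HOL-Library.Extended_Nat"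
begin

hide_const (open) Multiset.mult (* shadows the record field *)

section \<open>Modules\<close>

text \<open>Modules are the records of \<^theory>\<open>HOL-Algebra.Module\<close>. These extend rings, so a module record
  also has fields \<open>mult\<close> and \<open>one\<close>; they carry no meaning for a module and are left \<open>undefined\<close>
  where there is no natural value.\<close>

definition fin_gen :: "('a, 'r) ring_scheme \<Rightarrow> ('a, 'm, 's) module_scheme \<Rightarrow> bool" where
  "fin_gen R M \<longleftrightarrow> module R M \<and>
     (\<exists>G. finite G \<and> G \<subseteq> carrier M \<and>
        (\<forall>x\<in>carrier M. \<exists>c\<in>G \<rightarrow> carrier R. x = (\<Oplus>\<^bsub>M\<^esub>g\<in>G. c g \<odot>\<^bsub>M\<^esub> g)))"

definition module_ann :: "('a, 'r) ring_scheme \<Rightarrow> ('a, 'm, 's) module_scheme \<Rightarrow> 'a set" where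
  "module_ann R M = {r \<in> carrier R. \<forall>x\<in>carrier M. r \<odot>\<^bsub>M\<^esub> x = \<zero>\<^bsub>M\<^esub>}"

definition ring_module :: "('a, 'r) ring_scheme \<Rightarrow> ('a, 'a) module" where
  "ring_module R =
     \<lparr>carrier = carrier R, mult = mult R, one = one R, zero = zero R, add = add R, smult = mult R\<rparr>"

definition free_module :: "('a, 'r) ring_scheme \<Rightarrow> nat \<Rightarrow> ('a, nat \<Rightarrow> 'a) module" where
  "free_module R n =
     \<lparr>carrier = {..<n} \<rightarrow>\<^sub>E carrier R,
      mult = undefined,
      one = undefined,
      zero = (\<lambda>i\<in>{..<n}. \<zero>\<^bsub>R\<^esub>),
      add = (\<lambda>x y. \<lambda>i\<in>{..<n}. x i \<oplus>\<^bsub>R\<^esub> y i),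
      smult = (\<lambda>r x. \<lambda>i\<in>{..<n}. r \<otimes>\<^bsub>R\<^esub> x i)\<rparr>"

text \<open>Homomorphisms are extensional, so that equality in the module \<open>Hom(M, N)\<close> is equality of
  functions.\<close>

definition module_hom ::
  "('a, 'r) ring_scheme \<Rightarrow> ('a, 'm, 's) module_scheme \<Rightarrow> ('a, 'n, 't) module_scheme \<Rightarrow> ('m \<Rightarrow> 'n) set"
where
  "module_hom R M N = {f \<in> carrier M \<rightarrow>\<^sub>E carrier N.
     (\<forall>x\<in>carrier M. \<forall>y\<in>carrier M. f (x \<oplus>\<^bsub>M\<^esub> y) = f x \<oplus>\<^bsub>N\<^esub> f y) \<and>
     (\<forall>r\<in>carrier R. \<forall>x\<in>carrier M. f (r \<odot>\<^bsub>M\<^esub> x) = r \<odot>\<^bsub>N\<^esub> f x)}"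

definition hom_module ::
  "('a, 'r) ring_scheme \<Rightarrow> ('a, 'm, 's) module_scheme \<Rightarrow> ('a, 'n, 't) module_scheme \<Rightarrow> ('a, 'm \<Rightarrow> 'n) module"
where
  "hom_module R M N =
     \<lparr>carrier = module_hom R M N,
      mult = undefined,
      one = undefined,
      zero = (\<lambda>x\<in>carrier M. \<zero>\<^bsub>N\<^esub>),
      add = (\<lambda>f g. \<lambda>x\<in>carrier M. f x \<oplus>\<^bsub>N\<^esub> g x),
      smult = (\<lambda>r f. \<lambda>x\<in>carrier M. r \<odot>\<^bsub>N\<^esub> f x)\<rparr>"

definition module_ker ::
  "('a, 'm, 's) module_scheme \<Rightarrow> ('a, 'n, 't) module_scheme \<Rightarrow> ('m \<Rightarrow> 'n) \<Rightarrow> 'm set"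
where
  "module_ker M N f = {x \<in> carrier M. f x = \<zero>\<^bsub>N\<^esub>}"

definition quot_module :: "('a, 'm, 's) module_scheme \<Rightarrow> 'm set \<Rightarrow> ('a, 'm set) module" where
  "quot_module M H =
     \<lparr>carrier = a_rcosets\<^bsub>M\<^esub> H,
      mult = undefined,
      one = undefined,
      zero = H,
      add = (<+>\<^bsub>M\<^esub>),
      smult = (\<lambda>r C. \<Union>x\<in>C. H +>\<^bsub>M\<^esub> (r \<odot>\<^bsub>M\<^esub> x))\<rparr>"


section \<open>Ext and the cohomology annihilator\<close>

text \<open>A resolution of \<open>M\<close> by the finitely generated free modules \<open>F i = free_module R (b i)\<close>, with
  differentials \<open>d i : F (i + 1) \<rightarrow> F i\<close> and augmentation \<open>e : F 0 \<rightarrow> M\<close>.\<close>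

definition free_resolution ::
  "('a, 'r) ring_scheme \<Rightarrow> ('a, 'm, 's) module_scheme \<Rightarrow>
   (nat \<Rightarrow> nat) \<Rightarrow> (nat \<Rightarrow> (nat \<Rightarrow> 'a) \<Rightarrow> nat \<Rightarrow> 'a) \<Rightarrow> ((nat \<Rightarrow> 'a) \<Rightarrow> 'm) \<Rightarrow> bool"
where
  "free_resolution R M b d e \<longleftrightarrow>
     e \<in> module_hom R (free_module R (b 0)) M \<and>
     (\<forall>i. d i \<in> module_hom R (free_module R (b (Suc i))) (free_module R (b i))) \<and>
     e ` carrier (free_module R (b 0)) = carrier M \<and>
     d 0 ` carrier (free_module R (b 1)) = module_ker (free_module R (b 0)) M e \<and>
     (\<forall>i. d (Suc i) ` carrier (free_module R (b (Suc (Suc i)))) =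
        module_ker (free_module R (b (Suc i))) (free_module R (b i)) (d i))"

text \<open>The \<open>n\<close>-th cohomology of the complex \<open>Hom(F 0, N) \<rightarrow> Hom(F 1, N) \<rightarrow> \<dots>\<close>.\<close>

definition hom_cocycles ::
  "('a, 'r) ring_scheme \<Rightarrow> (nat \<Rightarrow> nat) \<Rightarrow> (nat \<Rightarrow> (nat \<Rightarrow> 'a) \<Rightarrow> nat \<Rightarrow> 'a) \<Rightarrow>
   ('a, 'n, 't) module_scheme \<Rightarrow> nat \<Rightarrow> ((nat \<Rightarrow> 'a) \<Rightarrow> 'n) set"
where
  "hom_cocycles R b d N n = {f \<in> module_hom R (free_module R (b n)) N.
     \<forall>x\<in>carrier (free_module R (b (Suc n))). f (d n x) = \<zero>\<^bsub>N\<^esub>}"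

definition hom_coboundaries ::
  "('a, 'r) ring_scheme \<Rightarrow> (nat \<Rightarrow> nat) \<Rightarrow> (nat \<Rightarrow> (nat \<Rightarrow> 'a) \<Rightarrow> nat \<Rightarrow> 'a) \<Rightarrow>
   ('a, 'n, 't) module_scheme \<Rightarrow> nat \<Rightarrow> ((nat \<Rightarrow> 'a) \<Rightarrow> 'n) set"
where
  "hom_coboundaries R b d N n = (case n of
       0 \<Rightarrow> {\<zero>\<^bsub>hom_module R (free_module R (b 0)) N\<^esub>}
     | Suc m \<Rightarrow> (\<lambda>f. compose (carrier (free_module R (b n))) f (d m)) `
                  module_hom R (free_module R (b m)) N)"

definition hom_cohomology ::
  "('a, 'r) ring_scheme \<Rightarrow> (nat \<Rightarrow> nat) \<Rightarrow> (nat \<Rightarrow> (nat \<Rightarrow> 'a) \<Rightarrow> nat \<Rightarrow> 'a) \<Rightarrow>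
   ('a, 'n, 't) module_scheme \<Rightarrow> nat \<Rightarrow> ('a, ((nat \<Rightarrow> 'a) \<Rightarrow> 'n) set) module"
where
  "hom_cohomology R b d N n =
     quot_module ((hom_module R (free_module R (b n)) N)\<lparr>carrier := hom_cocycles R b d N n\<rparr>)
       (hom_coboundaries R b d N n)"

text \<open>\<open>Ext R n M N\<close> is computed from a chosen resolution of \<open>M\<close> by finitely generated free modules.
  One exists whenever \<open>R\<close> is Noetherian and \<open>M\<close> finitely generated (the only case used), and the
  result is independent of it up to isomorphism.\<close>

definition Ext ::
  "('a, 'r) ring_scheme \<Rightarrow> nat \<Rightarrow> ('a, 'm, 's) module_scheme \<Rightarrow> ('a, 'n, 't) module_scheme \<Rightarrow>
   ('a, ((nat \<Rightarrow> 'a) \<Rightarrow> 'n) set) module"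
where
  "Ext R n M N =
     (let (b, d) = (SOME (b, d). \<exists>e. free_resolution R M b d e) in hom_cohomology R b d N n)"

text \<open>Modules on subsets of \<open>(nat \<Rightarrow> 'a) set\<close> represent every finitely generated \<open>R\<close>-module up to
  isomorphism, because they include all quotients of the modules \<open>free_module R k\<close>.\<close>

type_synonym 'a fg_universe = "('a, (nat \<Rightarrow> 'a) set) module"

definition cohom_ann_deg :: "('a, 'r) ring_scheme \<Rightarrow> nat \<Rightarrow> 'a set" where
  "cohom_ann_deg R n = {r \<in> carrier R.
     \<forall>(M :: 'a fg_universe) (N :: 'a fg_universe). fin_gen R M \<longrightarrow> fin_gen R N \<longrightarrow> r \<in> module_ann R (Ext R n M N)}"

definition cohom_ann :: "('a, 'r) ring_scheme \<Rightarrow> 'a set" where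
  "cohom_ann R = (\<Union>n. cohom_ann_deg R n)"


section \<open>Total quotient ring, normalization and conductor\<close>

definition nonzerodivisors :: "('a, 'r) ring_scheme \<Rightarrow> 'a set" where
  "nonzerodivisors R = {s \<in> carrier R. \<forall>x\<in>carrier R. s \<otimes>\<^bsub>R\<^esub> x = \<zero>\<^bsub>R\<^esub> \<longrightarrow> x = \<zero>\<^bsub>R\<^esub>}"

definition frac_rel :: "('a, 'r) ring_scheme \<Rightarrow> (('a \<times> 'a) \<times> ('a \<times> 'a)) set" where
  "frac_rel R = {((a, s), (b, t)).
     a \<in> carrier R \<and> s \<in> nonzerodivisors R \<and> b \<in> carrier R \<and> t \<in> nonzerodivisors R \<and>
     a \<otimes>\<^bsub>R\<^esub> t = b \<otimes>\<^bsub>R\<^esub> s}"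

definition mk_frac :: "('a, 'r) ring_scheme \<Rightarrow> 'a \<Rightarrow> 'a \<Rightarrow> ('a \<times> 'a) set" where
  "mk_frac R a s = frac_rel R `` {(a, s)}"

definition total_quotient_ring :: "('a, 'r) ring_scheme \<Rightarrow> ('a \<times> 'a) set ring" where
  "total_quotient_ring R =
     \<lparr>carrier = (carrier R \<times> nonzerodivisors R) // frac_rel R,
      mult = (\<lambda>p q. \<Union>(a, s)\<in>p. \<Union>(b, t)\<in>q. mk_frac R (a \<otimes>\<^bsub>R\<^esub> b) (s \<otimes>\<^bsub>R\<^esub> t)),
      one = mk_frac R \<one>\<^bsub>R\<^esub> \<one>\<^bsub>R\<^esub>,
      zero = mk_frac R \<zero>\<^bsub>R\<^esub> \<one>\<^bsub>R\<^esub>,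
      add = (\<lambda>p q. \<Union>(a, s)\<in>p. \<Union>(b, t)\<in>q.
               mk_frac R (a \<otimes>\<^bsub>R\<^esub> t \<oplus>\<^bsub>R\<^esub> b \<otimes>\<^bsub>R\<^esub> s) (s \<otimes>\<^bsub>R\<^esub> t))\<rparr>"

definition to_frac :: "('a, 'r) ring_scheme \<Rightarrow> 'a \<Rightarrow> ('a \<times> 'a) set" where
  "to_frac R a = mk_frac R a \<one>\<^bsub>R\<^esub>"

definition integral_over :: "('q, 'r) ring_scheme \<Rightarrow> 'q set \<Rightarrow> 'q \<Rightarrow> bool" where
  "integral_over S K x \<longleftrightarrow>
     (\<exists>p \<in> carrier (K[X]\<^bsub>S\<^esub>). p \<noteq> [] \<and> lead_coeff p = \<one>\<^bsub>S\<^esub> \<and> ring.eval S p x = \<zero>\<^bsub>S\<^esub>)"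

definition normalization :: "('a, 'r) ring_scheme \<Rightarrow> ('a \<times> 'a) set set" where
  "normalization R = {q \<in> carrier (total_quotient_ring R).
     integral_over (total_quotient_ring R) (to_frac R ` carrier R) q}"

definition normalization_module :: "('a, 'r) ring_scheme \<Rightarrow> ('a, ('a \<times> 'a) set) module" where
  "normalization_module R = (let Q = total_quotient_ring R in
     \<lparr>carrier = normalization R, mult = mult Q, one = one Q, zero = zero Q, add = add Q,
      smult = (\<lambda>r q. to_frac R r \<otimes>\<^bsub>Q\<^esub> q)\<rparr>)"

definition conductor :: "('a, 'r) ring_scheme \<Rightarrow> 'a set" where
  "conductor R = {r \<in> carrier R. \<forall>q\<in>normalization R.
     to_frac R r \<otimes>\<^bsub>total_quotient_ring R\<^esub> q \<in> to_frac R ` carrier R}"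


section \<open>One-dimensional Gorenstein local rings\<close>

definition local_ring :: "('a, 'r) ring_scheme \<Rightarrow> bool" where
  "local_ring R \<longleftrightarrow> cring R \<and> (\<exists>!I. maximalideal I R)"

definition krull_dim :: "('a, 'r) ring_scheme \<Rightarrow> enat" where
  "krull_dim R = Sup {enat n | n.
     \<exists>P :: nat \<Rightarrow> 'a set. (\<forall>i\<le>n. primeideal (P i) R) \<and> (\<forall>i<n. P i \<subset> P (Suc i))}"

text \<open>HOL cannot quantify over all modules \<open>B\<close> of arbitrary type. Restricting to \<open>'a fg_universe\<close>
  (where \<open>B\<close> need not be finitely generated) loses nothing: it contains a copy of \<open>R\<close> itself, so by
  Baer's criterion the extension property then holds for modules of every type.\<close>

definition injective_module :: "('a, 'r) ring_scheme \<Rightarrow> ('a, 'e, 's) module_scheme \<Rightarrow> bool" where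
  "injective_module R E \<longleftrightarrow> module R E \<and>
     (\<forall>(B :: 'a fg_universe) A f.
        module R B \<longrightarrow> submodule A R B \<longrightarrow> f \<in> module_hom R (B\<lparr>carrier := A\<rparr>) E \<longrightarrow>
        (\<exists>g\<in>module_hom R B E. \<forall>x\<in>A. g x = f x))"

text \<open>An injective resolution \<open>0 \<rightarrow> M \<rightarrow> I 0 \<rightarrow> I 1 \<rightarrow> \<dots>\<close>.\<close>

definition injective_resolution ::
  "('a, 'r) ring_scheme \<Rightarrow> ('a, 'm, 's) module_scheme \<Rightarrow>
   (nat \<Rightarrow> ('a, 'e) module) \<Rightarrow> (nat \<Rightarrow> 'e \<Rightarrow> 'e) \<Rightarrow> ('m \<Rightarrow> 'e) \<Rightarrow> bool"
where
  "injective_resolution R M I d e \<longleftrightarrow>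
     (\<forall>i. injective_module R (I i)) \<and>
     e \<in> module_hom R M (I 0) \<and>
     (\<forall>i. d i \<in> module_hom R (I i) (I (Suc i))) \<and>
     inj_on e (carrier M) \<and>
     e ` carrier M = module_ker (I 0) (I 1) (d 0) \<and>
     (\<forall>i. d i ` carrier (I i) = module_ker (I (Suc i)) (I (Suc (Suc i))) (d (Suc i)))"

text \<open>The type \<open>'e\<close> carries the terms of the resolution. As a free type variable in the hypothesis of
  a theorem it ranges over all types.\<close>

definition finite_injective_dimension ::
  "'e itself \<Rightarrow> ('a, 'r) ring_scheme \<Rightarrow> ('a, 'm, 's) module_scheme \<Rightarrow> bool"
where
  "finite_injective_dimension _ R M \<longleftrightarrow>
     (\<exists>(I :: nat \<Rightarrow> ('a, 'e) module) d e n. injective_resolution R M I d e \<and>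
        (\<forall>i>n. carrier (I i) = {\<zero>\<^bsub>I i\<^esub>}))"

definition gorenstein :: "'e itself \<Rightarrow> ('a, 'r) ring_scheme \<Rightarrow> bool" where
  "gorenstein T R \<longleftrightarrow> finite_injective_dimension T R (ring_module R)"

end

(* Write an element of the normalization as a/s and clear denominators in R[a/s]: this gives an
   ideal J of R containing a nonzerodivisor c and satisfying a J \<subseteq> s J. If some r in ca(R) acts on J
   as a composite J \<rightarrow> F \<rightarrow> J with F finite free, then j h(c) = c h(j) for every linear h : J \<rightarrow> R
   turns this factorization into r a \<in> s R, that is, r (a/s) \<in> R.

   The factorization comes from r killing the class of F_n \<rightarrow> Z in Ext^n(J, Z), where Z is the n-th
   syzygy of J. This says that r is null-homotopic on the resolution in degree n, and the homotopy
   descends to degree 0 because Ext^i(J, R) = 0 for i > 0. For the vanishing, c kills Ext^i(J, R) as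
   multiplication by c factors through J \<subseteq> R, and it acts surjectively once Ext^{i+1}(J/cJ, R) = 0.
   The latter follows by descending induction along a finite injective resolution: dimension one
   reduces all modules killed by c to the residue field k, which embeds into R/c. *)

theory Submission
  imports Defs "HOL-Algebra.Ring_Divisibility"
begin

text \<open>The degree in which r annihilates Ext is arbitrary, and each step of the descent has to
  extend a map from the i-th syzygy Z_i to all of F_i. This is where the Gorenstein hypothesis
  enters: a map on Z_i with values in a finite free module extends because Ext^1(F_i / Z_i, R) = 0.
  That vanishing is proved without forming Ext groups: it is stated throughout as an extension
  property. For instance, Ext^1(R/J, K) = 0 reads: every linear map J -> K has the form x |-> x u
  with u in K. The induction along the injective resolution runs over the cosyzygies K_j, the images
  of I_j -> I_{j+1}. They vanish for large j, and as images of injective modules they are divisible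
  by c, which is what each step needs. The module R, the kernel of I_0 -> I_1, is not divisible by
  c; the last step, from K_0 to R, therefore also uses the explicit maps that make c annihilate the
  Ext group.\<close>

section \<open>Linear maps\<close>

text \<open>\<open>module_hom\<close> demands extensional functions, which plain lambda terms for
  sums and composites are not. This predicate drops extensionality;
  \<open>module_hom_restrict\<close> restores it.\<close>

definition linear_map ::
  "('a, 'r) ring_scheme \<Rightarrow> ('a, 'm, 's) module_scheme \<Rightarrow> ('a, 'n, 't) module_scheme \<Rightarrow> ('m \<Rightarrow> 'n) \<Rightarrow> bool"
where
  "linear_map R M N f \<longleftrightarrow>
     (\<forall>x\<in>carrier M. f x \<in> carrier N) \<and>
     (\<forall>x\<in>carrier M. \<forall>y\<in>carrier M. f (x \<oplus>\<^bsub>M\<^esub> y) = f x \<oplus>\<^bsub>N\<^esub> f y) \<and>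
     (\<forall>r\<in>carrier R. \<forall>x\<in>carrier M. f (r \<odot>\<^bsub>M\<^esub> x) = r \<odot>\<^bsub>N\<^esub> f x)"

lemma linear_mapI:
  assumes "\<And>x. x \<in> carrier M \<Longrightarrow> f x \<in> carrier N"
    and "\<And>x y. x \<in> carrier M \<Longrightarrow> y \<in> carrier M \<Longrightarrow> f (x \<oplus>\<^bsub>M\<^esub> y) = f x \<oplus>\<^bsub>N\<^esub> f y"
    and "\<And>r x. r \<in> carrier R \<Longrightarrow> x \<in> carrier M \<Longrightarrow> f (r \<odot>\<^bsub>M\<^esub> x) = r \<odot>\<^bsub>N\<^esub> f x"
  shows "linear_map R M N f"
  using assms unfolding linear_map_def by blast

lemma linear_mapD:
  assumes "linear_map R M N f"
  shows "x \<in> carrier M \<Longrightarrow> f x \<in> carrier N"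
    and "x \<in> carrier M \<Longrightarrow> y \<in> carrier M \<Longrightarrow> f (x \<oplus>\<^bsub>M\<^esub> y) = f x \<oplus>\<^bsub>N\<^esub> f y"
    and "r \<in> carrier R \<Longrightarrow> x \<in> carrier M \<Longrightarrow> f (r \<odot>\<^bsub>M\<^esub> x) = r \<odot>\<^bsub>N\<^esub> f x"
  using assms unfolding linear_map_def by blast+

lemma linear_map_zero:
  assumes "module R M" "module R N" "linear_map R M N f"
  shows "f \<zero>\<^bsub>M\<^esub> = \<zero>\<^bsub>N\<^esub>"
proof -
  interpret M: module R M by fact
  interpret N: module R N by fact
  have "f (\<zero>\<^bsub>R\<^esub> \<odot>\<^bsub>M\<^esub> \<zero>\<^bsub>M\<^esub>) = \<zero>\<^bsub>R\<^esub> \<odot>\<^bsub>N\<^esub> f \<zero>\<^bsub>M\<^esub>"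
    by (intro linear_mapD(3)[OF assms(3)]) auto
  then show ?thesis
    using linear_mapD(1)[OF assms(3), of "\<zero>\<^bsub>M\<^esub>"] by simp
qed

text \<open>The additive inverse is a description over the carrier of the record. As a scalar
  multiple it can be compared between records with different carriers.\<close>

lemma module_minus_eq_smult:
  assumes "module R M" "x \<in> carrier M"
  shows "\<ominus>\<^bsub>M\<^esub> x = (\<ominus>\<^bsub>R\<^esub> \<one>\<^bsub>R\<^esub>) \<odot>\<^bsub>M\<^esub> x"
proof -
  interpret M: module R M by fact
  show ?thesis using assms(2) by (simp add: M.smult_l_minus)
qed

lemma linear_map_uminus:
  assumes "module R M" "module R N" "linear_map R M N f" "x \<in> carrier M"
  shows "f (\<ominus>\<^bsub>M\<^esub> x) = \<ominus>\<^bsub>N\<^esub> f x"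
proof -
  interpret M: module R M by fact
  interpret N: module R N by fact
  show ?thesis
    using assms(4) linear_mapD(1,3)[OF assms(3)]
    by (simp add: module_minus_eq_smult[OF assms(1)] module_minus_eq_smult[OF assms(2)])
qed

lemma linear_map_diff:
  assumes "module R M" "module R N" "linear_map R M N f" "x \<in> carrier M" "y \<in> carrier M"
  shows "f (x \<ominus>\<^bsub>M\<^esub> y) = f x \<ominus>\<^bsub>N\<^esub> f y"
proof -
  interpret M: module R M by fact
  interpret N: module R N by fact
  show ?thesis
    using assms(4,5) linear_mapD(2)[OF assms(3)]
    by (simp add: linear_map_uminus[OF assms(1-3)] a_minus_def)
qed

lemma linear_map_comp:
  assumes "linear_map R M N f" "linear_map R N P g"
  shows "linear_map R M P (\<lambda>x. g (f x))"
  using assms unfolding linear_map_def by auto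

lemma linear_map_add:
  assumes "module R M" "module R N" "linear_map R M N f" "linear_map R M N g"
  shows "linear_map R M N (\<lambda>x. f x \<oplus>\<^bsub>N\<^esub> g x)"
proof -
  interpret M: module R M by fact
  interpret N: module R N by fact
  note [simp] = linear_mapD[OF assms(3)] linear_mapD[OF assms(4)]
  show ?thesis
    by (intro linear_mapI) (simp_all add: N.smult_r_distr N.M.add.m_ac)
qed

lemma linear_map_smult:
  assumes "module R M" "module R N" "linear_map R M N f" "c \<in> carrier R"
  shows "linear_map R M N (\<lambda>x. c \<odot>\<^bsub>N\<^esub> f x)"
proof -
  interpret M: module R M by fact
  interpret N: module R N by fact
  note [simp] = linear_mapD[OF assms(3)]
  show ?thesis using assms(4)
    by (intro linear_mapI) (simp_all add: N.smult_r_distr N.smult_assoc1[symmetric] M.R.m_comm)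
qed

lemma linear_map_minus:
  assumes "module R M" "module R N" "linear_map R M N f" "linear_map R M N g"
  shows "linear_map R M N (\<lambda>x. f x \<ominus>\<^bsub>N\<^esub> g x)"
proof -
  interpret M: module R M by fact
  interpret N: module R N by fact
  have "linear_map R M N (\<lambda>x. f x \<oplus>\<^bsub>N\<^esub> (\<ominus>\<^bsub>R\<^esub> \<one>\<^bsub>R\<^esub>) \<odot>\<^bsub>N\<^esub> g x)"
    by (intro linear_map_add linear_map_smult assms) auto
  moreover have "f x \<oplus>\<^bsub>N\<^esub> (\<ominus>\<^bsub>R\<^esub> \<one>\<^bsub>R\<^esub>) \<odot>\<^bsub>N\<^esub> g x = f x \<ominus>\<^bsub>N\<^esub> g x" if "x \<in> carrier M" for x
    using that linear_mapD(1)[OF assms(4)] module_minus_eq_smult[OF assms(2)]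
    by (simp add: a_minus_def)
  ultimately show ?thesis
    unfolding linear_map_def by simp
qed

lemma linear_map_id: "linear_map R M M (\<lambda>x. x)"
  by (auto intro: linear_mapI)

lemma linear_map_subset:
  assumes "linear_map R M N f" "A \<subseteq> carrier M"
  shows "linear_map R (M\<lparr>carrier := A\<rparr>) N f"
  using assms unfolding linear_map_def by (simp add: subset_iff)

lemma linear_map_into_subset:
  assumes "linear_map R M N f" "\<And>x. x \<in> carrier M \<Longrightarrow> f x \<in> B"
  shows "linear_map R M (N\<lparr>carrier := B\<rparr>) f"
  using assms unfolding linear_map_def by auto

lemma linear_map_from_subset:
  assumes "linear_map R M (N\<lparr>carrier := B\<rparr>) f" "B \<subseteq> carrier N"
  shows "linear_map R M N f"
  using assms unfolding linear_map_def by auto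

lemma module_hom_linear_map: "f \<in> module_hom R M N \<Longrightarrow> linear_map R M N f"
  unfolding module_hom_def linear_map_def by auto

lemma module_hom_restrict:
  assumes "module R M" "linear_map R M N f"
  shows "restrict f (carrier M) \<in> module_hom R M N"
proof -
  interpret M: module R M by fact
  show ?thesis using assms(2) unfolding module_hom_def linear_map_def by auto
qed

lemma (in abelian_group) add_diff_add:
  assumes "a \<in> carrier G" "b \<in> carrier G" "c \<in> carrier G"
  shows "a \<oplus> ((b \<ominus> a) \<oplus> c) = b \<oplus> c"
proof -
  have "a \<oplus> ((b \<ominus> a) \<oplus> c) = a \<oplus> (\<ominus> a \<oplus> (b \<oplus> c))"
    using assms by (simp add: a_minus_def a_ac)
  then show ?thesis using assms by (simp add: r_neg2)
qed

section \<open>Submodules and extension of linear maps by one element\<close>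

lemma submoduleI':
  assumes "module R M" "H \<subseteq> carrier M" "\<zero>\<^bsub>M\<^esub> \<in> H"
    and "\<And>a b. a \<in> H \<Longrightarrow> b \<in> H \<Longrightarrow> a \<oplus>\<^bsub>M\<^esub> b \<in> H"
    and "\<And>a x. a \<in> carrier R \<Longrightarrow> x \<in> H \<Longrightarrow> a \<odot>\<^bsub>M\<^esub> x \<in> H"
  shows "submodule H R M"
proof -
  interpret M: module R M by fact
  show ?thesis
  proof (rule M.submoduleI)
    fix a assume "a \<in> H"
    then show "\<ominus>\<^bsub>M\<^esub> a \<in> H"
      using module_minus_eq_smult[OF assms(1), of a] assms(2,5) by auto
  qed (use assms in auto)
qed

lemma submoduleD:
  assumes "module R M" "submodule H R M"
  shows "H \<subseteq> carrier M" "\<zero>\<^bsub>M\<^esub> \<in> H"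
    "\<And>a b. a \<in> H \<Longrightarrow> b \<in> H \<Longrightarrow> a \<oplus>\<^bsub>M\<^esub> b \<in> H"
    "\<And>a x. a \<in> carrier R \<Longrightarrow> x \<in> H \<Longrightarrow> a \<odot>\<^bsub>M\<^esub> x \<in> H"
    "\<And>a b. a \<in> H \<Longrightarrow> b \<in> H \<Longrightarrow> a \<ominus>\<^bsub>M\<^esub> b \<in> H"
proof -
  interpret M: module R M by fact
  note E = M.submoduleE[OF assms(2)]
  show "H \<subseteq> carrier M" by (rule E(1))
  obtain a where "a \<in> H" using E(2) by auto
  then have "a \<oplus>\<^bsub>M\<^esub> \<ominus>\<^bsub>M\<^esub> a \<in> H" using E by blast
  then show "\<zero>\<^bsub>M\<^esub> \<in> H" using \<open>a \<in> H\<close> E(1) by (auto simp: M.M.r_neg)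
  show "\<And>a b. a \<in> H \<Longrightarrow> b \<in> H \<Longrightarrow> a \<oplus>\<^bsub>M\<^esub> b \<in> H" by (rule E(5))
  show "\<And>a x. a \<in> carrier R \<Longrightarrow> x \<in> H \<Longrightarrow> a \<odot>\<^bsub>M\<^esub> x \<in> H" by (rule E(4))
  show "\<And>a b. a \<in> H \<Longrightarrow> b \<in> H \<Longrightarrow> a \<ominus>\<^bsub>M\<^esub> b \<in> H" unfolding a_minus_def by (intro E(5) E(3))
qed

lemma submodule_module:
  assumes "module R M" "submodule H R M"
  shows "module R (M\<lparr>carrier := H\<rparr>)"
  using submodule.submodule_is_module[OF assms(2,1)] .

text \<open>Shrinking the carrier changes the set in which the inverse is sought, so the two
  subtractions agree only after a proof; both multiply by -1 with the same scalar operation.\<close>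

lemma submodule_minus:
  assumes "module R M" "submodule H R M" "x \<in> H" "y \<in> H"
  shows "x \<ominus>\<^bsub>M\<lparr>carrier := H\<rparr>\<^esub> y = x \<ominus>\<^bsub>M\<^esub> y"
proof -
  have "x \<in> carrier M" "y \<in> carrier M" using assms submoduleD(1) by auto
  then show ?thesis
    using module_minus_eq_smult[OF assms(1), of y]
      module_minus_eq_smult[OF submodule_module[OF assms(1,2)], of y] assms(4)
    by (simp add: a_minus_def)
qed

lemma submodule_ker:
  assumes "module R M" "module R N" "linear_map R M N f"
  shows "submodule (module_ker M N f) R M"
proof -
  interpret M: module R M by fact
  interpret N: module R N by fact
  show ?thesis unfolding module_ker_def
    by (rule submoduleI'[OF assms(1)])
      (auto simp: linear_mapD[OF assms(3)] linear_map_zero[OF assms])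
qed

lemma submodule_image:
  assumes "module R M" "module R N" "linear_map R M N f" "submodule A R M"
  shows "submodule (f ` A) R N"
proof (rule submoduleI'[OF assms(2)])
  note A = submoduleD[OF assms(1,4)]
  note [simp] = linear_mapD[OF assms(3)]
  show "f ` A \<subseteq> carrier N" using A(1) by auto
  show "\<zero>\<^bsub>N\<^esub> \<in> f ` A"
    using A(2) by (auto intro!: image_eqI[of _ _ "\<zero>\<^bsub>M\<^esub>"] simp: linear_map_zero[OF assms(1-3)])
  fix a b assume "a \<in> f ` A" "b \<in> f ` A"
  then obtain x y where *: "x \<in> A" "y \<in> A" "a = f x" "b = f y" by auto
  then have "a \<oplus>\<^bsub>N\<^esub> b = f (x \<oplus>\<^bsub>M\<^esub> y)" using subsetD[OF A(1)] by simp
  then show "a \<oplus>\<^bsub>N\<^esub> b \<in> f ` A" using A(3) * by auto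
next
  note A = submoduleD[OF assms(1,4)]
  fix r a assume "r \<in> carrier R" "a \<in> f ` A"
  then obtain x where *: "x \<in> A" "a = f x" by auto
  have "r \<odot>\<^bsub>N\<^esub> a = f (r \<odot>\<^bsub>M\<^esub> x)"
    using A(1) * \<open>r \<in> carrier R\<close> linear_mapD(3)[OF assms(3)] by auto
  then show "r \<odot>\<^bsub>N\<^esub> a \<in> f ` A" using A(4) * \<open>r \<in> carrier R\<close> by auto
qed

lemma submodule_carrier: "module R M \<Longrightarrow> submodule (carrier M) R M"
  by (rule module.carrier_is_submodule)

text \<open>The single step of Baer's argument: a + r y |-> f a + r u is well defined on A + R y as
  soon as f and u agree on the intersection of A and R y, which is \<open>compat\<close>.\<close>

lemma linear_map_extend_one:
  assumes M: "module R M" and N: "module R N" and A: "submodule A R M"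
    and f: "linear_map R (M\<lparr>carrier := A\<rparr>) N f"
    and y: "y \<in> carrier M" and u: "u \<in> carrier N"
    and compat: "\<And>r. r \<in> carrier R \<Longrightarrow> r \<odot>\<^bsub>M\<^esub> y \<in> A \<Longrightarrow> f (r \<odot>\<^bsub>M\<^esub> y) = r \<odot>\<^bsub>N\<^esub> u"
  shows "\<exists>B g. submodule B R M \<and> A \<subseteq> B \<and> y \<in> B \<and> linear_map R (M\<lparr>carrier := B\<rparr>) N g \<and>
    (\<forall>x\<in>A. g x = f x) \<and> g y = u"
proof -
  interpret M: module R M by fact
  interpret N: module R N by fact
  note A' = submoduleD[OF M A]
  have Ac: "a \<in> carrier M" if "a \<in> A" for a using that A'(1) by auto
  have f1: "f a \<in> carrier N" if "a \<in> A" for a using linear_mapD(1)[OF f] that by auto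
  have f2: "f (a \<oplus>\<^bsub>M\<^esub> b) = f a \<oplus>\<^bsub>N\<^esub> f b" if "a \<in> A" "b \<in> A" for a b
    using linear_mapD(2)[OF f] that by auto
  have f3: "f (r \<odot>\<^bsub>M\<^esub> a) = r \<odot>\<^bsub>N\<^esub> f a" if "r \<in> carrier R" "a \<in> A" for r a
    using linear_mapD(3)[OF f] that by auto
  define B where "B = {a \<oplus>\<^bsub>M\<^esub> r \<odot>\<^bsub>M\<^esub> y | a r. a \<in> A \<and> r \<in> carrier R}"
  \<comment> \<open>A presentation x = a + r y is not unique; some value is chosen here, and
    \<open>wd\<close> shows that all presentations give the same one.\<close>
  define g where "g x = (SOME v. \<exists>a r. a \<in> A \<and> r \<in> carrier R \<and> x = a \<oplus>\<^bsub>M\<^esub> r \<odot>\<^bsub>M\<^esub> y \<and> v = f a \<oplus>\<^bsub>N\<^esub> r \<odot>\<^bsub>N\<^esub> u)" for x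
  have wd: "f a \<oplus>\<^bsub>N\<^esub> r \<odot>\<^bsub>N\<^esub> u = f a' \<oplus>\<^bsub>N\<^esub> r' \<odot>\<^bsub>N\<^esub> u"
    if "a \<in> A" "a' \<in> A" "r \<in> carrier R" "r' \<in> carrier R"
      "a \<oplus>\<^bsub>M\<^esub> r \<odot>\<^bsub>M\<^esub> y = a' \<oplus>\<^bsub>M\<^esub> r' \<odot>\<^bsub>M\<^esub> y" for a a' r r'
  proof -
    \<comment> \<open>Two presentations of the same element differ by (r - r') y, which equals a' -
      a and so lies in A, where \<open>compat\<close> applies.\<close>
    have "(r \<ominus>\<^bsub>R\<^esub> r') \<odot>\<^bsub>M\<^esub> y = r \<odot>\<^bsub>M\<^esub> y \<ominus>\<^bsub>M\<^esub> r' \<odot>\<^bsub>M\<^esub> y"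
      using that y by (simp add: a_minus_def M.smult_l_distr M.smult_l_minus)
    also have "\<dots> = a' \<ominus>\<^bsub>M\<^esub> a"
    proof -
      have "r \<odot>\<^bsub>M\<^esub> y = \<ominus>\<^bsub>M\<^esub> a \<oplus>\<^bsub>M\<^esub> (a \<oplus>\<^bsub>M\<^esub> r \<odot>\<^bsub>M\<^esub> y)"
        using that(1-4) y Ac by (simp add: M.M.r_neg1)
      also have "\<dots> = \<ominus>\<^bsub>M\<^esub> a \<oplus>\<^bsub>M\<^esub> (a' \<oplus>\<^bsub>M\<^esub> r' \<odot>\<^bsub>M\<^esub> y)" by (simp add: that(5))
      finally have "r \<odot>\<^bsub>M\<^esub> y = \<ominus>\<^bsub>M\<^esub> a \<oplus>\<^bsub>M\<^esub> (a' \<oplus>\<^bsub>M\<^esub> r' \<odot>\<^bsub>M\<^esub> y)" .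
      then show ?thesis
        using that(1-4) y Ac by (simp add: a_minus_def M.M.add.m_ac M.M.r_neg1 M.M.r_neg)
    qed
    finally have e: "(r \<ominus>\<^bsub>R\<^esub> r') \<odot>\<^bsub>M\<^esub> y = a' \<ominus>\<^bsub>M\<^esub> a" .
    have "f (a' \<ominus>\<^bsub>M\<^esub> a) = (r \<ominus>\<^bsub>R\<^esub> r') \<odot>\<^bsub>N\<^esub> u"
      using compat[of "r \<ominus>\<^bsub>R\<^esub> r'"] e A'(5) that by auto
    also have "\<dots> = r \<odot>\<^bsub>N\<^esub> u \<ominus>\<^bsub>N\<^esub> r' \<odot>\<^bsub>N\<^esub> u"
      using that u by (simp add: a_minus_def N.smult_l_distr N.smult_l_minus)
    finally have "r \<odot>\<^bsub>N\<^esub> u \<ominus>\<^bsub>N\<^esub> r' \<odot>\<^bsub>N\<^esub> u = f (a' \<ominus>\<^bsub>M\<^esub> a)" ..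
    also have "f (a' \<ominus>\<^bsub>M\<^esub> a) = f a' \<ominus>\<^bsub>N\<^esub> f a"
      using linear_map_diff[OF submodule_module[OF M A] N f] that submodule_minus[OF M A] by simp
    finally have e2: "r \<odot>\<^bsub>N\<^esub> u \<ominus>\<^bsub>N\<^esub> r' \<odot>\<^bsub>N\<^esub> u = f a' \<ominus>\<^bsub>N\<^esub> f a" .
    have "f a \<oplus>\<^bsub>N\<^esub> r \<odot>\<^bsub>N\<^esub> u = f a \<oplus>\<^bsub>N\<^esub> ((r \<odot>\<^bsub>N\<^esub> u \<ominus>\<^bsub>N\<^esub> r' \<odot>\<^bsub>N\<^esub> u) \<oplus>\<^bsub>N\<^esub> r' \<odot>\<^bsub>N\<^esub> u)"
      using that u f1 by (simp add: a_minus_def N.M.add.m_assoc N.M.l_neg)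
    also have "\<dots> = f a' \<oplus>\<^bsub>N\<^esub> r' \<odot>\<^bsub>N\<^esub> u"
      unfolding e2 by (rule N.M.add_diff_add) (use that(1-4) u f1 in auto)
    finally show ?thesis .
  qed
  have g: "g (a \<oplus>\<^bsub>M\<^esub> r \<odot>\<^bsub>M\<^esub> y) = f a \<oplus>\<^bsub>N\<^esub> r \<odot>\<^bsub>N\<^esub> u" if "a \<in> A" "r \<in> carrier R" for a r
    unfolding g_def
  proof (rule some_equality)
    fix v assume "\<exists>a' r'. a' \<in> A \<and> r' \<in> carrier R \<and> a \<oplus>\<^bsub>M\<^esub> r \<odot>\<^bsub>M\<^esub> y = a' \<oplus>\<^bsub>M\<^esub> r' \<odot>\<^bsub>M\<^esub> y \<and>
      v = f a' \<oplus>\<^bsub>N\<^esub> r' \<odot>\<^bsub>N\<^esub> u"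
    then obtain a' r' where *: "a' \<in> A" "r' \<in> carrier R"
      "a \<oplus>\<^bsub>M\<^esub> r \<odot>\<^bsub>M\<^esub> y = a' \<oplus>\<^bsub>M\<^esub> r' \<odot>\<^bsub>M\<^esub> y" "v = f a' \<oplus>\<^bsub>N\<^esub> r' \<odot>\<^bsub>N\<^esub> u" by blast
    show "v = f a \<oplus>\<^bsub>N\<^esub> r \<odot>\<^bsub>N\<^esub> u"
      unfolding *(4) by (rule wd[OF that(1) *(1) that(2) *(2,3), symmetric])
  qed (use that in blast)
  have BI: "a \<oplus>\<^bsub>M\<^esub> r \<odot>\<^bsub>M\<^esub> y \<in> B" if "a \<in> A" "r \<in> carrier R" for a r
    unfolding B_def using that by auto
  have add: "(a \<oplus>\<^bsub>M\<^esub> r \<odot>\<^bsub>M\<^esub> y) \<oplus>\<^bsub>M\<^esub> (b \<oplus>\<^bsub>M\<^esub> s \<odot>\<^bsub>M\<^esub> y) = (a \<oplus>\<^bsub>M\<^esub> b) \<oplus>\<^bsub>M\<^esub> (r \<oplus>\<^bsub>R\<^esub> s) \<odot>\<^bsub>M\<^esub> y"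
    if "a \<in> A" "r \<in> carrier R" "b \<in> A" "s \<in> carrier R" for a b r s
    using that Ac y by (simp add: M.smult_l_distr M.M.add.m_ac)
  have sm: "s \<odot>\<^bsub>M\<^esub> (a \<oplus>\<^bsub>M\<^esub> r \<odot>\<^bsub>M\<^esub> y) = s \<odot>\<^bsub>M\<^esub> a \<oplus>\<^bsub>M\<^esub> (s \<otimes>\<^bsub>R\<^esub> r) \<odot>\<^bsub>M\<^esub> y"
    if "a \<in> A" "r \<in> carrier R" "s \<in> carrier R" for a r s
    using that Ac y by (simp add: M.smult_r_distr M.smult_assoc1)
  have AB: "a = a \<oplus>\<^bsub>M\<^esub> \<zero>\<^bsub>R\<^esub> \<odot>\<^bsub>M\<^esub> y" if "a \<in> A" for a using that Ac y by simp
  have yB: "y = \<zero>\<^bsub>M\<^esub> \<oplus>\<^bsub>M\<^esub> \<one>\<^bsub>R\<^esub> \<odot>\<^bsub>M\<^esub> y" using y by simp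
  show ?thesis
  proof (intro exI[of _ B] exI[of _ g] conjI ballI)
    show AsB: "A \<subseteq> B" using AB BI by (metis M.R.zero_closed subsetI)
    show "y \<in> B" using BI[OF A'(2) M.R.one_closed] yB by simp
    show "submodule B R M"
    proof (rule submoduleI'[OF M])
      show "B \<subseteq> carrier M" unfolding B_def using Ac y by auto
      show "\<zero>\<^bsub>M\<^esub> \<in> B" using A'(2) AsB by auto
    next
      fix x z assume "x \<in> B" "z \<in> B"
      then obtain a r b s where *: "a \<in> A" "r \<in> carrier R" "b \<in> A" "s \<in> carrier R"
        "x = a \<oplus>\<^bsub>M\<^esub> r \<odot>\<^bsub>M\<^esub> y" "z = b \<oplus>\<^bsub>M\<^esub> s \<odot>\<^bsub>M\<^esub> y" unfolding B_def by blast
      show "x \<oplus>\<^bsub>M\<^esub> z \<in> B" unfolding *(5,6) add[OF *(1-4)] using * A'(3) by (intro BI) auto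
    next
      fix s x assume "s \<in> carrier R" "x \<in> B"
      then obtain a r where *: "a \<in> A" "r \<in> carrier R" "x = a \<oplus>\<^bsub>M\<^esub> r \<odot>\<^bsub>M\<^esub> y"
        unfolding B_def by blast
      show "s \<odot>\<^bsub>M\<^esub> x \<in> B" unfolding *(3) sm[OF *(1,2) \<open>s \<in> carrier R\<close>]
        using * A'(4) \<open>s \<in> carrier R\<close> by (intro BI) auto
    qed
    show "linear_map R (M\<lparr>carrier := B\<rparr>) N g"
    proof (rule linear_mapI, goal_cases)
      case (1 x)
      then show ?case using f1 u by (auto simp: B_def g)
    next
      case (2 x z)
      then obtain a r b s where *: "a \<in> A" "r \<in> carrier R" "b \<in> A" "s \<in> carrier R"
        "x = a \<oplus>\<^bsub>M\<^esub> r \<odot>\<^bsub>M\<^esub> y" "z = b \<oplus>\<^bsub>M\<^esub> s \<odot>\<^bsub>M\<^esub> y" unfolding B_def by auto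
      show ?case using * A'(3) f1 u
        by (simp add: add g f2 N.smult_l_distr N.M.add.m_ac)
    next
      case (3 s x)
      then obtain a r where *: "a \<in> A" "r \<in> carrier R" "x = a \<oplus>\<^bsub>M\<^esub> r \<odot>\<^bsub>M\<^esub> y"
        unfolding B_def by auto
      show ?case using * 3 A'(4) f1 u
        by (simp add: sm g f3 N.smult_r_distr N.smult_assoc1)
    qed
    show "g x = f x" if "x \<in> A" for x
      using g[OF that M.R.zero_closed] AB[OF that] f1[OF that] u by simp
    show "g y = u"
      using g[OF A'(2) M.R.one_closed] yB u linear_map_zero[OF submodule_module[OF M A] N f] by simp
  qed
qed

lemma module_minus_eq_zeroD:
  assumes "module R M" "x \<ominus>\<^bsub>M\<^esub> y = \<zero>\<^bsub>M\<^esub>" "x \<in> carrier M" "y \<in> carrier M"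
  shows "x = y"
proof -
  interpret M: module R M by fact
  show ?thesis
    using assms(2-4) M.M.minus_equality[of x "\<ominus>\<^bsub>M\<^esub> y"] by (simp add: a_minus_def)
qed

section \<open>Free modules\<close>

lemma module_ring_module:
  assumes "cring R" shows "module R (ring_module R)"
proof -
  interpret cring R by fact
  show ?thesis
  proof (rule moduleI)
    show "abelian_group (ring_module R)"
    proof (rule abelian_groupI)
      fix x assume "x \<in> carrier (ring_module R)"
      then show "\<exists>y\<in>carrier (ring_module R). y \<oplus>\<^bsub>ring_module R\<^esub> x = \<zero>\<^bsub>ring_module R\<^esub>"
        by (intro bexI[of _ "\<ominus>\<^bsub>R\<^esub> x"]) (auto simp: ring_module_def l_neg)
    qed (auto simp: ring_module_def a_ac)
  qed (use assms in \<open>auto simp: ring_module_def l_distr r_distr m_assoc\<close>)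
qed

lemma ring_module_simps [simp]:
  "carrier (ring_module R) = carrier R" "\<zero>\<^bsub>ring_module R\<^esub> = \<zero>\<^bsub>R\<^esub>"
  "x \<oplus>\<^bsub>ring_module R\<^esub> y = x \<oplus>\<^bsub>R\<^esub> y" "r \<odot>\<^bsub>ring_module R\<^esub> x = r \<otimes>\<^bsub>R\<^esub> x"
  by (simp_all add: ring_module_def)

lemma ring_module_minus:
  assumes "cring R" "x \<in> carrier R" "y \<in> carrier R"
  shows "x \<ominus>\<^bsub>ring_module R\<^esub> y = x \<ominus>\<^bsub>R\<^esub> y"
proof -
  interpret cring R by fact
  show ?thesis
    using assms(2,3) module_minus_eq_smult[OF module_ring_module[OF assms(1)], of y]
    by (simp add: a_minus_def l_minus)
qed

text \<open>Opens the lemmas on submodules, kernels and images to ideals.\<close>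

lemma submodule_ring_module:
  assumes "cring R"
  shows "submodule I R (ring_module R) \<longleftrightarrow> ideal I R"
proof -
  interpret cring R by fact
  show ?thesis
  proof
    assume "submodule I R (ring_module R)"
    note I = submoduleD[OF module_ring_module[OF assms] this, simplified]
    have "\<ominus>\<^bsub>R\<^esub> a \<in> I" if "a \<in> I" for a
      using I(4)[of "\<ominus>\<^bsub>R\<^esub> \<one>\<^bsub>R\<^esub>" a] that I(1) by (auto simp: l_minus)
    then have "subgroup I (add_monoid R)"
      using I by (intro add.subgroupI) (auto simp: a_inv_def)
    then show "ideal I R"
      using I by (intro idealI) (auto simp: ring_axioms, metis m_comm subsetD)
  next
    assume "ideal I R"
    then interpret ideal I R .
    show "submodule I R (ring_module R)"
      by (rule submoduleI'[OF module_ring_module[OF assms]]) (auto intro: I_l_closed)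
  qed
qed

lemma free_module_simps [simp]:
  "carrier (free_module R n) = {..<n} \<rightarrow>\<^sub>E carrier R"
  "\<zero>\<^bsub>free_module R n\<^esub> = (\<lambda>i\<in>{..<n}. \<zero>\<^bsub>R\<^esub>)"
  "x \<oplus>\<^bsub>free_module R n\<^esub> y = (\<lambda>i\<in>{..<n}. x i \<oplus>\<^bsub>R\<^esub> y i)"
  "r \<odot>\<^bsub>free_module R n\<^esub> x = (\<lambda>i\<in>{..<n}. r \<otimes>\<^bsub>R\<^esub> x i)"
  by (simp_all add: free_module_def)

lemma module_free_module:
  assumes R: "cring R" shows "module R (free_module R n)"
proof -
  interpret cring R by fact
  let ?F = "free_module R n"
  have c: "\<And>i. i < n \<Longrightarrow> x i \<in> carrier R" if "x \<in> carrier ?F" for x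
    using that by auto
  show ?thesis
  proof (rule moduleI)
    show "abelian_group ?F"
    proof (rule abelian_groupI)
      fix x y assume "x \<in> carrier ?F" "y \<in> carrier ?F"
      note [simp] = c[OF this(1)] c[OF this(2)]
      show "x \<oplus>\<^bsub>?F\<^esub> y \<in> carrier ?F" by auto
      show "x \<oplus>\<^bsub>?F\<^esub> y = y \<oplus>\<^bsub>?F\<^esub> x" by (simp add: a_comm cong: restrict_cong)
      fix z assume "z \<in> carrier ?F"
      note [simp] = c[OF this]
      show "x \<oplus>\<^bsub>?F\<^esub> y \<oplus>\<^bsub>?F\<^esub> z = x \<oplus>\<^bsub>?F\<^esub> (y \<oplus>\<^bsub>?F\<^esub> z)"
        by (simp add: a_assoc cong: restrict_cong)
    next
      show "\<zero>\<^bsub>?F\<^esub> \<in> carrier ?F" by auto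
      fix x assume x: "x \<in> carrier ?F"
      note [simp] = c[OF this]
      show "\<exists>y\<in>carrier ?F. y \<oplus>\<^bsub>?F\<^esub> x = \<zero>\<^bsub>?F\<^esub>"
        by (intro bexI[of _ "\<lambda>i\<in>{..<n}. \<ominus>\<^bsub>R\<^esub> x i"]) (auto simp: l_neg cong: restrict_cong)
      show "\<zero>\<^bsub>?F\<^esub> \<oplus>\<^bsub>?F\<^esub> x = x"
        using x PiE_arb[of x "{..<n}"] by (intro ext) (simp add: restrict_def)
    qed
  next
    fix x assume x: "x \<in> carrier ?F"
    note [simp] = c[OF x]
    show "\<one>\<^bsub>R\<^esub> \<odot>\<^bsub>?F\<^esub> x = x"
      using x PiE_arb[of x "{..<n}"] by (intro ext) (simp add: restrict_def)
  next
    fix a x assume a: "a \<in> carrier R" and x: "x \<in> carrier ?F"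
    note [simp] = c[OF x]
    show "a \<odot>\<^bsub>?F\<^esub> x \<in> carrier ?F" using a by auto
    fix b assume "b \<in> carrier R"
    then show "(a \<oplus>\<^bsub>R\<^esub> b) \<odot>\<^bsub>?F\<^esub> x = a \<odot>\<^bsub>?F\<^esub> x \<oplus>\<^bsub>?F\<^esub> b \<odot>\<^bsub>?F\<^esub> x"
      "(a \<otimes>\<^bsub>R\<^esub> b) \<odot>\<^bsub>?F\<^esub> x = a \<odot>\<^bsub>?F\<^esub> (b \<odot>\<^bsub>?F\<^esub> x)"
      using a by (simp_all add: l_distr m_assoc cong: restrict_cong)
  next
    fix a x y assume a: "a \<in> carrier R" and x: "x \<in> carrier ?F" and y: "y \<in> carrier ?F"
    note [simp] = c[OF x] c[OF y]
    show "a \<odot>\<^bsub>?F\<^esub> (x \<oplus>\<^bsub>?F\<^esub> y) = a \<odot>\<^bsub>?F\<^esub> x \<oplus>\<^bsub>?F\<^esub> a \<odot>\<^bsub>?F\<^esub> y"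
      using a by (simp add: r_distr cong: restrict_cong)
  next
    show "cring R" by (rule R)
  qed
qed

lemma free_module_coord:
  assumes "i < n"
  shows "linear_map R (free_module R n) (ring_module R) (\<lambda>x. x i)"
  using assms by (intro linear_mapI) auto

lemma linear_map_into_free_module:
  assumes "\<And>i. i < n \<Longrightarrow> linear_map R M (ring_module R) (h i)"
  shows "linear_map R M (free_module R n) (\<lambda>x. \<lambda>i\<in>{..<n}. h i x)"
  using linear_mapD[OF assms] by (intro linear_mapI) (auto intro!: restrict_ext)

definition unit_vec :: "('a, 'r) ring_scheme \<Rightarrow> nat \<Rightarrow> nat \<Rightarrow> nat \<Rightarrow> 'a" where
  "unit_vec R n i = (\<lambda>j\<in>{..<n}. if j = i then \<one>\<^bsub>R\<^esub> else \<zero>\<^bsub>R\<^esub>)"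

lemma unit_vec_carrier:
  assumes "cring R" shows "unit_vec R n i \<in> carrier (free_module R n)"
proof -
  interpret cring R by fact
  show ?thesis unfolding unit_vec_def by auto
qed

lemma free_module_span:
  assumes R: "cring R" and A: "submodule A R (free_module R n)"
    and "\<And>i. i < n \<Longrightarrow> unit_vec R n i \<in> A"
  shows "A = carrier (free_module R n)"
proof -
  interpret cring R by fact
  note A' = submoduleD[OF module_free_module[OF R] A]
  have "carrier (free_module R n) \<subseteq> A"
  proof
    fix x assume x: "x \<in> carrier (free_module R n)"
    then have xi: "x i \<in> carrier R" if "i < n" for i using that by auto
    \<comment> \<open>The vector x truncated to its first k coordinates; going from k to k + 1 adds
      x k times a unit vector.\<close>
    define t where "t k = (\<lambda>j\<in>{..<n}. if j < k then x j else \<zero>\<^bsub>R\<^esub>)" for k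
    have "t k \<in> A" if "k \<le> n" for k
      using that
    proof (induction k)
      case 0
      then show ?case using A'(2) by (simp add: t_def restrict_def)
    next
      case (Suc k)
      have "t k \<oplus>\<^bsub>free_module R n\<^esub> (x k \<odot>\<^bsub>free_module R n\<^esub> unit_vec R n k) \<in> A"
        using Suc xi by (intro A'(3,4) assms(3)) auto
      also have "t k \<oplus>\<^bsub>free_module R n\<^esub> (x k \<odot>\<^bsub>free_module R n\<^esub> unit_vec R n k) = t (Suc k)"
        using Suc.prems xi by (auto simp: t_def unit_vec_def fun_eq_iff less_Suc_eq)
      finally show ?case .
    qed
    moreover have "t n = x"
      using x PiE_arb[of x "{..<n}"] by (intro ext) (simp add: t_def restrict_def)
    ultimately show "x \<in> A" by blast
  qed
  then show ?thesis using A'(1) by auto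
qed

text \<open>The kernel of f - g is a submodule containing the unit vectors.\<close>

lemma free_module_ext:
  assumes R: "cring R" and N: "module R N"
    and f: "linear_map R (free_module R n) N f" and g: "linear_map R (free_module R n) N g"
    and eq: "\<And>i. i < n \<Longrightarrow> f (unit_vec R n i) = g (unit_vec R n i)"
    and x: "x \<in> carrier (free_module R n)"
  shows "f x = g x"
proof -
  let ?F = "free_module R n"
  interpret F: module R ?F by (rule module_free_module[OF R])
  interpret N: module R N by fact
  have "submodule (module_ker ?F N (\<lambda>x. f x \<ominus>\<^bsub>N\<^esub> g x)) R ?F"
    by (intro submodule_ker linear_map_minus F.module_axioms N f g)
  then have "module_ker ?F N (\<lambda>x. f x \<ominus>\<^bsub>N\<^esub> g x) = carrier ?F"
  proof (rule free_module_span[OF R])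
    fix i assume "i < n"
    then show "unit_vec R n i \<in> module_ker ?F N (\<lambda>x. f x \<ominus>\<^bsub>N\<^esub> g x)"
      using unit_vec_carrier[OF R, of n i] linear_mapD(1)[OF g] eq
      by (simp add: module_ker_def a_minus_def N.M.r_neg del: free_module_simps)
  qed
  then have "f x \<ominus>\<^bsub>N\<^esub> g x = \<zero>\<^bsub>N\<^esub>" using x unfolding module_ker_def by blast
  then show ?thesis
    using linear_mapD(1)[OF f x] linear_mapD(1)[OF g x] by (rule module_minus_eq_zeroD[OF N])
qed

section \<open>Linear combinations and projectivity of free modules\<close>

primrec lincomb :: "('a, 'm, 's) module_scheme \<Rightarrow> (nat \<Rightarrow> 'm) \<Rightarrow> nat \<Rightarrow> (nat \<Rightarrow> 'a) \<Rightarrow> 'm" where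
  "lincomb M g 0 x = \<zero>\<^bsub>M\<^esub>"
| "lincomb M g (Suc k) x = lincomb M g k x \<oplus>\<^bsub>M\<^esub> x k \<odot>\<^bsub>M\<^esub> g k"

lemma lincomb_closed:
  assumes "module R M" "submodule A R M" "\<And>i. i < k \<Longrightarrow> x i \<in> carrier R" "\<And>i. i < k \<Longrightarrow> g i \<in> A"
  shows "lincomb M g k x \<in> A"
  using assms(3,4) submoduleD[OF assms(1,2)] by (induction k) auto

lemma lincomb_linear:
  assumes R: "cring R" and M: "module R M" and g: "\<And>i. i < n \<Longrightarrow> g i \<in> carrier M"
  shows "linear_map R (free_module R n) M (lincomb M g n)"
proof -
  interpret M: module R M by fact
  have "k \<le> n \<Longrightarrow> linear_map R (free_module R n) M (lincomb M g k)" for k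
  proof (induction k)
    case 0
    show ?case by (intro linear_mapI) auto
  next
    case (Suc k)
    have gk: "g k \<in> carrier M" using g Suc.prems by auto
    have "linear_map R (ring_module R) M (\<lambda>r. r \<odot>\<^bsub>M\<^esub> g k)"
      using gk by (intro linear_mapI) (simp_all add: M.smult_l_distr M.smult_assoc1)
    from linear_map_comp[OF free_module_coord this]
    have "linear_map R (free_module R n) M (\<lambda>x. x k \<odot>\<^bsub>M\<^esub> g k)"
      using Suc.prems by simp
    then show ?case
      using linear_map_add[OF module_free_module[OF R] M Suc.IH] Suc.prems by simp
  qed
  then show ?thesis by simp
qed

lemma lincomb_unit_vec:
  assumes R: "cring R" and M: "module R M" and g: "\<And>i. i < n \<Longrightarrow> g i \<in> carrier M" and "i < n"
  shows "lincomb M g n (unit_vec R n i) = g i"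
proof -
  interpret M: module R M by fact
  have "k \<le> n \<Longrightarrow> lincomb M g k (unit_vec R n i) = (if i < k then g i else \<zero>\<^bsub>M\<^esub>)" for k
    using g \<open>i < n\<close> by (induction k) (auto simp: unit_vec_def less_Suc_eq)
  then show ?thesis using \<open>i < n\<close> by simp
qed

lemma free_module_lift:
  assumes R: "cring R" and P: "module R P" and N: "module R N"
    and \<gamma>: "linear_map R (free_module R n) N \<gamma>" and D: "linear_map R P N D"
    and sub: "\<And>x. x \<in> carrier (free_module R n) \<Longrightarrow> \<gamma> x \<in> D ` carrier P"
  obtains \<gamma>' where "linear_map R (free_module R n) P \<gamma>'"
    "\<And>x. x \<in> carrier (free_module R n) \<Longrightarrow> D (\<gamma>' x) = \<gamma> x"
proof -
  have "\<exists>p. p \<in> carrier P \<and> D p = \<gamma> (unit_vec R n i)" for i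
    using sub[OF unit_vec_carrier[OF R, of n i]] by force
  then obtain p where p: "\<And>i. p i \<in> carrier P" "\<And>i. D (p i) = \<gamma> (unit_vec R n i)" by metis
  have l: "linear_map R (free_module R n) P (lincomb P p n)"
    using p by (intro lincomb_linear[OF R P])
  show ?thesis
  proof
    show "linear_map R (free_module R n) P (lincomb P p n)" by (rule l)
    show "D (lincomb P p n x) = \<gamma> x" if "x \<in> carrier (free_module R n)" for x
      using p by (intro free_module_ext[OF R N linear_map_comp[OF l D] \<gamma> _ that])
        (simp add: lincomb_unit_vec[OF R P])
  qed
qed

section \<open>Transport of structure and extension into injective modules\<close>

text \<open>\<open>injective_module\<close> and \<open>cohom_ann_deg\<close> quantify over modules
  whose elements are sets of functions. Ideals, free modules and syzygies are copied onto that type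
  along an injection before these definitions can be applied to them.\<close>

definition transport_module ::
  "('m \<Rightarrow> 'n) \<Rightarrow> ('a, 'm, 's) module_scheme \<Rightarrow> ('a, 'n) module" where
  "transport_module \<iota> M = (let \<kappa> = inv_into (carrier M) \<iota> in
     \<lparr>carrier = \<iota> ` carrier M, mult = undefined, one = undefined, zero = \<iota> \<zero>\<^bsub>M\<^esub>,
      add = (\<lambda>x y. \<iota> (\<kappa> x \<oplus>\<^bsub>M\<^esub> \<kappa> y)), smult = (\<lambda>r x. \<iota> (r \<odot>\<^bsub>M\<^esub> \<kappa> x))\<rparr>)"

lemma transport_module_carrier [simp]: "carrier (transport_module \<iota> M) = \<iota> ` carrier M"
  by (simp add: transport_module_def Let_def)

lemma transport_module:
  assumes M: "module R M" and inj: "inj_on \<iota> (carrier M)"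
  shows "module R (transport_module \<iota> M)"
    "linear_map R M (transport_module \<iota> M) \<iota>"
    "linear_map R (transport_module \<iota> M) M (inv_into (carrier M) \<iota>)"
    "\<zero>\<^bsub>transport_module \<iota> M\<^esub> = \<iota> \<zero>\<^bsub>M\<^esub>"
proof -
  interpret M: module R M by fact
  have [simp]: "inv_into (carrier M) \<iota> (\<iota> x) = x" if "x \<in> carrier M" for x
    using inj that by simp
  note [simp] = transport_module_def Let_def
  show "module R (transport_module \<iota> M)"
  proof (rule moduleI)
    show "abelian_group (transport_module \<iota> M)"
    proof (rule abelian_groupI)
      fix x assume "x \<in> carrier (transport_module \<iota> M)"
      then obtain y where "y \<in> carrier M" "x = \<iota> y" by auto
      then show "\<exists>y\<in>carrier (transport_module \<iota> M). y \<oplus>\<^bsub>transport_module \<iota> M\<^esub> x = \<zero>\<^bsub>transport_module \<iota> M\<^esub>"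
        by (intro bexI[of _ "\<iota> (\<ominus>\<^bsub>M\<^esub> y)"]) (auto simp: M.M.l_neg)
    qed (auto simp: M.M.a_ac)
  qed (auto simp: M.smult_l_distr M.smult_r_distr M.smult_assoc1 M.is_cring)
  show "linear_map R M (transport_module \<iota> M) \<iota>"
    "linear_map R (transport_module \<iota> M) M (inv_into (carrier M) \<iota>)"
    by (auto intro!: linear_mapI)
  show "\<zero>\<^bsub>transport_module \<iota> M\<^esub> = \<iota> \<zero>\<^bsub>M\<^esub>" by simp
qed

text \<open>The copy of M under \<iota> is one of the modules that \<open>injective_module\<close>
  quantifies over; the extension found there is pulled back to M.\<close>

lemma injective_module_extend:
  fixes M :: "('a, 'm, 's) module_scheme" and \<iota> :: "'m \<Rightarrow> (nat \<Rightarrow> 'a) set"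
  assumes E: "injective_module R E" and M: "module R M" and inj: "inj_on \<iota> (carrier M)"
    and A: "submodule A R M" and f: "linear_map R (M\<lparr>carrier := A\<rparr>) E f"
  obtains g where "linear_map R M E g" "\<And>x. x \<in> A \<Longrightarrow> g x = f x"
proof -
  let ?B = "transport_module \<iota> M" and ?\<kappa> = "inv_into (carrier M) \<iota>"
  note T = transport_module[OF M inj]
  have EM: "module R E" using E by (simp add: injective_module_def)
  note A' = submoduleD[OF M A]
  have k: "?\<kappa> (\<iota> x) = x" if "x \<in> A" for x using inj that A'(1) by auto
  have sub: "submodule (\<iota> ` A) R ?B" by (rule submodule_image[OF M T(1,2) A])
  have "linear_map R (?B\<lparr>carrier := \<iota> ` A\<rparr>) (M\<lparr>carrier := A\<rparr>) ?\<kappa>"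
    by (rule linear_map_into_subset, rule linear_map_subset[OF T(3)]) (use A'(1) k in auto)
  then have "linear_map R (?B\<lparr>carrier := \<iota> ` A\<rparr>) E (\<lambda>x. f (?\<kappa> x))"
    using f by (rule linear_map_comp)
  from module_hom_restrict[OF submodule_module[OF T(1) sub] this]
  have "restrict (\<lambda>x. f (?\<kappa> x)) (\<iota> ` A) \<in> module_hom R (?B\<lparr>carrier := \<iota> ` A\<rparr>) E" by simp
  then obtain g where g: "g \<in> module_hom R ?B E" "\<forall>x\<in>\<iota> ` A. g x = restrict (\<lambda>x. f (?\<kappa> x)) (\<iota> ` A) x"
    using E T(1) sub unfolding injective_module_def by blast
  show ?thesis
  proof
    show "linear_map R M E (\<lambda>x. g (\<iota> x))"
      by (rule linear_map_comp[OF T(2) module_hom_linear_map[OF g(1)]])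
    show "g (\<iota> x) = f x" if "x \<in> A" for x using g(2) that k by simp
  qed
qed

lemma submodule_Int:
  assumes M: "module R M" and A: "submodule A R M" and B: "submodule B R M"
  shows "submodule (A \<inter> B) R M"
proof (rule submoduleI'[OF M])
  note A' = submoduleD[OF M A] and B' = submoduleD[OF M B]
  show "A \<inter> B \<subseteq> carrier M" using A'(1) by auto
  show "\<zero>\<^bsub>M\<^esub> \<in> A \<inter> B" using A'(2) B'(2) by auto
  show "a \<oplus>\<^bsub>M\<^esub> b \<in> A \<inter> B" if "a \<in> A \<inter> B" "b \<in> A \<inter> B" for a b using that A'(3) B'(3) by auto
  show "r \<odot>\<^bsub>M\<^esub> a \<in> A \<inter> B" if "r \<in> carrier R" "a \<in> A \<inter> B" for r a using that A'(4) B'(4) by auto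
qed

section \<open>Finite generation over Noetherian rings\<close>

text \<open>For a submodule A this says that A is the least submodule containing G. Expressed
  through submodules instead of sums, generation passes along images and preimages without handling
  coefficients.\<close>

definition spans ::
  "('a, 'r) ring_scheme \<Rightarrow> ('a, 'm, 's) module_scheme \<Rightarrow> 'm set \<Rightarrow> 'm set \<Rightarrow> bool" where
  "spans R M G A \<longleftrightarrow> G \<subseteq> A \<and> (\<forall>B. submodule B R M \<longrightarrow> G \<subseteq> B \<longrightarrow> A \<subseteq> B)"

text \<open>The linear combinations of G form a submodule containing G, so by \<open>spans\<close>
  they exhaust M.\<close>

lemma fin_genI:
  assumes M: "module R M" and fin: "finite G" and G: "spans R M G (carrier M)"
  shows "fin_gen R M"
proof -
  interpret M: module R M by fact
  have Gc: "G \<subseteq> carrier M" using G by (simp add: spans_def)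
  define A where "A = {\<Oplus>\<^bsub>M\<^esub>g\<in>G. c g \<odot>\<^bsub>M\<^esub> g | c. c \<in> G \<rightarrow> carrier R}"
  have cl: "(\<lambda>g. c g \<odot>\<^bsub>M\<^esub> g) \<in> G \<rightarrow> carrier M" if "c \<in> G \<rightarrow> carrier R" for c
    using that Gc by auto
  have "submodule A R M"
  proof (rule submoduleI'[OF M])
    show "A \<subseteq> carrier M" unfolding A_def using cl by auto
    have "(\<Oplus>\<^bsub>M\<^esub>g\<in>G. \<zero>\<^bsub>R\<^esub> \<odot>\<^bsub>M\<^esub> g) = (\<Oplus>\<^bsub>M\<^esub>g\<in>G. \<zero>\<^bsub>M\<^esub>)"
      using Gc by (intro M.M.finsum_cong') auto
    then have "\<zero>\<^bsub>M\<^esub> = (\<Oplus>\<^bsub>M\<^esub>g\<in>G. (\<lambda>_. \<zero>\<^bsub>R\<^esub>) g \<odot>\<^bsub>M\<^esub> g)" by simp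
    then show "\<zero>\<^bsub>M\<^esub> \<in> A" unfolding A_def by (intro CollectI exI conjI) auto
  next
    fix a b assume "a \<in> A" "b \<in> A"
    then obtain c d where cd: "c \<in> G \<rightarrow> carrier R" "d \<in> G \<rightarrow> carrier R"
      and ab: "a = (\<Oplus>\<^bsub>M\<^esub>g\<in>G. c g \<odot>\<^bsub>M\<^esub> g)" "b = (\<Oplus>\<^bsub>M\<^esub>g\<in>G. d g \<odot>\<^bsub>M\<^esub> g)" unfolding A_def by blast
    have "(\<Oplus>\<^bsub>M\<^esub>g\<in>G. (c g \<oplus>\<^bsub>R\<^esub> d g) \<odot>\<^bsub>M\<^esub> g) = (\<Oplus>\<^bsub>M\<^esub>g\<in>G. c g \<odot>\<^bsub>M\<^esub> g \<oplus>\<^bsub>M\<^esub> d g \<odot>\<^bsub>M\<^esub> g)"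
      using cd Gc by (intro M.M.finsum_cong') (auto simp: M.smult_l_distr Pi_iff subset_iff)
    also have "\<dots> = a \<oplus>\<^bsub>M\<^esub> b" unfolding ab by (rule M.M.finsum_addf[OF cl[OF cd(1)] cl[OF cd(2)]])
    finally have "a \<oplus>\<^bsub>M\<^esub> b = (\<Oplus>\<^bsub>M\<^esub>g\<in>G. (c g \<oplus>\<^bsub>R\<^esub> d g) \<odot>\<^bsub>M\<^esub> g)" ..
    moreover have "(\<lambda>g. c g \<oplus>\<^bsub>R\<^esub> d g) \<in> G \<rightarrow> carrier R" using cd by auto
    ultimately show "a \<oplus>\<^bsub>M\<^esub> b \<in> A" unfolding A_def by (intro CollectI exI conjI)
  next
    fix r a assume r: "r \<in> carrier R" and "a \<in> A"
    then obtain c where c: "c \<in> G \<rightarrow> carrier R" and a: "a = (\<Oplus>\<^bsub>M\<^esub>g\<in>G. c g \<odot>\<^bsub>M\<^esub> g)"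
      unfolding A_def by blast
    have "(\<Oplus>\<^bsub>M\<^esub>g\<in>G. (r \<otimes>\<^bsub>R\<^esub> c g) \<odot>\<^bsub>M\<^esub> g) = (\<Oplus>\<^bsub>M\<^esub>g\<in>G. r \<odot>\<^bsub>M\<^esub> (c g \<odot>\<^bsub>M\<^esub> g))"
      using c r Gc by (intro M.M.finsum_cong') (auto simp: M.smult_assoc1 Pi_iff subset_iff)
    also have "\<dots> = r \<odot>\<^bsub>M\<^esub> a" unfolding a by (rule M.finsum_smult_ldistr[OF fin r cl[OF c], symmetric])
    finally have "r \<odot>\<^bsub>M\<^esub> a = (\<Oplus>\<^bsub>M\<^esub>g\<in>G. (r \<otimes>\<^bsub>R\<^esub> c g) \<odot>\<^bsub>M\<^esub> g)" ..
    moreover have "(\<lambda>g. r \<otimes>\<^bsub>R\<^esub> c g) \<in> G \<rightarrow> carrier R" using c r by auto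
    ultimately show "r \<odot>\<^bsub>M\<^esub> a \<in> A" unfolding A_def by (intro CollectI exI conjI)
  qed
  moreover have "G \<subseteq> A"
  proof
    fix g assume g: "g \<in> G"
    let ?c = "\<lambda>h. if g = h then \<one>\<^bsub>R\<^esub> else \<zero>\<^bsub>R\<^esub>"
    have "(\<Oplus>\<^bsub>M\<^esub>h\<in>G. ?c h \<odot>\<^bsub>M\<^esub> h) = (\<Oplus>\<^bsub>M\<^esub>h\<in>G. if g = h then h else \<zero>\<^bsub>M\<^esub>)"
      using Gc by (intro M.M.finsum_cong') auto
    also have "\<dots> = g"
      using M.M.add.finprod_singleton[OF g fin, of "\<lambda>h. h"] Gc by auto
    finally have "g = (\<Oplus>\<^bsub>M\<^esub>h\<in>G. ?c h \<odot>\<^bsub>M\<^esub> h)" ..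
    moreover have "?c \<in> G \<rightarrow> carrier R" by auto
    ultimately show "g \<in> A" unfolding A_def by (intro CollectI exI conjI)
  qed
  ultimately have "carrier M \<subseteq> A" using G by (simp add: spans_def)
  then show ?thesis unfolding fin_gen_def
    using M fin Gc unfolding A_def by (intro conjI exI[of _ G]) blast+
qed

text \<open>The images of the unit vectors generate: the preimage of a submodule containing them
  contains all unit vectors, hence everything. Used to see that syzygies are finitely
  generated.\<close>

lemma fin_gen_image_free_module:
  assumes R: "cring R" and M: "module R M" and \<phi>: "linear_map R (free_module R n) M \<phi>"
    and surj: "\<phi> ` carrier (free_module R n) = carrier M"
  shows "fin_gen R M"
proof (rule fin_genI[OF M])
  let ?F = "free_module R n" and ?G = "\<phi> ` unit_vec R n ` {..<n}"
  note F = module_free_module[OF R, of n]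
  show "finite ?G" by simp
  have "carrier M \<subseteq> B" if B: "submodule B R M" and G: "?G \<subseteq> B" for B
  proof -
    note B' = submoduleD[OF M B]
    let ?A = "{x \<in> carrier ?F. \<phi> x \<in> B}"
    interpret F: module R ?F by (rule F)
    have "submodule ?A R ?F"
    proof (rule submoduleI'[OF F])
      show "\<zero>\<^bsub>?F\<^esub> \<in> ?A" using B'(2) linear_map_zero[OF F M \<phi>] F.M.zero_closed by simp
    next
      fix a b assume "a \<in> ?A" "b \<in> ?A"
      then show "a \<oplus>\<^bsub>?F\<^esub> b \<in> ?A" using F.M.a_closed[of a b] linear_mapD(2)[OF \<phi>, of a b] B'(3) by simp
    next
      fix r a assume "r \<in> carrier R" "a \<in> ?A"
      then show "r \<odot>\<^bsub>?F\<^esub> a \<in> ?A" using F.smult_closed[of r a] linear_mapD(3)[OF \<phi>, of r a] B'(4) by simp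
    qed auto
    then have "?A = carrier ?F"
      using G unit_vec_carrier[OF R, of n] by (intro free_module_span[OF R]) auto
    then have "\<phi> x \<in> B" if "x \<in> carrier ?F" for x using that by blast
    then show ?thesis unfolding surj[symmetric] by blast
  qed
  then show "spans R M ?G (carrier M)"
    using unit_vec_carrier[OF R, of n] surj unfolding spans_def by blast
qed

lemma spans_imp_image_free_module:
  assumes R: "cring R" and M: "module R M" and A: "submodule A R M"
    and "finite G" "spans R M G A"
  obtains n \<phi> where "linear_map R (free_module R n) M \<phi>" "\<phi> ` carrier (free_module R n) = A"
proof -
  obtain xs where xs: "set xs = G" using \<open>finite G\<close> finite_list by auto
  let ?n = "length xs" and ?\<phi> = "lincomb M (\<lambda>i. xs ! i) (length xs)"
  note A' = submoduleD[OF M A]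
  have GA: "G \<subseteq> A" using assms(5) by (simp add: spans_def)
  have g: "xs ! i \<in> A" if "i < ?n" for i using that xs GA nth_mem by blast
  then have gM: "xs ! i \<in> carrier M" if "i < ?n" for i using that A'(1) by blast
  have lin: "linear_map R (free_module R ?n) M ?\<phi>"
    by (rule lincomb_linear[OF R M gM])
  show ?thesis
  proof (rule that[OF lin])
    have "?\<phi> ` carrier (free_module R ?n) \<subseteq> A"
      using g by (auto intro!: lincomb_closed[OF M A])
    moreover have "A \<subseteq> ?\<phi> ` carrier (free_module R ?n)"
    proof -
      have "G \<subseteq> ?\<phi> ` carrier (free_module R ?n)"
      proof
        fix x assume "x \<in> G"
        then obtain i where "i < ?n" "xs ! i = x" using xs by (metis in_set_conv_nth)
        then have "x = ?\<phi> (unit_vec R ?n i)" using lincomb_unit_vec[OF R M gM] by simp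
        then show "x \<in> ?\<phi> ` carrier (free_module R ?n)" using unit_vec_carrier[OF R] by blast
      qed
      moreover have "submodule (?\<phi> ` carrier (free_module R ?n)) R M"
        by (intro submodule_image[OF module_free_module[OF R] M lin] submodule_carrier module_free_module R)
      ultimately show ?thesis using assms(5) unfolding spans_def by blast
    qed
    ultimately show "?\<phi> ` carrier (free_module R ?n) = A" by blast
  qed
qed

lemma noetherian_ideal_spans:
  assumes R: "cring R" and N: "noetherian_ring R" and I: "ideal I R"
  obtains G where "finite G" "spans R (ring_module R) G I"
proof -
  interpret cring R by fact
  interpret N: noetherian_ring R by fact
  obtain G where G: "G \<subseteq> carrier R" "finite G" "I = genideal R G" using N.finetely_gen[OF I] by blast
  have "spans R (ring_module R) G I"
    unfolding spans_def submodule_ring_module[OF R] G(3)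
    using genideal_self[OF G(1)] genideal_minimal by blast
  then show ?thesis using that G(2) by blast
qed

text \<open>Induction on the number of coordinates allowed to be nonzero. The k-th coordinates of
  the elements vanishing beyond k form an ideal; lifts of its finitely many generators, together
  with generators from the previous level, suffice.\<close>

lemma free_module_submodule_spans:
  assumes R: "cring R" and N: "noetherian_ring R" and A: "submodule A R (free_module R n)"
  obtains G where "finite G" "spans R (free_module R n) G A"
proof -
  interpret cring R by fact
  let ?F = "free_module R n"
  note F = module_free_module[OF R, of n]
  interpret F: module R ?F by (rule F)
  note A' = submoduleD[OF F A]
  \<comment> \<open>The elements of A supported on the first k coordinates, so that
    \<open>A_lt 0\<close> is zero and \<open>A_lt n\<close> is A.\<close>
  define A_lt where "A_lt k = {x \<in> A. \<forall>i<n. k \<le> i \<longrightarrow> x i = \<zero>\<^bsub>R\<^esub>}" for k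
  have "k \<le> n \<Longrightarrow> \<exists>G. finite G \<and> spans R ?F G (A_lt k)" for k
  proof (induction k)
    case 0
    have "A_lt 0 \<subseteq> {\<zero>\<^bsub>?F\<^esub>}"
    proof
      fix x assume x: "x \<in> A_lt 0"
      then have "x \<in> carrier ?F" using A'(1) by (auto simp: A_lt_def)
      then have "x = \<zero>\<^bsub>?F\<^esub>"
        using x PiE_arb[of x "{..<n}"] by (intro ext) (simp add: A_lt_def restrict_def)
      then show "x \<in> {\<zero>\<^bsub>?F\<^esub>}" by simp
    qed
    then have "spans R ?F {} (A_lt 0)" unfolding spans_def using submoduleD(2)[OF F] by blast
    then show ?case by blast
  next
    case (Suc k)
    then obtain G where G: "finite G" "spans R ?F G (A_lt k)" by auto
    have kn: "k < n" using Suc.prems by simp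
    have subm: "submodule (A_lt (Suc k)) R ?F"
    proof (rule submoduleI'[OF F])
      show "A_lt (Suc k) \<subseteq> carrier ?F" using A'(1) unfolding A_lt_def by blast
      show "\<zero>\<^bsub>?F\<^esub> \<in> A_lt (Suc k)" using A'(2) by (simp add: A_lt_def)
    next
      fix a b assume "a \<in> A_lt (Suc k)" "b \<in> A_lt (Suc k)"
      then show "a \<oplus>\<^bsub>?F\<^esub> b \<in> A_lt (Suc k)" using A'(3)[of a b] by (simp add: A_lt_def)
    next
      fix r a assume "r \<in> carrier R" "a \<in> A_lt (Suc k)"
      then show "r \<odot>\<^bsub>?F\<^esub> a \<in> A_lt (Suc k)" using A'(4)[of r a] by (simp add: A_lt_def)
    qed
    note coord = free_module_coord[OF kn, of R]
    define I where "I = (\<lambda>x. x k) ` A_lt (Suc k)"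
    have "ideal I R"
      unfolding I_def submodule_ring_module[OF R, symmetric]
      by (rule submodule_image[OF F module_ring_module[OF R] coord subm])
    from noetherian_ideal_spans[OF R N this]
    obtain H where H: "finite H" "spans R (ring_module R) H I" by blast
    then have "\<forall>h\<in>H. \<exists>x. x \<in> A_lt (Suc k) \<and> x k = h" unfolding spans_def I_def by blast
    then obtain l where l: "\<And>h. h \<in> H \<Longrightarrow> l h \<in> A_lt (Suc k) \<and> l h k = h" by metis
    have sub: "A_lt k \<subseteq> A_lt (Suc k)" unfolding A_lt_def by auto
    have "A_lt (Suc k) \<subseteq> B" if B: "submodule B R ?F" and GB: "G \<union> l ` H \<subseteq> B" for B
    proof
      fix x assume x: "x \<in> A_lt (Suc k)"
      have kB: "A_lt k \<subseteq> B" using G(2) B GB unfolding spans_def by blast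
      note B' = submoduleD[OF F B] and S' = submoduleD[OF F subm]
      \<comment> \<open>The intersection keeps the element y, which is to match x in coordinate k,
        inside the current level; then x - y falls into \<open>A_lt k\<close>.\<close>
      have "submodule (B \<inter> A_lt (Suc k)) R ?F"
        by (rule submodule_Int[OF F B subm])
      then have "submodule ((\<lambda>x. x k) ` (B \<inter> A_lt (Suc k))) R (ring_module R)"
        by (rule submodule_image[OF F module_ring_module[OF R] coord])
      moreover have "H \<subseteq> (\<lambda>x. x k) ` (B \<inter> A_lt (Suc k))"
      proof
        fix h assume "h \<in> H"
        then show "h \<in> (\<lambda>x. x k) ` (B \<inter> A_lt (Suc k))"
          using l[of h] GB by (intro image_eqI[of _ _ "l h"]) auto
      qed
      ultimately have "I \<subseteq> (\<lambda>x. x k) ` (B \<inter> A_lt (Suc k))" using H(2) unfolding spans_def by blast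
      then obtain y where y: "y \<in> B" "y \<in> A_lt (Suc k)" "y k = x k" using x unfolding I_def by auto
      have xyF: "x \<in> carrier ?F" "y \<in> carrier ?F" using x y S'(1) by auto
      have d: "x \<ominus>\<^bsub>?F\<^esub> y \<in> A_lt (Suc k)" using x y S'(5) by blast
      have "(x \<ominus>\<^bsub>?F\<^esub> y) k = x k \<ominus>\<^bsub>ring_module R\<^esub> y k"
        by (rule linear_map_diff[OF F module_ring_module[OF R] coord xyF])
      also have "\<dots> = \<zero>\<^bsub>R\<^esub>"
      proof -
        have "x k \<in> carrier R" using xyF(1) kn by auto
        then have "x k \<ominus>\<^bsub>R\<^esub> x k = \<zero>\<^bsub>R\<^esub>" by (simp add: a_minus_def r_neg)
        then show ?thesis unfolding y(3) using \<open>x k \<in> carrier R\<close> by (simp add: ring_module_minus[OF R])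
      qed
      finally have "x \<ominus>\<^bsub>?F\<^esub> y \<in> A_lt k"
        using d unfolding A_lt_def by (auto simp: le_less Suc_le_eq)
      then have "x \<ominus>\<^bsub>?F\<^esub> y \<in> B" using kB by blast
      then have "(x \<ominus>\<^bsub>?F\<^esub> y) \<oplus>\<^bsub>?F\<^esub> y \<in> B" using y B'(3) by blast
      moreover have "(x \<ominus>\<^bsub>?F\<^esub> y) \<oplus>\<^bsub>?F\<^esub> y = x"
        using xyF by (simp add: a_minus_def F.M.a_assoc F.M.l_neg del: free_module_simps)
      ultimately show "x \<in> B" by simp
    qed
    then have "spans R ?F (G \<union> l ` H) (A_lt (Suc k))"
      using G(2) l sub unfolding spans_def by blast
    then show ?case using G(1) H(1) by (intro exI[of _ "G \<union> l ` H"]) simp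
  qed
  from this[of n] obtain G where G: "finite G" "spans R ?F G (A_lt n)" by blast
  have "A_lt n = A" unfolding A_lt_def by auto
  then show ?thesis using that G by simp
qed

text \<open>Lets a free resolution be continued: every kernel between finite free modules is the
  image of another one.\<close>

lemma free_module_submodule_cover:
  assumes "cring R" "noetherian_ring R" "submodule A R (free_module R n)"
  obtains m \<phi> where "linear_map R (free_module R m) (free_module R n) \<phi>"
    "\<phi> ` carrier (free_module R m) = A"
  using free_module_submodule_spans[OF assms] spans_imp_image_free_module[OF assms(1) module_free_module[OF assms(1)] assms(3)]
  by metis

section \<open>Prime ideals in dimension one\<close>

text \<open>In a Noetherian ring the union of a nonempty chain of ideals is a member of the chain,
  so an arbitrary property P passes to it and Zorn's lemma applies. P will be properness, avoiding a
  multiplicative set, being a colon ideal, or being the domain of an extension.\<close>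

lemma noetherian_maximal_ideal_with:
  assumes N: "noetherian_ring R" and I: "ideal I R" "P I"
  shows "\<exists>J. ideal J R \<and> P J \<and> I \<subseteq> J \<and> (\<forall>K. ideal K R \<longrightarrow> P K \<longrightarrow> J \<subseteq> K \<longrightarrow> K = J)"
proof -
  interpret noetherian_ring R by fact
  let ?A = "{J. ideal J R \<and> P J \<and> I \<subseteq> J}"
  have "\<exists>U\<in>?A. \<forall>Y\<in>C. Y \<subseteq> U" if C: "subset.chain ?A C" for C
  proof (cases "C = {}")
    case True
    then show ?thesis using I by blast
  next
    case False
    have CA: "C \<subseteq> ?A" using C by (simp add: subset.chain_def)
    then have "C \<subseteq> {I. ideal I R}" by blast
    then have "subset.chain {I. ideal I R} C" using C by (simp add: subset.chain_def)
    then have "\<Union>C \<in> C" by (rule ideal_chain_is_trivial[OF False])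
    then show ?thesis using CA by (intro bexI[of _ "\<Union>C"]) auto
  qed
  then have "\<exists>J\<in>?A. \<forall>Y\<in>?A. J \<subseteq> Y \<longrightarrow> Y = J" by (rule subset_Zorn)
  then obtain J where J: "J \<in> ?A" and max: "\<forall>Y\<in>?A. J \<subseteq> Y \<longrightarrow> Y = J" by (rule bexE)
  have "K = J" if "ideal K R" "P K" "J \<subseteq> K" for K
    using that J max by auto
  then show ?thesis using J by auto
qed

lemma noetherian_maximalideal_above:
  assumes N: "noetherian_ring R" and I: "ideal I R" "I \<noteq> carrier R"
  obtains M where "maximalideal M R" "I \<subseteq> M"
proof -
  from noetherian_maximal_ideal_with[of R I "\<lambda>J. J \<noteq> carrier R", OF N I]
  obtain J where J: "ideal J R" "J \<noteq> carrier R" "I \<subseteq> J"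
    "\<And>K. ideal K R \<Longrightarrow> K \<noteq> carrier R \<Longrightarrow> J \<subseteq> K \<Longrightarrow> K = J" by blast
  have "maximalideal J R" by (rule maximalidealI) (use J in blast)+
  then show ?thesis using that J(3) by blast
qed

lemma ideal_sum_principal:
  assumes R: "cring R" and I: "ideal I R" and y: "y \<in> carrier R"
  shows "ideal {a \<oplus>\<^bsub>R\<^esub> r \<otimes>\<^bsub>R\<^esub> y | a r. a \<in> I \<and> r \<in> carrier R} R" (is "ideal ?S R")
    and "I \<subseteq> {a \<oplus>\<^bsub>R\<^esub> r \<otimes>\<^bsub>R\<^esub> y | a r. a \<in> I \<and> r \<in> carrier R}"
    and "y \<in> {a \<oplus>\<^bsub>R\<^esub> r \<otimes>\<^bsub>R\<^esub> y | a r. a \<in> I \<and> r \<in> carrier R}"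
proof -
  interpret cring R by fact
  interpret I: ideal I R by fact
  note RM = module_ring_module[OF R]
  have "submodule ?S R (ring_module R)"
  proof (rule submoduleI'[OF RM], goal_cases)
    case 1
    then show ?case using I.Icarr y by auto
  next
    case 2
    have "\<zero>\<^bsub>R\<^esub> = \<zero>\<^bsub>R\<^esub> \<oplus>\<^bsub>R\<^esub> \<zero>\<^bsub>R\<^esub> \<otimes>\<^bsub>R\<^esub> y" using y by simp
    then show ?case using I.zero_closed zero_closed by fastforce
  next
    case (3 a b)
    then obtain u v r s where *: "u \<in> I" "v \<in> I" "r \<in> carrier R" "s \<in> carrier R"
      "a = u \<oplus>\<^bsub>R\<^esub> r \<otimes>\<^bsub>R\<^esub> y" "b = v \<oplus>\<^bsub>R\<^esub> s \<otimes>\<^bsub>R\<^esub> y" by auto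
    then have "a \<oplus>\<^bsub>R\<^esub> b = (u \<oplus>\<^bsub>R\<^esub> v) \<oplus>\<^bsub>R\<^esub> (r \<oplus>\<^bsub>R\<^esub> s) \<otimes>\<^bsub>R\<^esub> y"
      using y I.Icarr by (simp add: l_distr a_ac)
    moreover have "u \<oplus>\<^bsub>R\<^esub> v \<in> I" "r \<oplus>\<^bsub>R\<^esub> s \<in> carrier R" using * by auto
    ultimately show ?case by auto
  next
    case (4 t a)
    then obtain u r where *: "u \<in> I" "r \<in> carrier R" "a = u \<oplus>\<^bsub>R\<^esub> r \<otimes>\<^bsub>R\<^esub> y" by auto
    then have "t \<otimes>\<^bsub>R\<^esub> a = t \<otimes>\<^bsub>R\<^esub> u \<oplus>\<^bsub>R\<^esub> (t \<otimes>\<^bsub>R\<^esub> r) \<otimes>\<^bsub>R\<^esub> y"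
      using y I.Icarr 4 by (simp add: r_distr m_assoc)
    moreover have "t \<otimes>\<^bsub>R\<^esub> u \<in> I" "t \<otimes>\<^bsub>R\<^esub> r \<in> carrier R" using * 4 I.I_l_closed by auto
    ultimately show ?case by auto
  qed
  then show "ideal ?S R" using submodule_ring_module[OF R] by blast
  show "I \<subseteq> ?S"
  proof
    fix u assume "u \<in> I"
    moreover from this have "u = u \<oplus>\<^bsub>R\<^esub> \<zero>\<^bsub>R\<^esub> \<otimes>\<^bsub>R\<^esub> y" using y I.Icarr by simp
    ultimately show "u \<in> ?S" by (intro CollectI exI conjI) auto
  qed
  have "y = \<zero>\<^bsub>R\<^esub> \<oplus>\<^bsub>R\<^esub> \<one>\<^bsub>R\<^esub> \<otimes>\<^bsub>R\<^esub> y" using y by simp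
  then show "y \<in> ?S" by (intro CollectI exI conjI) auto
qed

text \<open>The multiplicative set \<open>{c\<^sup>i s | s \<notin> p}\<close> avoids \<open>\<zero>\<close>, so \<open>p\<close> properly contains a prime; if \<open>p\<close>
  were not maximal, this would give a chain of length two.\<close>

lemma primeideal_contains_nonzerodivisor_maximal:
  assumes R: "cring R" and N: "noetherian_ring R" and dim: "krull_dim R = 1"
    and p: "primeideal p R" and c: "c \<in> p" "c \<in> nonzerodivisors R"
  shows "maximalideal p R"
proof -
  interpret cring R by fact
  interpret p: primeideal p R by fact
  have pc: "p \<noteq> carrier R" using p.I_notcarr by blast
  obtain m where m: "maximalideal m R" "p \<subseteq> m"
    using noetherian_maximalideal_above[OF N p.is_ideal pc] by blast
  have mp: "primeideal m R" by (rule maximalideal_prime[OF m(1)])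
  have cR: "c \<in> carrier R" using c p.Icarr by blast
  have creg: "x = \<zero>\<^bsub>R\<^esub>" if "x \<in> carrier R" "c \<otimes>\<^bsub>R\<^esub> x = \<zero>\<^bsub>R\<^esub>" for x
    using c(2) that unfolding nonzerodivisors_def by blast
  define S where "S = {c [^]\<^bsub>R\<^esub> (i::nat) \<otimes>\<^bsub>R\<^esub> s | i s. s \<in> carrier R - p}"
  have Smult: "x \<otimes>\<^bsub>R\<^esub> y \<in> S" if xS: "x \<in> S" and yS: "y \<in> S" for x y
  proof -
    obtain i s where s: "s \<in> carrier R - p" "x = c [^]\<^bsub>R\<^esub> (i::nat) \<otimes>\<^bsub>R\<^esub> s"
      using xS unfolding S_def by auto
    obtain j t where t: "t \<in> carrier R - p" "y = c [^]\<^bsub>R\<^esub> (j::nat) \<otimes>\<^bsub>R\<^esub> t"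
      using yS unfolding S_def by auto
    note * = s(1) t(1) s(2) t(2)
    have "x \<otimes>\<^bsub>R\<^esub> y = c [^]\<^bsub>R\<^esub> (i + j) \<otimes>\<^bsub>R\<^esub> (s \<otimes>\<^bsub>R\<^esub> t)"
      using * cR by (simp add: nat_pow_mult[symmetric] m_ac)
    moreover have "s \<otimes>\<^bsub>R\<^esub> t \<in> carrier R - p" using * p.I_prime by blast
    ultimately show ?thesis unfolding S_def by blast
  qed
  have one: "\<one>\<^bsub>R\<^esub> \<in> carrier R - p" using pc p.one_imp_carrier by blast
  have cS: "c \<in> S"
  proof -
    have "c = c [^]\<^bsub>R\<^esub> (1::nat) \<otimes>\<^bsub>R\<^esub> \<one>\<^bsub>R\<^esub>" using cR by simp
    then show ?thesis using one unfolding S_def by blast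
  qed
  have sS: "s \<in> S" if "s \<in> carrier R - p" for s
  proof -
    have "s = c [^]\<^bsub>R\<^esub> (0::nat) \<otimes>\<^bsub>R\<^esub> s" using that by simp
    then show ?thesis using that unfolding S_def by blast
  qed
  \<comment> \<open>Factors c are cancelled one at a time; what remains is s = 0, impossible since 0
    lies in p.\<close>
  have ne: "c [^]\<^bsub>R\<^esub> i \<otimes>\<^bsub>R\<^esub> s \<noteq> \<zero>\<^bsub>R\<^esub>" if "s \<in> carrier R - p" for i :: nat and s
  proof (induction i)
    case 0
    then show ?case using that p.zero_closed by auto
  next
    case (Suc i)
    have "c [^]\<^bsub>R\<^esub> Suc i \<otimes>\<^bsub>R\<^esub> s = c \<otimes>\<^bsub>R\<^esub> (c [^]\<^bsub>R\<^esub> i \<otimes>\<^bsub>R\<^esub> s)" using that cR by (simp add: m_ac)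
    then show ?case using Suc creg[of "c [^]\<^bsub>R\<^esub> i \<otimes>\<^bsub>R\<^esub> s"] that cR by auto
  qed
  have "\<zero>\<^bsub>R\<^esub> \<notin> S"
  proof
    assume "\<zero>\<^bsub>R\<^esub> \<in> S"
    then obtain i s where "s \<in> carrier R - p" "\<zero>\<^bsub>R\<^esub> = c [^]\<^bsub>R\<^esub> (i::nat) \<otimes>\<^bsub>R\<^esub> s"
      unfolding S_def by auto
    then show False using ne[of s i] by simp
  qed
  then have "{\<zero>\<^bsub>R\<^esub>} \<inter> S = {}" by simp
  \<comment> \<open>An ideal maximal among those disjoint from a multiplicative set is
    prime.\<close>
  then obtain q where q: "ideal q R" "q \<inter> S = {}" "{\<zero>\<^bsub>R\<^esub>} \<subseteq> q"
    "\<forall>K. ideal K R \<longrightarrow> K \<inter> S = {} \<longrightarrow> q \<subseteq> K \<longrightarrow> K = q"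
    using noetherian_maximal_ideal_with[of R "{\<zero>\<^bsub>R\<^esub>}" "\<lambda>J. J \<inter> S = {}", OF N zeroideal] by auto
  interpret q: ideal q R by (rule q(1))
  have qprime: "primeideal q R"
  proof (rule primeidealI[OF q(1) R])
    show "carrier R \<noteq> q" using q(2) cS cR by blast
    fix a b assume ab: "a \<in> carrier R" "b \<in> carrier R" "a \<otimes>\<^bsub>R\<^esub> b \<in> q"
    have meets: "\<exists>u r. u \<in> q \<and> r \<in> carrier R \<and> u \<oplus>\<^bsub>R\<^esub> r \<otimes>\<^bsub>R\<^esub> x \<in> S" if x: "x \<in> carrier R" "x \<notin> q" for x
    proof (rule ccontr)
      assume neg: "\<not> ?thesis"
      define K where "K = {a \<oplus>\<^bsub>R\<^esub> r \<otimes>\<^bsub>R\<^esub> x | a r. a \<in> q \<and> r \<in> carrier R}"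
      note K = ideal_sum_principal[OF R q(1) x(1), folded K_def]
      have "K \<inter> S = {}" using neg unfolding K_def by auto
      then have "K = q" using q(4) K(1,2) by simp
      then show False using K(3) x(2) by simp
    qed
    show "a \<in> q \<or> b \<in> q"
    proof (rule ccontr)
      assume "\<not> ?thesis"
      then have nq: "a \<notin> q" "b \<notin> q" by auto
      obtain u r where ur: "u \<in> q" "r \<in> carrier R" "u \<oplus>\<^bsub>R\<^esub> r \<otimes>\<^bsub>R\<^esub> a \<in> S"
        using meets[OF ab(1) nq(1)] by auto
      obtain v s where vs: "v \<in> q" "s \<in> carrier R" "v \<oplus>\<^bsub>R\<^esub> s \<otimes>\<^bsub>R\<^esub> b \<in> S"
        using meets[OF ab(2) nq(2)] by auto
      note * = ur vs
      have uv: "u \<in> carrier R" "v \<in> carrier R" using * q.Icarr by auto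
      \<comment> \<open>Both factors lie in S, but after expansion every term contains u, v or a b
        and so lies in q.\<close>
      have "(u \<oplus>\<^bsub>R\<^esub> r \<otimes>\<^bsub>R\<^esub> a) \<otimes>\<^bsub>R\<^esub> (v \<oplus>\<^bsub>R\<^esub> s \<otimes>\<^bsub>R\<^esub> b) =
          (v \<oplus>\<^bsub>R\<^esub> s \<otimes>\<^bsub>R\<^esub> b) \<otimes>\<^bsub>R\<^esub> u \<oplus>\<^bsub>R\<^esub> ((r \<otimes>\<^bsub>R\<^esub> a) \<otimes>\<^bsub>R\<^esub> v \<oplus>\<^bsub>R\<^esub> (r \<otimes>\<^bsub>R\<^esub> s) \<otimes>\<^bsub>R\<^esub> (a \<otimes>\<^bsub>R\<^esub> b))"
        using * ab(1,2) uv by (simp add: l_distr r_distr m_ac a_ac)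
      also have "\<dots> \<in> q" 
        using q.I_l_closed[OF *(1), of "v \<oplus>\<^bsub>R\<^esub> s \<otimes>\<^bsub>R\<^esub> b"] q.I_l_closed[OF *(4), of "r \<otimes>\<^bsub>R\<^esub> a"]
          q.I_l_closed[OF ab(3), of "r \<otimes>\<^bsub>R\<^esub> s"] *(2,5) ab(1,2) uv by (intro q.a_closed) auto
      finally show False using Smult[OF *(3,6)] q(2) by blast
    qed
  qed
  \<comment> \<open>S contains everything outside p, so q lies in p; it misses c, which lies in both
    S and p.\<close>
  have "q \<subset> p" using sS cS c(1) q(2) q.Icarr by blast
  have "p = m"
  proof (rule ccontr)
    assume "p \<noteq> m"
    \<comment> \<open>The chain q, p, m has three members, which corresponds to dimension at least
      2.\<close>
    define P where "P i = (if i = 0 then q else if i = 1 then p else m)" for i :: nat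
    have "\<forall>i\<le>2. primeideal (P i) R" using qprime p mp by (simp add: P_def)
    moreover have "\<forall>i<2. P i \<subset> P (Suc i)"
      using \<open>q \<subset> p\<close> m(2) \<open>p \<noteq> m\<close> by (auto simp: P_def less_2_cases_iff)
    ultimately have "enat 2 \<in> {enat n | n. \<exists>P :: nat \<Rightarrow> 'a set. (\<forall>i\<le>n. primeideal (P i) R) \<and> (\<forall>i<n. P i \<subset> P (Suc i))}"
      by blast
    then have "enat 2 \<le> krull_dim R" unfolding krull_dim_def by (rule Sup_upper)
    then show False using dim by (simp add: one_enat_def)
  qed
  then show ?thesis using m(1) by simp
qed

text \<open>This finds an associated prime of R/J: a maximal element among the annihilators of
  nonzero classes of R/J is prime, and as it contains the nonzerodivisor c it is a maximal ideal.
  Hence R/J contains a copy of a residue field.\<close>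

lemma proper_ideal_colon_maximal:
  assumes R: "cring R" and N: "noetherian_ring R" and dim: "krull_dim R = 1"
    and J: "ideal J R" "J \<noteq> carrier R" and c: "c \<in> J" "c \<in> nonzerodivisors R"
  obtains y where "y \<in> carrier R" "y \<notin> J" "maximalideal {r \<in> carrier R. r \<otimes>\<^bsub>R\<^esub> y \<in> J} R"
proof -
  interpret cring R by fact
  interpret J: ideal J R by fact
  define col where "col y = {r \<in> carrier R. r \<otimes>\<^bsub>R\<^esub> y \<in> J}" for y
  have col: "ideal (col y) R" if y: "y \<in> carrier R" for y
  proof -
    have "submodule (col y) R (ring_module R)"
      unfolding col_def
      by (rule submoduleI'[OF module_ring_module[OF R]])
        (use y J.I_l_closed in \<open>auto simp: l_distr m_assoc\<close>)
    then show ?thesis using submodule_ring_module[OF R] by blast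
  qed
  have one: "\<one>\<^bsub>R\<^esub> \<notin> J" using J(2) J.one_imp_carrier by blast
  let ?P = "\<lambda>I. \<exists>y\<in>carrier R - J. I = col y"
  have "?P (col \<one>\<^bsub>R\<^esub>)" using one by auto
  from noetherian_maximal_ideal_with[of R "col \<one>\<^bsub>R\<^esub>" ?P, OF N col[OF one_closed] this]
  obtain p where p: "ideal p R" "?P p" "\<forall>K. ideal K R \<longrightarrow> ?P K \<longrightarrow> p \<subseteq> K \<longrightarrow> K = p"
    by (elim exE conjE)
  then obtain y where y: "y \<in> carrier R" "y \<notin> J" "p = col y" by blast
  have "primeideal p R"
  proof (rule primeidealI[OF p(1) R])
    show "carrier R \<noteq> p"
    proof
      assume "carrier R = p"
      then have "\<one>\<^bsub>R\<^esub> \<in> col y" using one_closed y(3) by simp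
      then show False using y(1,2) by (simp add: col_def)
    qed
    fix a b assume ab: "a \<in> carrier R" "b \<in> carrier R" "a \<otimes>\<^bsub>R\<^esub> b \<in> p"
    show "a \<in> p \<or> b \<in> p"
    proof (rule disjCI)
      assume b: "b \<notin> p"
      have bJ: "b \<otimes>\<^bsub>R\<^esub> y \<in> carrier R - J" using b ab y by (auto simp: col_def)
      \<comment> \<open>If b is not in p, the class of b y is nonzero; its annihilator contains p
        and a, and by maximality it equals p.\<close>
      have "p \<subseteq> col (b \<otimes>\<^bsub>R\<^esub> y)"
      proof
        fix r assume "r \<in> p"
        then have r: "r \<in> carrier R" "r \<otimes>\<^bsub>R\<^esub> y \<in> J" using y(3) by (auto simp: col_def)
        have "r \<otimes>\<^bsub>R\<^esub> (b \<otimes>\<^bsub>R\<^esub> y) = b \<otimes>\<^bsub>R\<^esub> (r \<otimes>\<^bsub>R\<^esub> y)" using r ab y by (simp add: m_ac)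
        then show "r \<in> col (b \<otimes>\<^bsub>R\<^esub> y)" using r ab J.I_l_closed by (simp add: col_def)
      qed
      then have "col (b \<otimes>\<^bsub>R\<^esub> y) = p" using p(3) col bJ by blast
      moreover have "a \<in> col (b \<otimes>\<^bsub>R\<^esub> y)" using ab y by (auto simp: col_def m_assoc)
      ultimately show "a \<in> p" by simp
    qed
  qed
  moreover have "c \<in> p" unfolding y(3) col_def using c(1) J.I_r_closed y(1) J.Icarr by blast
  ultimately have "maximalideal p R"
    using primeideal_contains_nonzerodivisor_maximal[OF R N dim _ _ c(2)] by blast
  then show ?thesis using that y unfolding col_def by blast
qed

section \<open>Extension from ideals containing a nonzerodivisor\<close>

text \<open>Ext^1(R/J, K) = 0 for all ideals J containing c: each linear map J -> K extends to R,
  and the extension is determined by its value u at one. It expresses injectivity of K relative to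
  modules killed by c.\<close>

definition injective_over ::
  "('a, 'r) ring_scheme \<Rightarrow> 'a \<Rightarrow> ('a, 'm, 's) module_scheme \<Rightarrow> bool" where
  "injective_over R c K \<longleftrightarrow>
     (\<forall>J f. ideal J R \<longrightarrow> c \<in> J \<longrightarrow> linear_map R ((ring_module R)\<lparr>carrier := J\<rparr>) K f \<longrightarrow>
        (\<exists>u\<in>carrier K. \<forall>x\<in>J. f x = x \<odot>\<^bsub>K\<^esub> u))"

lemma injective_overD:
  assumes "injective_over R c K" "ideal J R" "c \<in> J" "linear_map R ((ring_module R)\<lparr>carrier := J\<rparr>) K f"
  shows "\<exists>u\<in>carrier K. \<forall>x\<in>J. f x = x \<odot>\<^bsub>K\<^esub> u"
  using assms unfolding injective_over_def by simp

text \<open>The map r |-> f (r y) on the ideal of all r with r y in A is the obstruction to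
  extending f to y. Once it has the form r |-> r u, \<open>linear_map_extend_one\<close>
  applies.\<close>

lemma linear_map_colon:
  assumes R: "cring R" and M: "module R M" and A: "submodule A R M" and y: "y \<in> carrier M"
    and f: "linear_map R (M\<lparr>carrier := A\<rparr>) K f"
  shows "ideal {r \<in> carrier R. r \<odot>\<^bsub>M\<^esub> y \<in> A} R"
    and "linear_map R ((ring_module R)\<lparr>carrier := {r \<in> carrier R. r \<odot>\<^bsub>M\<^esub> y \<in> A}\<rparr>) K (\<lambda>r. f (r \<odot>\<^bsub>M\<^esub> y))"
proof -
  interpret M: module R M by fact
  note A' = submoduleD[OF M A]
  have "submodule {r \<in> carrier R. r \<odot>\<^bsub>M\<^esub> y \<in> A} R (ring_module R)"
    by (rule submoduleI'[OF module_ring_module[OF R]])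
      (use y A'(2-4) in \<open>auto simp: M.smult_l_distr M.smult_assoc1\<close>)
  then show "ideal {r \<in> carrier R. r \<odot>\<^bsub>M\<^esub> y \<in> A} R" using submodule_ring_module[OF R] by blast
  show "linear_map R ((ring_module R)\<lparr>carrier := {r \<in> carrier R. r \<odot>\<^bsub>M\<^esub> y \<in> A}\<rparr>) K (\<lambda>r. f (r \<odot>\<^bsub>M\<^esub> y))"
    using linear_mapD[OF f] y by (intro linear_mapI) (auto simp: M.smult_l_distr M.smult_assoc1)
qed

text \<open>R is moved into the test universe by sending x to the singleton of the constant function
  x; u is the value at one of the extended map.\<close>

lemma injective_module_ideal:
  assumes R: "cring R" and E: "injective_module R E" and J: "ideal J R"
    and f: "linear_map R ((ring_module R)\<lparr>carrier := J\<rparr>) E f"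
  obtains u where "u \<in> carrier E" "\<And>x. x \<in> J \<Longrightarrow> f x = x \<odot>\<^bsub>E\<^esub> u"
proof -
  interpret cring R by fact
  interpret J: ideal J R by fact
  have sub: "submodule J R (ring_module R)" using J submodule_ring_module[OF R] by blast
  have "inj_on (\<lambda>x. {\<lambda>_::nat. x}) (carrier (ring_module R))" by (auto simp: inj_on_def fun_eq_iff)
  then obtain g where g: "linear_map R (ring_module R) E g" "\<And>x. x \<in> J \<Longrightarrow> g x = f x"
    using injective_module_extend[OF E module_ring_module[OF R] _ sub f] by metis
  show ?thesis
  proof
    show "g \<one>\<^bsub>R\<^esub> \<in> carrier E" using linear_mapD(1)[OF g(1)] by simp
    show "f x = x \<odot>\<^bsub>E\<^esub> g \<one>\<^bsub>R\<^esub>" if "x \<in> J" for x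
      using linear_mapD(3)[OF g(1), of x "\<one>\<^bsub>R\<^esub>"] g(2)[OF that] J.Icarr[OF that] by simp
  qed
qed

text \<open>Since c is a nonzerodivisor, c |-> u defines a linear map on an ideal containing c; by
  injectivity it is multiplication by some v.\<close>

lemma injective_module_divisible:
  assumes R: "cring R" and E: "injective_module R E" and c: "c \<in> nonzerodivisors R"
    and u: "u \<in> carrier E"
  obtains v where "v \<in> carrier E" "c \<odot>\<^bsub>E\<^esub> v = u"
proof -
  interpret cring R by fact
  note RM = module_ring_module[OF R]
  have EM: "module R E" using E by (simp add: injective_module_def)
  interpret E: module R E by (rule EM)
  have cR: "c \<in> carrier R" using c by (simp add: nonzerodivisors_def)
  have sub: "submodule {\<zero>\<^bsub>R\<^esub>} R (ring_module R)" using zeroideal submodule_ring_module[OF R] by blast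
  have f0: "linear_map R ((ring_module R)\<lparr>carrier := {\<zero>\<^bsub>R\<^esub>}\<rparr>) E (\<lambda>_. \<zero>\<^bsub>E\<^esub>)"
    by (rule linear_mapI) auto
  have comp: "\<zero>\<^bsub>E\<^esub> = r \<odot>\<^bsub>E\<^esub> u" if "r \<in> carrier R" "r \<odot>\<^bsub>ring_module R\<^esub> c \<in> {\<zero>\<^bsub>R\<^esub>}" for r
  proof -
    have "c \<otimes>\<^bsub>R\<^esub> r = \<zero>\<^bsub>R\<^esub>" using that cR by (simp add: m_comm)
    then have "r = \<zero>\<^bsub>R\<^esub>" using c that(1) unfolding nonzerodivisors_def by blast
    then show ?thesis using u by simp
  qed
  obtain B g where B: "submodule B R (ring_module R)" "c \<in> B"
    "linear_map R ((ring_module R)\<lparr>carrier := B\<rparr>) E g" "g c = u"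
    using linear_map_extend_one[of R "ring_module R" E "{\<zero>\<^bsub>R\<^esub>}" "\<lambda>_. \<zero>\<^bsub>E\<^esub>" c u, OF RM EM sub f0 _ u comp] cR
    by auto
  have "ideal B R" using B(1) submodule_ring_module[OF R] by blast
  then obtain v where "v \<in> carrier E" "\<And>x. x \<in> B \<Longrightarrow> g x = x \<odot>\<^bsub>E\<^esub> v"
    using injective_module_ideal[OF R E _ B(3)] by metis
  then show ?thesis using that B(2,4) by metis
qed

text \<open>Baer's argument with residue fields as the only test modules: if a maximal domain J' of
  an extension is proper, \<open>proper_ideal_colon_maximal\<close> gives y outside J' for which the
  obstruction is a map m -> K with m maximal and c in m, and \<open>max\<close> removes it.\<close>

lemma injective_overI_maximal:
  assumes R: "cring R" and N: "noetherian_ring R" and dim: "krull_dim R = 1"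
    and c: "c \<in> nonzerodivisors R" and K: "module R K"
    and max: "\<And>m f. maximalideal m R \<Longrightarrow> c \<in> m \<Longrightarrow>
      linear_map R ((ring_module R)\<lparr>carrier := m\<rparr>) K f \<Longrightarrow> \<exists>v\<in>carrier K. \<forall>a\<in>m. f a = a \<odot>\<^bsub>K\<^esub> v"
  shows "injective_over R c K"
  unfolding injective_over_def
proof (intro allI impI)
  fix J f assume J: "ideal J R" "c \<in> J" and f: "linear_map R ((ring_module R)\<lparr>carrier := J\<rparr>) K f"
  interpret cring R by fact
  note RM = module_ring_module[OF R]
  \<comment> \<open>Only the domain of an extension is recorded, so the maximal condition on ideals
    can stand in for an order on partial maps.\<close>
  define P where "P J' \<longleftrightarrow> (\<exists>g. linear_map R ((ring_module R)\<lparr>carrier := J'\<rparr>) K g \<and> (\<forall>x\<in>J. g x = f x))" for J'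
  have "P J" using f unfolding P_def by blast
  from noetherian_maximal_ideal_with[of R J P, OF N J(1) this]
  obtain J' where J': "ideal J' R" "P J'" "J \<subseteq> J'"
    and J'max: "\<forall>B. ideal B R \<longrightarrow> P B \<longrightarrow> J' \<subseteq> B \<longrightarrow> B = J'" by (elim exE conjE)
  obtain g where g: "linear_map R ((ring_module R)\<lparr>carrier := J'\<rparr>) K g" "\<forall>x\<in>J. g x = f x"
    using J'(2) unfolding P_def by (elim exE conjE)
  have cJ': "c \<in> J'" using J(2) J'(3) by blast
  have "J' = carrier R"
  proof (rule ccontr)
    assume "J' \<noteq> carrier R"
    from proper_ideal_colon_maximal[OF R N dim J'(1) this cJ' c]
    obtain y where y: "y \<in> carrier R" "y \<notin> J'" and m: "maximalideal {r \<in> carrier R. r \<otimes>\<^bsub>R\<^esub> y \<in> J'} R"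
      by metis
    have sub: "submodule J' R (ring_module R)" using J'(1) submodule_ring_module[OF R] by blast
    have cm: "c \<in> {r \<in> carrier R. r \<otimes>\<^bsub>R\<^esub> y \<in> J'}"
      using c ideal.I_r_closed[OF J'(1) cJ' y(1)] by (simp add: nonzerodivisors_def)
    obtain v where v: "v \<in> carrier K" "\<forall>a\<in>{r \<in> carrier R. r \<otimes>\<^bsub>R\<^esub> y \<in> J'}. g (a \<otimes>\<^bsub>R\<^esub> y) = a \<odot>\<^bsub>K\<^esub> v"
      using max[OF m cm] linear_map_colon(2)[OF R RM sub _ g(1), of y] y(1) by auto
    have comp: "g (r \<odot>\<^bsub>ring_module R\<^esub> y) = r \<odot>\<^bsub>K\<^esub> v"
      if "r \<in> carrier R" "r \<odot>\<^bsub>ring_module R\<^esub> y \<in> J'" for r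
      using that v(2) by simp
    obtain B h where B: "submodule B R (ring_module R)" "J' \<subseteq> B" "y \<in> B"
      "linear_map R ((ring_module R)\<lparr>carrier := B\<rparr>) K h" "\<forall>x\<in>J'. h x = g x"
      using linear_map_extend_one[of R "ring_module R" K J' g y v, OF RM K sub g(1) _ v(1) comp] y(1) by auto
    have "\<forall>x\<in>J. h x = f x" using g(2) B(5) J'(3) by auto
    then have "P B" unfolding P_def using B(4) by (intro exI[of _ h] conjI)
    moreover have "ideal B R" using B(1) submodule_ring_module[OF R] by blast
    ultimately have "B = J'" using J'max B(2) by simp
    then show False using B(3) y(2) by simp
  qed
  then have one: "\<one>\<^bsub>R\<^esub> \<in> J'" by simp
  have Jc: "x \<in> carrier R" if "x \<in> J" for x using ideal.Icarr[OF J(1) that] .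
  show "\<exists>u\<in>carrier K. \<forall>x\<in>J. f x = x \<odot>\<^bsub>K\<^esub> u"
  proof (intro bexI[of _ "g \<one>\<^bsub>R\<^esub>"] ballI)
    show "g \<one>\<^bsub>R\<^esub> \<in> carrier K" using linear_mapD(1)[OF g(1)] one by simp
    fix x assume x: "x \<in> J"
    then have "g (x \<otimes>\<^bsub>R\<^esub> \<one>\<^bsub>R\<^esub>) = x \<odot>\<^bsub>K\<^esub> g \<one>\<^bsub>R\<^esub>"
      using linear_mapD(3)[OF g(1), of x "\<one>\<^bsub>R\<^esub>"] one Jc by simp
    then show "f x = x \<odot>\<^bsub>K\<^esub> g \<one>\<^bsub>R\<^esub>" using g(2) x Jc by simp
  qed
qed

text \<open>One step of the induction along the resolution, for 0 -> K -> E -> K' -> 0 with E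
  injective. Embed the residue field k into R/c with cokernel C. Then Ext^1(k, K) sits between
  Ext^1(R/c, K) = K / c K, zero by \<open>div\<close>, and Ext^2(C, K) = Ext^1(C, K'), zero by the
  hypothesis on the image. The proof writes the connecting maps out with elements.\<close>

lemma injective_over_kernel:
  assumes R: "cring R" and N: "noetherian_ring R" and dim: "krull_dim R = 1"
    and loc: "local_ring R" and c: "c \<in> nonzerodivisors R"
    and E: "injective_module R E" and E': "module R E'" and d: "linear_map R E E' d"
    and K: "K = module_ker E E' d"
    and K': "injective_over R c (E'\<lparr>carrier := d ` carrier E\<rparr>)"
    and div: "\<And>u. u \<in> K \<Longrightarrow> \<exists>v\<in>K. c \<odot>\<^bsub>E\<^esub> v = u"
  shows "injective_over R c (E\<lparr>carrier := K\<rparr>)"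
proof (rule injective_overI_maximal[OF R N dim c])
  interpret cring R by fact
  note RM = module_ring_module[OF R]
  have EM: "module R E" using E by (simp add: injective_module_def)
  interpret E: module R E by (rule EM)
  interpret E': module R E' by (rule E')
  have Ksub: "submodule K R E" unfolding K by (rule submodule_ker[OF EM E' d])
  note Kd = submoduleD[OF EM Ksub]
  note dl = linear_mapD[OF d]
  have cR: "c \<in> carrier R" using c by (simp add: nonzerodivisors_def)
  have imsub: "submodule (d ` carrier E) R E'" by (rule submodule_image[OF EM E' d submodule_carrier[OF EM]])
  show "module R (E\<lparr>carrier := K\<rparr>)" by (rule submodule_module[OF EM Ksub])
  fix m \<phi> assume m: "maximalideal m R" and cm: "c \<in> m"
    and \<phi>: "linear_map R ((ring_module R)\<lparr>carrier := m\<rparr>) (E\<lparr>carrier := K\<rparr>) \<phi>"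
  interpret m: maximalideal m R by (rule m)
  \<comment> \<open>Inside the injective module E the map is multiplication by u. It remains to move
    u into K; the defect d u is annihilated by m.\<close>
  obtain u where u: "u \<in> carrier E" "\<And>a. a \<in> m \<Longrightarrow> \<phi> a = a \<odot>\<^bsub>E\<^esub> u"
    using injective_module_ideal[OF R E m.is_ideal linear_map_from_subset[OF \<phi> Kd(1)]] by metis
  have auK: "a \<odot>\<^bsub>E\<^esub> u \<in> K" if "a \<in> m" for a
    using linear_mapD(1)[OF \<phi>, of a] that u(2)[OF that] by simp
  have adu: "a \<odot>\<^bsub>E'\<^esub> d u = \<zero>\<^bsub>E'\<^esub>" if "a \<in> m" for a
    using auK[OF that] dl(3)[OF m.Icarr[OF that] u(1)] unfolding K module_ker_def by simp
  define C where "C = PIdl\<^bsub>R\<^esub> c"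
  have C: "ideal C R" unfolding C_def by (rule cgenideal_ideal[OF cR])
  have cC: "c \<in> C" unfolding C_def by (rule cgenideal_self[OF cR])
  have "C \<subseteq> m" unfolding C_def by (rule cgenideal_minimal[OF m.is_ideal cm])
  then have "C \<noteq> carrier R" using m.I_notcarr m.a_subset by blast
  from proper_ideal_colon_maximal[OF R N dim C this cC c]
  obtain y where y: "y \<in> carrier R" "y \<notin> C" and my: "maximalideal {r \<in> carrier R. r \<otimes>\<^bsub>R\<^esub> y \<in> C} R"
    by metis
  \<comment> \<open>The class of y spans a copy of a residue field in R/C; as R is local, its
    annihilator is the given m.\<close>
  have m_eq: "{r \<in> carrier R. r \<otimes>\<^bsub>R\<^esub> y \<in> C} = m"
    using loc m my unfolding local_ring_def by metis
  have Csub: "submodule C R (ring_module R)" using C submodule_ring_module[OF R] by blast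
  let ?K' = "E'\<lparr>carrier := d ` carrier E\<rparr>"
  have K'M: "module R ?K'" by (rule submodule_module[OF E' imsub])
  have f0: "linear_map R ((ring_module R)\<lparr>carrier := C\<rparr>) ?K' (\<lambda>_. \<zero>\<^bsub>E'\<^esub>)"
    using submoduleD(2)[OF E' imsub] by (intro linear_mapI) auto
  have du: "d u \<in> carrier ?K'" using u(1) by simp
  have comp: "\<zero>\<^bsub>E'\<^esub> = r \<odot>\<^bsub>?K'\<^esub> d u" if "r \<in> carrier R" "r \<odot>\<^bsub>ring_module R\<^esub> y \<in> C" for r
  proof -
    have "r \<in> m" unfolding m_eq[symmetric] using that by simp
    then show ?thesis using adu by simp
  qed
  \<comment> \<open>Sending C to 0 and y to d u is consistent because m kills d u. By the hypothesis
    on the image this map is multiplication by some v, whence c v = 0 and y v = d u.\<close>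
  obtain B g where B: "submodule B R (ring_module R)" "C \<subseteq> B" "y \<in> B"
    "linear_map R ((ring_module R)\<lparr>carrier := B\<rparr>) ?K' g" "\<forall>x\<in>C. g x = \<zero>\<^bsub>E'\<^esub>" "g y = d u"
    using linear_map_extend_one[of R "ring_module R" ?K' C "\<lambda>_. \<zero>\<^bsub>E'\<^esub>" y "d u", OF RM K'M Csub f0 _ du comp] y(1)
    by auto
  have Bi: "ideal B R" using B(1) submodule_ring_module[OF R] by blast
  have cB: "c \<in> B" using cC B(2) by blast
  from injective_overD[OF K' Bi cB B(4)]
  obtain v where "v \<in> carrier ?K'" "\<forall>x\<in>B. g x = x \<odot>\<^bsub>?K'\<^esub> v" by (rule bexE)
  then have v: "v \<in> d ` carrier E" "\<forall>x\<in>B. g x = x \<odot>\<^bsub>E'\<^esub> v" by simp_all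
  have cv: "c \<odot>\<^bsub>E'\<^esub> v = \<zero>\<^bsub>E'\<^esub>"
  proof -
    have "g c = c \<odot>\<^bsub>E'\<^esub> v" using v(2) cB by (rule bspec)
    moreover have "g c = \<zero>\<^bsub>E'\<^esub>" using B(5) cC by (rule bspec)
    ultimately show ?thesis by simp
  qed
  have yv: "y \<odot>\<^bsub>E'\<^esub> v = d u" using bspec[OF v(2) B(3)] B(6) by simp
  obtain w where w: "w \<in> carrier E" "v = d w" using v(1) by blast
  \<comment> \<open>A preimage w of v need not be killed by c, but c w lies in K. Dividing c w by c
    inside K gives a correction w' that leaves the image v unchanged.\<close>
  have "c \<odot>\<^bsub>E\<^esub> w \<in> K" unfolding K module_ker_def using w cR cv dl(3)[OF cR w(1)] by simp
  then obtain w' where w': "w' \<in> K" "c \<odot>\<^bsub>E\<^esub> w' = c \<odot>\<^bsub>E\<^esub> w" using div by blast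
  have w'E: "w' \<in> carrier E" using w'(1) Kd(1) by blast
  define w2 where "w2 = w \<ominus>\<^bsub>E\<^esub> w'"
  have w2: "w2 \<in> carrier E" unfolding w2_def using w(1) w'E by simp
  have cw2: "c \<odot>\<^bsub>E\<^esub> w2 = \<zero>\<^bsub>E\<^esub>"
    unfolding w2_def a_minus_def using w(1) w'E cR w'(2)
    by (simp add: E.smult_r_distr E.smult_r_minus E.M.r_neg)
  have dw': "d w' = \<zero>\<^bsub>E'\<^esub>" using w'(1) unfolding K module_ker_def by simp
  have dw2: "d w2 = v"
    unfolding w2_def linear_map_diff[OF EM E' d w(1) w'E] dw' w(2)
    using dl(1)[OF w(1)] by (simp add: a_minus_def)
  \<comment> \<open>Subtracting y w2 moves u into K. The products with a in m stay the same, since a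
    y is a multiple of c and c kills w2.\<close>
  define v0 where "v0 = u \<ominus>\<^bsub>E\<^esub> y \<odot>\<^bsub>E\<^esub> w2"
  have yw2: "y \<odot>\<^bsub>E\<^esub> w2 \<in> carrier E" using y(1) w2 by simp
  have "d v0 = d u \<ominus>\<^bsub>E'\<^esub> y \<odot>\<^bsub>E'\<^esub> v"
    unfolding v0_def linear_map_diff[OF EM E' d u(1) yw2] dl(3)[OF y(1) w2] dw2 ..
  also have "\<dots> = \<zero>\<^bsub>E'\<^esub>" unfolding yv using dl(1)[OF u(1)] by (simp add: a_minus_def E'.M.r_neg)
  finally have "v0 \<in> K" unfolding K module_ker_def v0_def using u(1) yw2 by simp
  moreover have "\<phi> a = a \<odot>\<^bsub>E\<^esub> v0" if a: "a \<in> m" for a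
  proof -
    have aR: "a \<in> carrier R" using a m.Icarr by blast
    have "a \<otimes>\<^bsub>R\<^esub> y \<in> C" using a m_eq by blast
    then obtain x where x: "x \<in> carrier R" "a \<otimes>\<^bsub>R\<^esub> y = x \<otimes>\<^bsub>R\<^esub> c"
      unfolding C_def cgenideal_def by blast
    have "a \<odot>\<^bsub>E\<^esub> (y \<odot>\<^bsub>E\<^esub> w2) = (a \<otimes>\<^bsub>R\<^esub> y) \<odot>\<^bsub>E\<^esub> w2" using aR y(1) w2 by (simp add: E.smult_assoc1)
    also have "\<dots> = x \<odot>\<^bsub>E\<^esub> (c \<odot>\<^bsub>E\<^esub> w2)" unfolding x(2) using x(1) cR w2 by (simp add: E.smult_assoc1)
    also have "\<dots> = \<zero>\<^bsub>E\<^esub>" unfolding cw2 using x(1) by simp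
    finally have "a \<odot>\<^bsub>E\<^esub> (y \<odot>\<^bsub>E\<^esub> w2) = \<zero>\<^bsub>E\<^esub>" .
    then have "a \<odot>\<^bsub>E\<^esub> v0 = a \<odot>\<^bsub>E\<^esub> u"
      unfolding v0_def a_minus_def using aR u(1) yw2 by (simp add: E.smult_r_distr E.smult_r_minus)
    then show ?thesis using u(2)[OF a] by simp
  qed
  ultimately show "\<exists>v\<in>carrier (E\<lparr>carrier := K\<rparr>). \<forall>a\<in>m. \<phi> a = a \<odot>\<^bsub>E\<lparr>carrier := K\<rparr>\<^esub> v" by auto
qed

text \<open>Descending induction over the cosyzygies, starting where they are zero. Each is the
  image of an injective, hence c-divisible, module; this supplies the hypothesis \<open>div\<close>
  of \<open>injective_over_kernel\<close>.\<close>

lemma injective_resolution_injective_over: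
  fixes I :: "nat \<Rightarrow> ('a, 'e) module"
  assumes R: "cring R" and N: "noetherian_ring R" and dim: "krull_dim R = 1"
    and loc: "local_ring R" and c: "c \<in> nonzerodivisors R"
    and res: "injective_resolution R M I d e" and fin: "\<And>i. i > n \<Longrightarrow> carrier (I i) = {\<zero>\<^bsub>I i\<^esub>}"
  shows "injective_over R c ((I (Suc j))\<lparr>carrier := d j ` carrier (I j)\<rparr>)"
proof -
  have inj: "injective_module R (I i)" for i using res by (simp add: injective_resolution_def)
  then have mod: "module R (I i)" for i by (simp add: injective_module_def)
  have d: "linear_map R (I i) (I (Suc i)) (d i)" for i
    using res unfolding injective_resolution_def by (intro module_hom_linear_map) blast
  have ex: "d i ` carrier (I i) = module_ker (I (Suc i)) (I (Suc (Suc i))) (d (Suc i))" for i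
    using res unfolding injective_resolution_def by blast
  have cR: "c \<in> carrier R" using c by (simp add: nonzerodivisors_def)
  define P where "P j \<longleftrightarrow> injective_over R c ((I (Suc j))\<lparr>carrier := d j ` carrier (I j)\<rparr>)" for j
  have P_top: "P j" if "j \<ge> n" for j
  proof -
    interpret J: module R "I (Suc j)" by (rule mod)
    interpret J': module R "I j" by (rule mod)
    have "d j ` carrier (I j) \<subseteq> {\<zero>\<^bsub>I (Suc j)\<^esub>}" using fin[of "Suc j"] that linear_mapD(1)[OF d[of j]] by auto
    moreover have "d j ` carrier (I j) \<noteq> {}" using J'.M.zero_closed by blast
    ultimately have im: "d j ` carrier (I j) = {\<zero>\<^bsub>I (Suc j)\<^esub>}" by (simp add: subset_singleton_iff)
    show ?thesis unfolding P_def im injective_over_def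
    proof (intro allI impI)
      fix J f assume J: "ideal J R"
        and f: "linear_map R ((ring_module R)\<lparr>carrier := J\<rparr>) ((I (Suc j))\<lparr>carrier := {\<zero>\<^bsub>I (Suc j)\<^esub>}\<rparr>) f"
      show "\<exists>u\<in>carrier ((I (Suc j))\<lparr>carrier := {\<zero>\<^bsub>I (Suc j)\<^esub>}\<rparr>). \<forall>x\<in>J. f x = x \<odot>\<^bsub>(I (Suc j))\<lparr>carrier := {\<zero>\<^bsub>I (Suc j)\<^esub>}\<rparr>\<^esub> u"
        using linear_mapD(1)[OF f] ideal.Icarr[OF J] by simp
    qed
  qed
  have P_step: "P j" if "P (Suc j)" for j
    unfolding P_def
  proof (rule injective_over_kernel[OF R N dim loc c inj mod d ex])
    show "injective_over R c ((I (Suc (Suc j)))\<lparr>carrier := d (Suc j) ` carrier (I (Suc j))\<rparr>)"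
      using that by (simp add: P_def)
    fix u assume "u \<in> d j ` carrier (I j)"
    then obtain w where w: "w \<in> carrier (I j)" "u = d j w" by blast
    from injective_module_divisible[OF R inj c w(1)]
    obtain z where z: "z \<in> carrier (I j)" "c \<odot>\<^bsub>I j\<^esub> z = w" by metis
    have "c \<odot>\<^bsub>I (Suc j)\<^esub> d j z = u" using linear_mapD(3)[OF d cR z(1)] z(2) w(2) by simp
    then show "\<exists>v\<in>d j ` carrier (I j). c \<odot>\<^bsub>I (Suc j)\<^esub> v = u" using z(1) by blast
  qed
  \<comment> \<open>Downward induction by truncated subtraction: k = n - j reaches every j up to n,
    and \<open>P_top\<close> covers larger j.\<close>
  have "P (n - k)" for k
  proof (induction k)
    case 0
    show ?case by (simp add: P_top)
  next
    case (Suc k)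
    then show ?case by (cases "k < n") (use P_step[of "n - Suc k"] in \<open>auto simp: Suc_diff_Suc\<close>)
  qed
  from this[of "n - j"] P_top[of j] have "P j" by (cases "j \<le> n") auto
  then show ?thesis by (simp add: P_def)
qed

text \<open>The unit vectors are adjoined one by one. Because A contains c F, every colon ideal met
  on the way contains c, so \<open>injective_over\<close> handles each obstruction.\<close>

lemma injective_over_extend_free:
  assumes R: "cring R" and K: "module R K" "injective_over R c K" and cR: "c \<in> carrier R"
    and A: "submodule A R (free_module R n)"
    and cA: "\<And>x. x \<in> carrier (free_module R n) \<Longrightarrow> c \<odot>\<^bsub>free_module R n\<^esub> x \<in> A"
    and f: "linear_map R ((free_module R n)\<lparr>carrier := A\<rparr>) K f"
  obtains g where "linear_map R (free_module R n) K g" "\<And>x. x \<in> A \<Longrightarrow> g x = f x"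
proof -
  let ?F = "free_module R n"
  note F = module_free_module[OF R, of n]
  have "k \<le> n \<Longrightarrow> \<exists>B g. submodule B R ?F \<and> A \<subseteq> B \<and> (\<forall>i<k. unit_vec R n i \<in> B) \<and>
      linear_map R (?F\<lparr>carrier := B\<rparr>) K g \<and> (\<forall>x\<in>A. g x = f x)" for k
  proof (induction k)
    case 0
    show ?case using A f by (intro exI[of _ A] exI[of _ f]) auto
  next
    case (Suc k)
    then obtain B g where B: "submodule B R ?F" "A \<subseteq> B" "\<forall>i<k. unit_vec R n i \<in> B"
      "linear_map R (?F\<lparr>carrier := B\<rparr>) K g" "\<forall>x\<in>A. g x = f x" by auto
    let ?e = "unit_vec R n k"
    have e: "?e \<in> carrier ?F" by (rule unit_vec_carrier[OF R])
    define J where "J = {r \<in> carrier R. r \<odot>\<^bsub>?F\<^esub> ?e \<in> B}"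
    note J = linear_map_colon[OF R F B(1) e B(4), folded J_def]
    have "c \<in> J" unfolding J_def using cA[OF e] B(2) cR by auto
    then obtain u where u: "u \<in> carrier K" "\<forall>r\<in>J. g (r \<odot>\<^bsub>?F\<^esub> ?e) = r \<odot>\<^bsub>K\<^esub> u"
      using injective_overD[OF K(2) J(1) _ J(2)] by blast
    have comp: "g (r \<odot>\<^bsub>?F\<^esub> ?e) = r \<odot>\<^bsub>K\<^esub> u" if "r \<in> carrier R" "r \<odot>\<^bsub>?F\<^esub> ?e \<in> B" for r
      using u(2) that unfolding J_def by blast
    obtain B' h where B': "submodule B' R ?F" "B \<subseteq> B'" "?e \<in> B'"
      "linear_map R (?F\<lparr>carrier := B'\<rparr>) K h" "\<forall>x\<in>B. h x = g x"
      using linear_map_extend_one[of R ?F K B g ?e u, OF F K(1) B(1,4) e u(1) comp] by auto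
    have "\<forall>i<Suc k. unit_vec R n i \<in> B'" using B(3) B'(2,3) by (auto simp: less_Suc_eq)
    moreover have "\<forall>x\<in>A. h x = f x" using B'(5) B(2,5) by auto
    moreover have "A \<subseteq> B'" using B(2) B'(2) by blast
    ultimately show ?case using B'(1,4) by (intro exI[of _ B'] exI[of _ h] conjI)
  qed
  from this[of n] obtain B g where B: "submodule B R ?F" "\<forall>i<n. unit_vec R n i \<in> B"
    "linear_map R (?F\<lparr>carrier := B\<rparr>) K g" "\<forall>x\<in>A. g x = f x" by auto
  have "B = carrier ?F" using free_module_span[OF R B(1)] B(2) by blast
  then have "linear_map R ?F K g" using B(3) unfolding linear_map_def by simp
  then show ?thesis using that B(4) by blast
qed

section \<open>Vanishing of Ext into a Gorenstein ring\<close>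

lemma linear_map_lift_injective:
  assumes M: "module R M" and P: "module R P" and N: "module R N"
    and f: "linear_map R M N f" and e: "linear_map R P N e" and inj: "inj_on e (carrier P)"
    and sub: "\<And>x. x \<in> carrier M \<Longrightarrow> f x \<in> e ` carrier P"
  shows "\<exists>g. linear_map R M P g \<and> (\<forall>x\<in>carrier M. e (g x) = f x)"
proof -
  interpret M: module R M by fact
  interpret P: module R P by fact
  define g where "g x = inv_into (carrier P) e (f x)" for x
  have g: "g x \<in> carrier P" "e (g x) = f x" if "x \<in> carrier M" for x
    using sub[OF that] unfolding g_def by (auto intro: inv_into_into f_inv_into_f)
  note fl = linear_mapD[OF f] and el = linear_mapD[OF e]
  have "linear_map R M P g"
  proof (rule linear_mapI)
    fix x y assume x: "x \<in> carrier M" and y: "y \<in> carrier M"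
    have "e (g (x \<oplus>\<^bsub>M\<^esub> y)) = e (g x \<oplus>\<^bsub>P\<^esub> g y)"
      using g[OF x] g[OF y] g[of "x \<oplus>\<^bsub>M\<^esub> y"] x y by (simp add: el(2) fl(2))
    then show "g (x \<oplus>\<^bsub>M\<^esub> y) = g x \<oplus>\<^bsub>P\<^esub> g y"
      using x y g by (intro inj_onD[OF inj]) auto
  next
    fix r x assume r: "r \<in> carrier R" and x: "x \<in> carrier M"
    have "e (g (r \<odot>\<^bsub>M\<^esub> x)) = e (r \<odot>\<^bsub>P\<^esub> g x)"
      using g[OF x] g[of "r \<odot>\<^bsub>M\<^esub> x"] x r by (simp add: el(3) fl(3))
    then show "g (r \<odot>\<^bsub>M\<^esub> x) = r \<odot>\<^bsub>P\<^esub> g x"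
      using x r g by (intro inj_onD[OF inj]) auto
  qed (rule g)
  then show ?thesis using g(2) by blast
qed

text \<open>For \<open>T = F / L\<close> this says \<open>Ext\<^sup>1(T, R) = 0\<close>. The map \<open>\<gamma>\<close> makes \<open>c\<close> annihilate this module,
  while multiplication by \<open>c\<close> is onto because \<open>Ext\<^sup>2(T / c T, R) = 0\<close>.\<close>

lemma free_module_hom_extend_ring:
  fixes I :: "nat \<Rightarrow> ('a, 'e) module"
  assumes R: "cring R" and N: "noetherian_ring R" and dim: "krull_dim R = 1"
    and loc: "local_ring R" and c: "c \<in> nonzerodivisors R"
    and res: "injective_resolution R (ring_module R) I d \<eta>"
    and fin: "\<And>i. i > m \<Longrightarrow> carrier (I i) = {\<zero>\<^bsub>I i\<^esub>}"
    and L: "submodule L R (free_module R n)"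
    and sat: "\<And>u. u \<in> carrier (free_module R n) \<Longrightarrow> c \<odot>\<^bsub>free_module R n\<^esub> u \<in> L \<Longrightarrow> u \<in> L"
    and \<gamma>: "linear_map R (free_module R n) (free_module R n) \<gamma>"
    and \<gamma>L: "\<And>x. x \<in> carrier (free_module R n) \<Longrightarrow> \<gamma> x \<in> L"
    and \<gamma>c: "\<And>x. x \<in> L \<Longrightarrow> \<gamma> x = c \<odot>\<^bsub>free_module R n\<^esub> x"
    and f: "linear_map R ((free_module R n)\<lparr>carrier := L\<rparr>) (ring_module R) f"
  shows "\<exists>k. linear_map R (free_module R n) (ring_module R) k \<and> (\<forall>x\<in>L. k x = f x)"
proof -
  let ?F = "free_module R n" and ?R = "ring_module R"
  note F = module_free_module[OF R, of n] and RM = module_ring_module[OF R]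
  have inj: "injective_module R (I i)" for i using res by (simp add: injective_resolution_def)
  then have mod: "module R (I i)" for i by (simp add: injective_module_def)
  have d0: "linear_map R (I 0) (I (Suc 0)) (d 0)"
    using res unfolding injective_resolution_def by (intro module_hom_linear_map) blast
  have \<eta>: "linear_map R ?R (I 0) \<eta>"
    using res unfolding injective_resolution_def by (intro module_hom_linear_map) blast
  have \<eta>inj: "inj_on \<eta> (carrier ?R)" using res unfolding injective_resolution_def by blast
  have ker: "\<eta> ` carrier ?R = module_ker (I 0) (I (Suc 0)) (d 0)"
    using res unfolding injective_resolution_def by (metis One_nat_def)
  interpret F: module R ?F by (rule F)
  interpret E: module R "I 0" by (rule mod)
  interpret E1: module R "I (Suc 0)" by (rule mod)
  note L' = submoduleD[OF F L]
  have LF: "x \<in> carrier ?F" if "x \<in> L" for x using that L'(1) by blast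
  have cR: "c \<in> carrier R" using c by (simp add: nonzerodivisors_def)
  note d0l = linear_mapD[OF d0] and \<gamma>l = linear_mapD[OF \<gamma>]
  have f\<eta>: "linear_map R (?F\<lparr>carrier := L\<rparr>) (I 0) (\<lambda>x. \<eta> (f x))" by (rule linear_map_comp[OF f \<eta>])
  have "inj_on (\<lambda>x::nat \<Rightarrow> 'a. {x}) (carrier ?F)" by simp
  \<comment> \<open>Followed by the embedding of R into \<open>I 0\<close>, the map f extends to g
    on F. It remains to correct g, without changing it on L, so that \<open>d 0\<close> kills its
    values.\<close>
  then obtain g where g: "linear_map R ?F (I 0) g" "\<And>x. x \<in> L \<Longrightarrow> g x = \<eta> (f x)"
    using injective_module_extend[OF inj F _ L f\<eta>] by metis
  note gl = linear_mapD[OF g(1)]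
  have \<phi>: "linear_map R ?F (I (Suc 0)) (\<lambda>x. d 0 (g x))" by (rule linear_map_comp[OF g(1) d0])
  have \<phi>L: "d 0 (g l) = \<zero>\<^bsub>I (Suc 0)\<^esub>" if "l \<in> L" for l
  proof -
    have "f l \<in> carrier ?R" using linear_mapD(1)[OF f, of l] that by simp
    then have "\<eta> (f l) \<in> module_ker (I 0) (I (Suc 0)) (d 0)" using ker by blast
    then show ?thesis using g(2)[OF that] by (simp add: module_ker_def)
  qed
  \<comment> \<open>A = c F + L, so that F/A is T / c T for T = F/L.\<close>
  define A where "A = {c \<odot>\<^bsub>?F\<^esub> u \<oplus>\<^bsub>?F\<^esub> l | u l. u \<in> carrier ?F \<and> l \<in> L}"
  have AI: "c \<odot>\<^bsub>?F\<^esub> u \<oplus>\<^bsub>?F\<^esub> l \<in> A" if "u \<in> carrier ?F" "l \<in> L" for u l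
    unfolding A_def by (intro CollectI exI[of _ u] exI[of _ l] conjI refl that)
  have AE: "\<exists>u l. u \<in> carrier ?F \<and> l \<in> L \<and> a = c \<odot>\<^bsub>?F\<^esub> u \<oplus>\<^bsub>?F\<^esub> l" if "a \<in> A" for a
    using that unfolding A_def by (elim CollectE exE conjE) (intro exI conjI)
  have addA: "(c \<odot>\<^bsub>?F\<^esub> u \<oplus>\<^bsub>?F\<^esub> l) \<oplus>\<^bsub>?F\<^esub> (c \<odot>\<^bsub>?F\<^esub> u' \<oplus>\<^bsub>?F\<^esub> l') = c \<odot>\<^bsub>?F\<^esub> (u \<oplus>\<^bsub>?F\<^esub> u') \<oplus>\<^bsub>?F\<^esub> (l \<oplus>\<^bsub>?F\<^esub> l')"
    if "u \<in> carrier ?F" "l \<in> L" "u' \<in> carrier ?F" "l' \<in> L" for u l u' l'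
    using that LF cR by (simp add: F.smult_r_distr F.M.a_ac del: free_module_simps)
  have smA: "r \<odot>\<^bsub>?F\<^esub> (c \<odot>\<^bsub>?F\<^esub> u \<oplus>\<^bsub>?F\<^esub> l) = c \<odot>\<^bsub>?F\<^esub> (r \<odot>\<^bsub>?F\<^esub> u) \<oplus>\<^bsub>?F\<^esub> r \<odot>\<^bsub>?F\<^esub> l"
    if "r \<in> carrier R" "u \<in> carrier ?F" "l \<in> L" for r u l
    using that LF cR by (simp add: F.smult_r_distr F.smult_assoc1[symmetric] F.R.m_comm del: free_module_simps)
  have A: "submodule A R ?F"
  proof (rule submoduleI'[OF F])
    show "A \<subseteq> carrier ?F"
    proof
      fix a assume "a \<in> A"
      then obtain u l where "u \<in> carrier ?F" "l \<in> L" "a = c \<odot>\<^bsub>?F\<^esub> u \<oplus>\<^bsub>?F\<^esub> l" using AE by metis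
      then show "a \<in> carrier ?F" using LF cR by (simp del: free_module_simps)
    qed
    have "c \<odot>\<^bsub>?F\<^esub> \<zero>\<^bsub>?F\<^esub> \<oplus>\<^bsub>?F\<^esub> \<zero>\<^bsub>?F\<^esub> = \<zero>\<^bsub>?F\<^esub>" using cR by (simp del: free_module_simps)
    then show "\<zero>\<^bsub>?F\<^esub> \<in> A" using AI[OF F.M.zero_closed L'(2)] by simp
  next
    fix a b assume "a \<in> A" "b \<in> A"
    then obtain u l u' l' where *: "u \<in> carrier ?F" "l \<in> L" "u' \<in> carrier ?F" "l' \<in> L"
      "a = c \<odot>\<^bsub>?F\<^esub> u \<oplus>\<^bsub>?F\<^esub> l" "b = c \<odot>\<^bsub>?F\<^esub> u' \<oplus>\<^bsub>?F\<^esub> l'" using AE by metis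
    show "a \<oplus>\<^bsub>?F\<^esub> b \<in> A" unfolding *(5,6) addA[OF *(1-4)]
      by (rule AI[OF F.M.a_closed[OF *(1,3)] L'(3)[OF *(2,4)]])
  next
    fix r a assume r: "r \<in> carrier R" and "a \<in> A"
    then obtain u l where *: "u \<in> carrier ?F" "l \<in> L" "a = c \<odot>\<^bsub>?F\<^esub> u \<oplus>\<^bsub>?F\<^esub> l" using AE by metis
    show "r \<odot>\<^bsub>?F\<^esub> a \<in> A" unfolding *(3) smA[OF r *(1,2)]
      by (rule AI[OF F.smult_closed[OF r *(1)] L'(4)[OF r *(2)]])
  qed
  \<comment> \<open>Division of \<open>d 0 (g u)\<close> by c: the element c u + l is sent to
    \<open>d 0 (g u)\<close>. The hypothesis \<open>sat\<close> makes this independent of u, since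
    \<open>d 0 (g u)\<close> vanishes for u in L.\<close>
  define \<psi>0 where "\<psi>0 a = d 0 (g (SOME u. u \<in> carrier ?F \<and> (\<exists>l\<in>L. a = c \<odot>\<^bsub>?F\<^esub> u \<oplus>\<^bsub>?F\<^esub> l)))" for a
  have \<psi>0: "\<psi>0 (c \<odot>\<^bsub>?F\<^esub> u \<oplus>\<^bsub>?F\<^esub> l) = d 0 (g u)" if u: "u \<in> carrier ?F" and l: "l \<in> L" for u l
  proof -
    define P where "P v \<longleftrightarrow> v \<in> carrier ?F \<and> (\<exists>l'\<in>L. c \<odot>\<^bsub>?F\<^esub> u \<oplus>\<^bsub>?F\<^esub> l = c \<odot>\<^bsub>?F\<^esub> v \<oplus>\<^bsub>?F\<^esub> l')" for v
    define v where "v = (SOME v. P v)"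
    have "P u" unfolding P_def by (intro conjI bexI[of _ l] refl u l)
    then have "P v" unfolding v_def by (rule someI[of P u])
    then obtain l' where v: "v \<in> carrier ?F" "l' \<in> L"
      "c \<odot>\<^bsub>?F\<^esub> u \<oplus>\<^bsub>?F\<^esub> l = c \<odot>\<^bsub>?F\<^esub> v \<oplus>\<^bsub>?F\<^esub> l'" unfolding P_def by (elim conjE bexE)
    let ?cu = "c \<odot>\<^bsub>?F\<^esub> u" and ?cv = "c \<odot>\<^bsub>?F\<^esub> v"
    have cl: "?cu \<in> carrier ?F" "?cv \<in> carrier ?F" "l \<in> carrier ?F" "l' \<in> carrier ?F"
      using F.smult_closed cR u v(1) LF l v(2) by blast+
    have "?cu = (?cu \<oplus>\<^bsub>?F\<^esub> l) \<ominus>\<^bsub>?F\<^esub> l"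
      using cl by (simp add: a_minus_def F.M.a_assoc F.M.r_neg del: free_module_simps)
    also have "\<dots> = ?cv \<oplus>\<^bsub>?F\<^esub> (l' \<ominus>\<^bsub>?F\<^esub> l)"
      unfolding v(3) using cl by (simp add: a_minus_def F.M.a_assoc del: free_module_simps)
    finally have eq: "?cu = ?cv \<oplus>\<^bsub>?F\<^esub> (l' \<ominus>\<^bsub>?F\<^esub> l)" .
    have "c \<odot>\<^bsub>?F\<^esub> (u \<ominus>\<^bsub>?F\<^esub> v) = ?cu \<ominus>\<^bsub>?F\<^esub> ?cv"
      using u v(1) cR by (simp add: a_minus_def F.smult_r_distr F.smult_r_minus del: free_module_simps)
    also have "\<dots> = l' \<ominus>\<^bsub>?F\<^esub> l"
      unfolding eq using cl by (simp add: a_minus_def F.M.a_ac F.M.r_neg1 F.M.r_neg2 F.M.r_neg del: free_module_simps)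
    finally have "c \<odot>\<^bsub>?F\<^esub> (u \<ominus>\<^bsub>?F\<^esub> v) \<in> L" using L'(5)[OF v(2) l] by simp
    then have "u \<ominus>\<^bsub>?F\<^esub> v \<in> L" by (rule sat[OF F.M.minus_closed[OF u v(1)]])
    then have "d 0 (g (u \<ominus>\<^bsub>?F\<^esub> v)) = \<zero>\<^bsub>I (Suc 0)\<^esub>" by (rule \<phi>L)
    then have "d 0 (g u) \<ominus>\<^bsub>I (Suc 0)\<^esub> d 0 (g v) = \<zero>\<^bsub>I (Suc 0)\<^esub>"
      using linear_map_diff[OF F mod \<phi> u v(1)] by simp
    then have "d 0 (g u) = d 0 (g v)"
      by (rule module_minus_eq_zeroD[OF mod _ linear_mapD(1)[OF \<phi> u] linear_mapD(1)[OF \<phi> v(1)]])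
    then show ?thesis unfolding \<psi>0_def v_def P_def by simp
  qed
  let ?K = "(I (Suc 0))\<lparr>carrier := d 0 ` carrier (I 0)\<rparr>"
  have im: "submodule (d 0 ` carrier (I 0)) R (I (Suc 0))"
    by (rule submodule_image[OF mod mod d0 submodule_carrier[OF mod]])
  have K: "module R ?K" by (rule submodule_module[OF mod im])
  have Kinj: "injective_over R c ?K"
    by (rule injective_resolution_injective_over[OF R N dim loc c res fin])
  have \<psi>0lin: "linear_map R (?F\<lparr>carrier := A\<rparr>) ?K \<psi>0"
  proof (rule linear_mapI)
    fix x assume "x \<in> carrier (?F\<lparr>carrier := A\<rparr>)"
    then obtain u l where *: "u \<in> carrier ?F" "l \<in> L" "x = c \<odot>\<^bsub>?F\<^esub> u \<oplus>\<^bsub>?F\<^esub> l" using AE[of x] by auto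
    show "\<psi>0 x \<in> carrier ?K" unfolding *(3) \<psi>0[OF *(1,2)] using gl(1)[OF *(1)] by simp
  next
    fix x y assume "x \<in> carrier (?F\<lparr>carrier := A\<rparr>)" "y \<in> carrier (?F\<lparr>carrier := A\<rparr>)"
    then have "x \<in> A" "y \<in> A" by simp_all
    then obtain u l u' l' where *: "u \<in> carrier ?F" "l \<in> L" "u' \<in> carrier ?F" "l' \<in> L"
      "x = c \<odot>\<^bsub>?F\<^esub> u \<oplus>\<^bsub>?F\<^esub> l" "y = c \<odot>\<^bsub>?F\<^esub> u' \<oplus>\<^bsub>?F\<^esub> l'" using AE by metis
    have "\<psi>0 (x \<oplus>\<^bsub>?F\<^esub> y) = \<psi>0 x \<oplus>\<^bsub>I (Suc 0)\<^esub> \<psi>0 y"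
      unfolding *(5,6) addA[OF *(1-4)] \<psi>0[OF *(1,2)] \<psi>0[OF *(3,4)]
        \<psi>0[OF F.M.a_closed[OF *(1,3)] L'(3)[OF *(2,4)]]
      by (rule linear_mapD(2)[OF \<phi> *(1,3)])
    then show "\<psi>0 (x \<oplus>\<^bsub>?F\<lparr>carrier := A\<rparr>\<^esub> y) = \<psi>0 x \<oplus>\<^bsub>?K\<^esub> \<psi>0 y" by simp
  next
    fix r x assume r: "r \<in> carrier R" and "x \<in> carrier (?F\<lparr>carrier := A\<rparr>)"
    then have "x \<in> A" by simp
    then obtain u l where *: "u \<in> carrier ?F" "l \<in> L" "x = c \<odot>\<^bsub>?F\<^esub> u \<oplus>\<^bsub>?F\<^esub> l" using AE by metis
    have "\<psi>0 (r \<odot>\<^bsub>?F\<^esub> x) = r \<odot>\<^bsub>I (Suc 0)\<^esub> \<psi>0 x"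
      unfolding *(3) smA[OF r *(1,2)] \<psi>0[OF *(1,2)] \<psi>0[OF F.smult_closed[OF r *(1)] L'(4)[OF r *(2)]]
      by (rule linear_mapD(3)[OF \<phi> r *(1)])
    then show "\<psi>0 (r \<odot>\<^bsub>?F\<lparr>carrier := A\<rparr>\<^esub> x) = r \<odot>\<^bsub>?K\<^esub> \<psi>0 x" by simp
  qed
  have cu0: "c \<odot>\<^bsub>?F\<^esub> u \<oplus>\<^bsub>?F\<^esub> \<zero>\<^bsub>?F\<^esub> = c \<odot>\<^bsub>?F\<^esub> u" if "u \<in> carrier ?F" for u
    by (rule F.M.r_zero[OF F.smult_closed[OF cR that]])
  have c0l: "c \<odot>\<^bsub>?F\<^esub> \<zero>\<^bsub>?F\<^esub> \<oplus>\<^bsub>?F\<^esub> l = l" if "l \<in> L" for l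
    unfolding F.smult_r_null[OF cR] by (rule F.M.l_zero[OF LF[OF that]])
  have cA: "c \<odot>\<^bsub>?F\<^esub> u \<in> A" if "u \<in> carrier ?F" for u using AI[OF that L'(2)] cu0[OF that] by simp
  obtain \<psi> where \<psi>: "linear_map R ?F ?K \<psi>" "\<And>x. x \<in> A \<Longrightarrow> \<psi> x = \<psi>0 x"
    using injective_over_extend_free[OF R K Kinj cR A cA \<psi>0lin] by metis
  have \<psi>c: "\<psi> (c \<odot>\<^bsub>?F\<^esub> u) = d 0 (g u)" if "u \<in> carrier ?F" for u
    using \<psi>(2)[OF cA[OF that]] \<psi>0[OF that L'(2)] cu0[OF that] by simp
  have \<psi>L: "\<psi> l = \<zero>\<^bsub>I (Suc 0)\<^esub>" if "l \<in> L" for l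
  proof -
    have "l \<in> A" using AI[OF F.M.zero_closed that] c0l[OF that] by simp
    then have "\<psi> l = d 0 (g \<zero>\<^bsub>?F\<^esub>)"
      using \<psi>(2) \<psi>0[OF F.M.zero_closed that] c0l[OF that] by simp
    then show ?thesis using \<phi>L[OF L'(2)] by simp
  qed
  have D: "linear_map R (I 0) ?K (d 0)" by (rule linear_map_into_subset[OF d0]) simp
  have "\<psi> x \<in> d 0 ` carrier (I 0)" if "x \<in> carrier ?F" for x
    using linear_mapD(1)[OF \<psi>(1) that] by simp
  from free_module_lift[OF R mod K \<psi>(1) D this]
  obtain p where p: "linear_map R ?F (I 0) p" "\<And>x. x \<in> carrier ?F \<Longrightarrow> d 0 (p x) = \<psi> x" by metis
  note pl = linear_mapD[OF p(1)]
  \<comment> \<open>Since \<psi> (c x) = \<open>d 0 (g x)\<close>, subtracting p (c x) produces a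
    map killed by \<open>d 0\<close>, but changes g on L. Adding p (\<gamma> x) repairs this, as
    \<gamma> x = c x on L, and costs nothing, as \<psi> vanishes on L, where \<gamma> takes its
    values.\<close>
  define k where "k x = (g x \<ominus>\<^bsub>I 0\<^esub> p (c \<odot>\<^bsub>?F\<^esub> x)) \<oplus>\<^bsub>I 0\<^esub> p (\<gamma> x)" for x
  have scale: "linear_map R ?F ?F (\<lambda>x. c \<odot>\<^bsub>?F\<^esub> x)"
    by (rule linear_map_smult[OF F F linear_map_id cR])
  have k: "linear_map R ?F (I 0) k"
    unfolding k_def
    by (intro linear_map_add linear_map_minus F mod g(1) linear_map_comp[OF scale p(1)] linear_map_comp[OF \<gamma> p(1)])
  have kker: "k x \<in> \<eta> ` carrier ?R" if x: "x \<in> carrier ?F" for x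
  proof -
    have cx: "c \<odot>\<^bsub>?F\<^esub> x \<in> carrier ?F" and gx: "\<gamma> x \<in> carrier ?F"
      using F.smult_closed[OF cR x] \<gamma>l(1)[OF x] by auto
    have "d 0 (k x) = (d 0 (g x) \<ominus>\<^bsub>I (Suc 0)\<^esub> d 0 (p (c \<odot>\<^bsub>?F\<^esub> x))) \<oplus>\<^bsub>I (Suc 0)\<^esub> d 0 (p (\<gamma> x))"
      unfolding k_def using gl(1)[OF x] pl(1)[OF cx] pl(1)[OF gx] d0l(2) linear_map_diff[OF mod mod d0] by simp
    also have "\<dots> = (d 0 (g x) \<ominus>\<^bsub>I (Suc 0)\<^esub> d 0 (g x)) \<oplus>\<^bsub>I (Suc 0)\<^esub> \<zero>\<^bsub>I (Suc 0)\<^esub>"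
      unfolding p(2)[OF cx] p(2)[OF gx] \<psi>c[OF x] \<psi>L[OF \<gamma>L[OF x]] ..
    also have "\<dots> = \<zero>\<^bsub>I (Suc 0)\<^esub>"
      using linear_mapD(1)[OF \<phi> x] by (simp add: a_minus_def E1.M.r_neg)
    finally show ?thesis unfolding ker module_ker_def using linear_mapD(1)[OF k x] by simp
  qed
  obtain h where h: "linear_map R ?F ?R h" "\<forall>x\<in>carrier ?F. \<eta> (h x) = k x"
    using linear_map_lift_injective[OF F RM mod k \<eta> \<eta>inj kker] by auto
  have "h x = f x" if x: "x \<in> L" for x
  proof (rule inj_onD[OF \<eta>inj])
    have xF: "x \<in> carrier ?F" using LF x by blast
    have cx: "c \<odot>\<^bsub>?F\<^esub> x \<in> carrier ?F" by (rule F.smult_closed[OF cR xF])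
    have "k x = g x"
      unfolding k_def \<gamma>c[OF x] using gl(1)[OF xF] pl(1)[OF cx]
      by (simp add: a_minus_def E.M.a_assoc E.M.l_neg)
    then show "\<eta> (h x) = \<eta> (f x)" using h(2) xF g(2)[OF x] by simp
    show "h x \<in> carrier ?R" by (rule linear_mapD(1)[OF h(1) xF])
    show "f x \<in> carrier ?R" using linear_mapD(1)[OF f, of x] x by simp
  qed
  then show ?thesis using h(1) by blast
qed

lemma free_module_hom_extend_free:
  fixes I :: "nat \<Rightarrow> ('a, 'e) module"
  assumes R: "cring R" and N: "noetherian_ring R" and dim: "krull_dim R = 1"
    and loc: "local_ring R" and c: "c \<in> nonzerodivisors R"
    and res: "injective_resolution R (ring_module R) I d \<eta>"
    and fin: "\<And>i. i > m \<Longrightarrow> carrier (I i) = {\<zero>\<^bsub>I i\<^esub>}"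
    and L: "submodule L R (free_module R n)"
    and sat: "\<And>u. u \<in> carrier (free_module R n) \<Longrightarrow> c \<odot>\<^bsub>free_module R n\<^esub> u \<in> L \<Longrightarrow> u \<in> L"
    and \<gamma>: "linear_map R (free_module R n) (free_module R n) \<gamma>"
    and \<gamma>L: "\<And>x. x \<in> carrier (free_module R n) \<Longrightarrow> \<gamma> x \<in> L"
    and \<gamma>c: "\<And>x. x \<in> L \<Longrightarrow> \<gamma> x = c \<odot>\<^bsub>free_module R n\<^esub> x"
    and f: "linear_map R ((free_module R n)\<lparr>carrier := L\<rparr>) (free_module R q) f"
  shows "\<exists>k. linear_map R (free_module R n) (free_module R q) k \<and> (\<forall>x\<in>L. k x = f x)"
proof -
  have "\<exists>k. linear_map R (free_module R n) (ring_module R) k \<and> (\<forall>x\<in>L. k x = f x i)" if "i < q" for i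
    by (rule free_module_hom_extend_ring[OF R N dim loc c res fin L sat \<gamma> \<gamma>L \<gamma>c
          linear_map_comp[OF f free_module_coord[OF that]]])
  then obtain k where k: "\<And>i. i < q \<Longrightarrow> linear_map R (free_module R n) (ring_module R) (k i)"
    "\<And>i x. i < q \<Longrightarrow> x \<in> L \<Longrightarrow> k i x = f x i" by metis
  have "(\<lambda>i\<in>{..<q}. k i x) = f x" if "x \<in> L" for x
  proof -
    have "f x \<in> {..<q} \<rightarrow>\<^sub>E carrier R" using linear_mapD(1)[OF f, of x] that by simp
    then show ?thesis using k(2)[OF _ that] PiE_arb[of "f x" "{..<q}"] by (intro ext) (simp add: restrict_def)
  qed
  then show ?thesis using linear_map_into_free_module[of q R _ k, OF k(1)] by blast
qed

section \<open>Free resolutions\<close>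

text \<open>The factorization through P / ker D, with the quotient replaced by the image of D; h is
  defined by choosing preimages.\<close>

lemma linear_map_factor:
  assumes P: "module R P" and N: "module R N" and Q: "module R Q"
    and D: "linear_map R P N D" and k: "linear_map R P Q k"
    and ker: "\<And>x. x \<in> carrier P \<Longrightarrow> D x = \<zero>\<^bsub>N\<^esub> \<Longrightarrow> k x = \<zero>\<^bsub>Q\<^esub>"
  shows "\<exists>h. linear_map R (N\<lparr>carrier := D ` carrier P\<rparr>) Q h \<and> (\<forall>x\<in>carrier P. h (D x) = k x)"
proof -
  interpret P: module R P by fact
  interpret N: module R N by fact
  define h where "h y = k (inv_into (carrier P) D y)" for y
  note Dl = linear_mapD[OF D] and kl = linear_mapD[OF k]
  have h: "h (D x) = k x" if x: "x \<in> carrier P" for x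
  proof -
    let ?x = "inv_into (carrier P) D (D x)"
    have x': "?x \<in> carrier P" "D ?x = D x" using x by (auto intro: inv_into_into f_inv_into_f)
    have "D (?x \<ominus>\<^bsub>P\<^esub> x) = \<zero>\<^bsub>N\<^esub>"
      unfolding linear_map_diff[OF P N D x'(1) x] x'(2) using Dl(1)[OF x] by (simp add: a_minus_def N.M.r_neg)
    then have "k (?x \<ominus>\<^bsub>P\<^esub> x) = \<zero>\<^bsub>Q\<^esub>" using x'(1) x by (intro ker) auto
    then have "k ?x \<ominus>\<^bsub>Q\<^esub> k x = \<zero>\<^bsub>Q\<^esub>" using linear_map_diff[OF P Q k x'(1) x] by simp
    then show ?thesis unfolding h_def by (rule module_minus_eq_zeroD[OF Q _ kl(1)[OF x'(1)] kl(1)[OF x]])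
  qed
  have "linear_map R (N\<lparr>carrier := D ` carrier P\<rparr>) Q h"
  proof (rule linear_mapI)
    fix y assume "y \<in> carrier (N\<lparr>carrier := D ` carrier P\<rparr>)"
    then show "h y \<in> carrier Q" using h kl(1) by auto
  next
    fix y y' assume "y \<in> carrier (N\<lparr>carrier := D ` carrier P\<rparr>)" "y' \<in> carrier (N\<lparr>carrier := D ` carrier P\<rparr>)"
    then obtain x x' where x: "x \<in> carrier P" "x' \<in> carrier P" "y = D x" "y' = D x'" by auto
    show "h (y \<oplus>\<^bsub>N\<lparr>carrier := D ` carrier P\<rparr>\<^esub> y') = h y \<oplus>\<^bsub>Q\<^esub> h y'"
      unfolding x(3,4) using h[of "x \<oplus>\<^bsub>P\<^esub> x'"] x(1,2) by (simp add: Dl(2) kl(2) h)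
  next
    fix r y assume r: "r \<in> carrier R" and "y \<in> carrier (N\<lparr>carrier := D ` carrier P\<rparr>)"
    then obtain x where x: "x \<in> carrier P" "y = D x" by auto
    show "h (r \<odot>\<^bsub>N\<lparr>carrier := D ` carrier P\<rparr>\<^esub> y) = r \<odot>\<^bsub>Q\<^esub> h y"
      unfolding x(2) using h[of "r \<odot>\<^bsub>P\<^esub> x"] x(1) r by (simp add: Dl(3) kl(3) h)
  qed
  then show ?thesis using h by blast
qed

text \<open>The rank of the next free module is found together with its differential, so dependent
  choice runs over triples: source rank, target rank, map. Q makes consecutive triples composable
  and exact.\<close>

lemma free_resolution_exists:
  assumes R: "cring R" and N: "noetherian_ring R" and M: "module R M"
    and "finite G" "spans R M G (carrier M)"
  shows "\<exists>b d e. free_resolution R M b d e"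
proof -
  obtain b0 e where e: "linear_map R (free_module R b0) M e" "e ` carrier (free_module R b0) = carrier M"
    using spans_imp_image_free_module[OF R M submodule_carrier[OF M] assms(4,5)] by metis
  note FM = module_free_module[OF R]
  define Q where "Q s t \<longleftrightarrow> fst (snd t) = fst s \<and>
     snd (snd t) ` carrier (free_module R (fst t)) =
       module_ker (free_module R (fst s)) (free_module R (fst (snd s))) (snd (snd s))"
    for s t :: "nat \<times> nat \<times> ((nat \<Rightarrow> 'a) \<Rightarrow> nat \<Rightarrow> 'a)"
  define P where "P i t \<longleftrightarrow>
     linear_map R (free_module R (fst t)) (free_module R (fst (snd t))) (snd (snd t)) \<and>
     (i = 0 \<longrightarrow> fst (snd t) = b0 \<and>
        snd (snd t) ` carrier (free_module R (fst t)) = module_ker (free_module R b0) M e)"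
    for i :: nat and t :: "nat \<times> nat \<times> ((nat \<Rightarrow> 'a) \<Rightarrow> nat \<Rightarrow> 'a)"
  have "\<exists>f. \<forall>n. P n (f n) \<and> Q (f n) (f (Suc n))"
  proof (rule dependent_nat_choice)
    obtain m \<phi> where "linear_map R (free_module R m) (free_module R b0) \<phi>"
      "\<phi> ` carrier (free_module R m) = module_ker (free_module R b0) M e"
      using free_module_submodule_cover[OF R N submodule_ker[OF FM M e(1)]] by metis
    then show "\<exists>t. P 0 t" unfolding P_def by (intro exI[of _ "(m, b0, \<phi>)"]) simp
  next
    fix s n assume "P n s"
    then have "linear_map R (free_module R (fst s)) (free_module R (fst (snd s))) (snd (snd s))"
      by (simp only: P_def)
    from free_module_submodule_cover[OF R N submodule_ker[OF FM FM this]]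
    obtain m \<phi> where "linear_map R (free_module R m) (free_module R (fst s)) \<phi>"
      "\<phi> ` carrier (free_module R m) =
         module_ker (free_module R (fst s)) (free_module R (fst (snd s))) (snd (snd s))" by metis
    then show "\<exists>t. P (Suc n) t \<and> Q s t"
      unfolding P_def Q_def by (intro exI[of _ "(m, fst s, \<phi>)"]) simp
  qed
  then obtain f where f: "\<And>n. P n (f n)" "\<And>n. Q (f n) (f (Suc n))" by blast
  \<comment> \<open>Index shift: the triple f j has source of rank b (j + 1), while b 0 comes from
    the cover of M.\<close>
  define b where "b i = (case i of 0 \<Rightarrow> b0 | Suc j \<Rightarrow> fst (f j))" for i
  have tgt: "fst (snd (f i)) = b i" for i
  proof (cases i)
    case 0
    then show ?thesis using f(1)[of 0] by (simp add: P_def b_def)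
  next
    case (Suc j)
    then show ?thesis using f(2)[of j] by (simp add: Q_def b_def)
  qed
  have b0: "b 0 = b0" by (simp add: b_def)
  have src: "fst (f i) = b (Suc i)" for i by (simp add: b_def)
  define \<delta> where "\<delta> i = snd (snd (f i))" for i
  have \<delta>: "linear_map R (free_module R (b (Suc i))) (free_module R (b i)) (\<delta> i)" for i
    using f(1)[of i] unfolding P_def tgt src \<delta>_def by blast
  have \<delta>0: "\<delta> 0 ` carrier (free_module R (b 1)) = module_ker (free_module R (b 0)) M e"
  proof -
    have "snd (snd (f 0)) ` carrier (free_module R (fst (f 0))) = module_ker (free_module R b0) M e"
      using f(1)[of 0] unfolding P_def by blast
    then show ?thesis unfolding src \<delta>_def b0 One_nat_def .
  qed
  have \<delta>S: "\<delta> (Suc i) ` carrier (free_module R (b (Suc (Suc i)))) =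
      module_ker (free_module R (b (Suc i))) (free_module R (b i)) (\<delta> i)" for i
    using f(2)[of i] unfolding Q_def tgt src \<delta>_def by blast
  \<comment> \<open>The maps are about to be made extensional for \<open>module_hom\<close>;
    exactness must survive the restriction.\<close>
  have kr: "module_ker A B (restrict g (carrier A)) = module_ker A B g"
    for A :: "('a, nat \<Rightarrow> 'a) module" and B :: "('a, 'z, 'w) module_scheme" and g
    unfolding module_ker_def by auto
  let ?d = "\<lambda>i. restrict (\<delta> i) (carrier (free_module R (b (Suc i))))"
  let ?e = "restrict e (carrier (free_module R (b 0)))"
  have "free_resolution R M b ?d ?e"
    unfolding free_resolution_def
  proof (intro conjI allI)
    show "?e \<in> module_hom R (free_module R (b 0)) M"
      using e(1) b0 by (intro module_hom_restrict FM) (simp del: free_module_simps)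
    show "?d i \<in> module_hom R (free_module R (b (Suc i))) (free_module R (b i))" for i
      by (intro module_hom_restrict FM \<delta>)
    show "?e ` carrier (free_module R (b 0)) = carrier M"
      using e(2) b0 by (simp del: free_module_simps)
    show "?d 0 ` carrier (free_module R (b 1)) = module_ker (free_module R (b 0)) M ?e"
      unfolding kr using \<delta>0 by (simp del: free_module_simps)
    show "?d (Suc i) ` carrier (free_module R (b (Suc (Suc i)))) =
        module_ker (free_module R (b (Suc i))) (free_module R (b i)) (?d i)" for i
      unfolding kr using \<delta>S by (simp del: free_module_simps)
  qed
  then show ?thesis by blast
qed

section \<open>Homotopies killed by the cohomology annihilator\<close>

text \<open>Scalar multiplication in \<open>quot_module\<close> is a union over all representatives
  of a coset. If r kills the coset of f, this union is the set of coboundaries, and the coset of r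
  f, being one of its members, lies in it.\<close>

lemma hom_cohomology_annihilates:
  assumes R: "cring R" and N: "module R N"
    and d: "\<And>i. linear_map R (free_module R (b (Suc i))) (free_module R (b i)) (d i)"
    and r: "r \<in> module_ann R (hom_cohomology R b d N n)" and f: "f \<in> hom_cocycles R b d N n"
  shows "(\<lambda>x\<in>carrier (free_module R (b n)). r \<odot>\<^bsub>N\<^esub> f x) \<in> hom_coboundaries R b d N n"
proof -
  interpret N: module R N by fact
  let ?F = "free_module R (b n)" and ?B = "hom_coboundaries R b d N n"
  let ?C = "(hom_module R ?F N)\<lparr>carrier := hom_cocycles R b d N n\<rparr>"
  let ?z = "\<lambda>x\<in>carrier ?F. \<zero>\<^bsub>N\<^esub>"
  \<comment> \<open>The zero coboundary puts every cochain into its own coset.\<close>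
  have zB: "?z \<in> ?B"
  proof (cases n)
    case 0
    then show ?thesis by (simp add: hom_coboundaries_def hom_module_def del: free_module_simps)
  next
    case (Suc m)
    let ?z' = "\<lambda>x\<in>carrier (free_module R (b m)). \<zero>\<^bsub>N\<^esub>"
    have "?z' \<in> module_hom R (free_module R (b m)) N"
      by (intro module_hom_restrict module_free_module R linear_mapI) simp_all
    moreover have "?z = compose (carrier (free_module R (b n))) ?z' (d m)"
      using linear_mapD(1)[OF d[of m]] Suc by (intro ext) (simp add: compose_def restrict_def del: free_module_simps)
    ultimately show ?thesis unfolding hom_coboundaries_def Suc by simp
  qed
  have coset: "g \<in> ?B +>\<^bsub>?C\<^esub> g" if "g \<in> carrier ?F \<rightarrow>\<^sub>E carrier N" for g
  proof -
    have "g = (\<lambda>x\<in>carrier ?F. ?z x \<oplus>\<^bsub>N\<^esub> g x)"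
      using that by (intro ext) (auto simp: restrict_def PiE_def extensional_def Pi_def simp del: free_module_simps)
    then have "g = ?z \<oplus>\<^bsub>?C\<^esub> g" by (simp add: hom_module_def del: free_module_simps)
    then show ?thesis unfolding a_r_coset_def' using zB by blast
  qed
  have fE: "f \<in> carrier ?F \<rightarrow>\<^sub>E carrier N" using f unfolding hom_cocycles_def module_hom_def by blast
  have rR: "r \<in> carrier R" using r by (simp add: module_ann_def)
  define rf where "rf = r \<odot>\<^bsub>?C\<^esub> f"
  have rf: "rf = (\<lambda>x\<in>carrier ?F. r \<odot>\<^bsub>N\<^esub> f x)" unfolding rf_def by (simp add: hom_module_def del: free_module_simps)
  have "?B +>\<^bsub>?C\<^esub> f \<in> carrier (hom_cohomology R b d N n)"
    using f by (auto simp: hom_cohomology_def quot_module_def A_RCOSETS_def')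
  then have "r \<odot>\<^bsub>hom_cohomology R b d N n\<^esub> (?B +>\<^bsub>?C\<^esub> f) = \<zero>\<^bsub>hom_cohomology R b d N n\<^esub>"
    using r unfolding module_ann_def by blast
  then have "(\<Union>x\<in>?B +>\<^bsub>?C\<^esub> f. ?B +>\<^bsub>?C\<^esub> (r \<odot>\<^bsub>?C\<^esub> x)) = ?B"
    by (simp add: hom_cohomology_def quot_module_def)
  then have "?B +>\<^bsub>?C\<^esub> rf \<subseteq> ?B" unfolding rf_def using coset[OF fE] by blast
  moreover have "rf \<in> ?B +>\<^bsub>?C\<^esub> rf"
    using fE rR unfolding rf by (intro coset) (auto simp del: free_module_simps)
  ultimately show ?thesis unfolding rf by blast
qed

text \<open>The choice made in \<open>Ext\<close> depends on R and M alone, so one resolution serves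
  all degrees and all N at once.\<close>

lemma Ext_resolution:
  assumes "\<exists>b d e. free_resolution R M b d e"
  obtains b d e where "free_resolution R M b d e"
    "\<And>n (N :: 'a fg_universe). Ext R n M N = hom_cohomology R b d N n"
proof -
  define bd where "bd = (SOME (b, d). \<exists>e. free_resolution R M b d e)"
  obtain b d where bd': "bd = (b, d)" by (cases bd)
  have "case bd of (b, d) \<Rightarrow> \<exists>e. free_resolution R M b d e"
    unfolding bd_def using assms by (intro someI_ex[of "\<lambda>(b, d). \<exists>e. free_resolution R M b d e"]) auto
  then obtain e where "free_resolution R M b d e" unfolding bd' by auto
  moreover have "Ext R n M N = hom_cohomology R b d N n" for n and N :: "'a fg_universe"
    unfolding Ext_def bd_def[symmetric] bd' by simp
  ultimately show ?thesis using that by blast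
qed

text \<open>\<open>M\<close> is isomorphic via \<open>\<kappa>\<close> to an ideal containing the nonzerodivisor \<open>c\<close>. With \<open>Z i\<close> the
  \<open>i\<close>-th syzygy in \<open>F i\<close>, a map \<open>F i \<rightarrow> Z i\<close> restricting to multiplication by \<open>\<rho>\<close> on \<open>Z i\<close> witnesses that
  \<open>\<rho>\<close> kills \<open>Ext\<^bsup>i+1\<^esup>(M, -)\<close>. For \<open>\<rho> = c\<close> such maps are propagated up from \<open>i = 0\<close>; this gives the
  vanishing of Ext into \<open>R\<close> needed to propagate them down for \<open>\<rho> = r\<close>.\<close>

lemma cohom_ann_factors_free:
  fixes M :: "'a fg_universe" and I :: "nat \<Rightarrow> ('a, 'e) module"
  assumes R: "cring R" and N: "noetherian_ring R" and dim: "krull_dim R = 1"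
    and loc: "local_ring R" and gor: "gorenstein TYPE('e) R"
    and M: "module R M" and G: "finite G" "spans R M G (carrier M)"
    and \<kappa>: "linear_map R M (ring_module R) \<kappa>" "inj_on \<kappa> (carrier M)"
    and c: "c \<in> nonzerodivisors R" "c \<in> \<kappa> ` carrier M" and r: "r \<in> cohom_ann R"
  shows "\<exists>b e h. linear_map R (free_module R b) M e \<and> linear_map R M (free_module R b) h \<and>
    (\<forall>x\<in>carrier M. e (h x) = r \<odot>\<^bsub>M\<^esub> x)"
proof -
  interpret cring R by fact
  obtain J :: "nat \<Rightarrow> ('a, 'e) module" and \<delta> \<eta> m where
    res: "injective_resolution R (ring_module R) J \<delta> \<eta>" and fin: "\<forall>i>m. carrier (J i) = {\<zero>\<^bsub>J i\<^esub>}"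
    using gor unfolding gorenstein_def finite_injective_dimension_def by blast
  have fin': "\<And>i. i > m \<Longrightarrow> carrier (J i) = {\<zero>\<^bsub>J i\<^esub>}" using fin by blast
  obtain b d e where fr: "free_resolution R M b d e"
    and Ext: "\<And>n (N :: 'a fg_universe). Ext R n M N = hom_cohomology R b d N n"
    using Ext_resolution[OF free_resolution_exists[OF R N M G]] by metis
  define F where "F i = free_module R (b i)" for i
  have FM: "module R (F i)" for i unfolding F_def by (rule module_free_module[OF R])
  note RM = module_ring_module[OF R]
  have eh: "e \<in> module_hom R (F 0) M" using fr unfolding free_resolution_def F_def by blast
  then have e: "linear_map R (F 0) M e" by (rule module_hom_linear_map)
  have d: "linear_map R (F (Suc i)) (F i) (d i)" for i
    using fr unfolding free_resolution_def F_def by (intro module_hom_linear_map) blast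
  have e_surj: "e ` carrier (F 0) = carrier M" using fr unfolding free_resolution_def F_def by blast
  define Z where "Z i = (case i of 0 \<Rightarrow> module_ker (F 0) M e | Suc j \<Rightarrow> module_ker (F (Suc j)) (F j) (d j))" for i
  have Z0: "x \<in> Z 0 \<longleftrightarrow> x \<in> carrier (F 0) \<and> e x = \<zero>\<^bsub>M\<^esub>" for x by (simp add: Z_def module_ker_def)
  have ZS: "x \<in> Z (Suc i) \<longleftrightarrow> x \<in> carrier (F (Suc i)) \<and> d i x = \<zero>\<^bsub>F i\<^esub>" for i x
    by (simp add: Z_def module_ker_def)
  have im: "d i ` carrier (F (Suc i)) = Z i" for i
    using fr unfolding free_resolution_def F_def Z_def by (cases i) simp_all
  have Zsub: "submodule (Z i) R (F i)" for i
    by (cases i) (simp_all add: Z_def submodule_ker[OF FM M e] submodule_ker[OF FM FM d])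
  have ZF: "x \<in> carrier (F i)" if "x \<in> Z i" for x i using that submoduleD(1)[OF FM Zsub] by blast
  have cR: "c \<in> carrier R" using c(1) by (simp add: nonzerodivisors_def)
  have rR: "r \<in> carrier R" using r by (auto simp: cohom_ann_def cohom_ann_deg_def)
  have creg: "x = \<zero>\<^bsub>R\<^esub>" if "x \<in> carrier R" "c \<otimes>\<^bsub>R\<^esub> x = \<zero>\<^bsub>R\<^esub>" for x
    using c(1) that unfolding nonzerodivisors_def by blast
  interpret M: module R M by (rule M)
  define S where "S \<rho> i \<longleftrightarrow> (\<exists>g. linear_map R (F i) (F i) g \<and> (\<forall>x\<in>carrier (F i). g x \<in> Z i) \<and>
     (\<forall>x\<in>Z i. g x = \<rho> \<odot>\<^bsub>F i\<^esub> x))" for \<rho> i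
  have Sc0: "S c 0"
  proof -
    interpret F0: module R "F 0" by (rule FM)
    \<comment> \<open>Multiplication by c on M factors through R as x |-> \<kappa> x times e z,
      because \<kappa> (e z) = c. Its lift to F 0, subtracted from c, has values in the kernel of
      e.\<close>
    obtain z where z: "z \<in> carrier (F 0)" "\<kappa> (e z) = c" using c(2) e_surj by (metis image_iff)
    have "linear_map R (ring_module R) (F 0) (\<lambda>r. r \<odot>\<^bsub>F 0\<^esub> z)"
      using z(1) by (intro linear_mapI) (simp_all add: F0.smult_l_distr F0.smult_assoc1)
    then have t: "linear_map R (F 0) (F 0) (\<lambda>x. \<kappa> (e x) \<odot>\<^bsub>F 0\<^esub> z)"
      by (intro linear_map_comp[OF linear_map_comp[OF e \<kappa>(1)]])
    have cx: "linear_map R (F 0) (F 0) (\<lambda>x. c \<odot>\<^bsub>F 0\<^esub> x)"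
      by (rule linear_map_smult[OF FM FM linear_map_id cR])
    define g where "g x = c \<odot>\<^bsub>F 0\<^esub> x \<ominus>\<^bsub>F 0\<^esub> \<kappa> (e x) \<odot>\<^bsub>F 0\<^esub> z" for x
    have g: "linear_map R (F 0) (F 0) g" unfolding g_def by (rule linear_map_minus[OF FM FM cx t])
    have \<kappa>e: "linear_map R (F 0) (ring_module R) (\<lambda>x. \<kappa> (e x))" by (rule linear_map_comp[OF e \<kappa>(1)])
    have "g x \<in> Z 0" if x: "x \<in> carrier (F 0)" for x
    proof -
      have kx: "\<kappa> (e x) \<in> carrier R" using linear_mapD(1)[OF \<kappa>e x] by simp
      have "\<kappa> (e (g x)) = \<kappa> (e (c \<odot>\<^bsub>F 0\<^esub> x)) \<ominus>\<^bsub>R\<^esub> \<kappa> (e (\<kappa> (e x) \<odot>\<^bsub>F 0\<^esub> z))"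
        unfolding g_def using linear_map_diff[OF FM RM \<kappa>e linear_mapD(1)[OF cx x] linear_mapD(1)[OF t x]]
          linear_mapD(1)[OF \<kappa>e linear_mapD(1)[OF cx x]] linear_mapD(1)[OF \<kappa>e linear_mapD(1)[OF t x]]
        by (simp add: ring_module_minus[OF R])
      also have "\<dots> = c \<otimes>\<^bsub>R\<^esub> \<kappa> (e x) \<ominus>\<^bsub>R\<^esub> \<kappa> (e x) \<otimes>\<^bsub>R\<^esub> c"
        using linear_mapD(3)[OF \<kappa>e cR x] linear_mapD(3)[OF \<kappa>e kx z(1)] z(2) by simp
      also have "\<dots> = \<zero>\<^bsub>R\<^esub>" using cR kx by (simp add: m_comm a_minus_def r_neg)
      finally have "\<kappa> (e (g x)) = \<kappa> \<zero>\<^bsub>M\<^esub>" using linear_map_zero[OF M RM \<kappa>(1)] by simp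
      then have "e (g x) = \<zero>\<^bsub>M\<^esub>"
        using linear_mapD(1)[OF e linear_mapD(1)[OF g x]] by (intro inj_onD[OF \<kappa>(2)]) auto
      then show ?thesis using linear_mapD(1)[OF g x] Z0 by simp
    qed
    moreover have "g x = c \<odot>\<^bsub>F 0\<^esub> x" if x: "x \<in> Z 0" for x
    proof -
      have "\<kappa> (e x) = \<zero>\<^bsub>R\<^esub>" using x Z0 linear_map_zero[OF M RM \<kappa>(1)] by simp
      then show ?thesis unfolding g_def using x Z0 z(1) cR by (simp add: a_minus_def)
    qed
    ultimately show ?thesis unfolding S_def using g by blast
  qed
  have Sc_step: "S c (Suc i)" if Si: "S c i" for i
  proof -
    obtain g where g: "linear_map R (F i) (F i) g" "\<forall>x\<in>carrier (F i). g x \<in> Z i"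
      "\<forall>x\<in>Z i. g x = c \<odot>\<^bsub>F i\<^esub> x" using Si unfolding S_def by (elim exE conjE)
    have "g x \<in> d i ` carrier (F (Suc i))" if "x \<in> carrier (F i)" for x
      unfolding im using g(2) that by (rule bspec)
    from free_module_lift[of R "F (Suc i)" "F i" "b i" g "d i", folded F_def[of i], OF R FM FM g(1) d this]
    obtain g' where g': "linear_map R (F i) (F (Suc i)) g'" "\<And>x. x \<in> carrier (F i) \<Longrightarrow> d i (g' x) = g x"
      by metis
    have cx: "linear_map R (F (Suc i)) (F (Suc i)) (\<lambda>x. c \<odot>\<^bsub>F (Suc i)\<^esub> x)"
      by (rule linear_map_smult[OF FM FM linear_map_id cR])
    have gd: "linear_map R (F (Suc i)) (F (Suc i)) (\<lambda>x. g' (d i x))" by (rule linear_map_comp[OF d g'(1)])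
    \<comment> \<open>d i kills k, since d i after g' is g and g is multiplication by c on the image
      of d i. On Z (i + 1) the subtracted term is zero.\<close>
    define k where "k x = c \<odot>\<^bsub>F (Suc i)\<^esub> x \<ominus>\<^bsub>F (Suc i)\<^esub> g' (d i x)" for x
    have k: "linear_map R (F (Suc i)) (F (Suc i)) k" unfolding k_def by (rule linear_map_minus[OF FM FM cx gd])
    interpret Fi: module R "F i" by (rule FM)
    interpret Fi1: module R "F (Suc i)" by (rule FM)
    have "k x \<in> Z (Suc i)" if x: "x \<in> carrier (F (Suc i))" for x
    proof -
      have dx: "d i x \<in> Z i" using im x by blast
      have "d i (k x) = c \<odot>\<^bsub>F i\<^esub> d i x \<ominus>\<^bsub>F i\<^esub> g (d i x)"
        unfolding k_def linear_map_diff[OF FM FM d linear_mapD(1)[OF cx x] linear_mapD(1)[OF gd x]]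
          linear_mapD(3)[OF d cR x] g'(2)[OF ZF[OF dx]] ..
      also have "\<dots> = \<zero>\<^bsub>F i\<^esub>"
        using bspec[OF g(3) dx] ZF[OF dx] cR by (simp add: a_minus_def Fi.M.r_neg)
      finally show ?thesis using linear_mapD(1)[OF k x] ZS by simp
    qed
    moreover have "k x = c \<odot>\<^bsub>F (Suc i)\<^esub> x" if x: "x \<in> Z (Suc i)" for x
    proof -
      have "g' (d i x) = \<zero>\<^bsub>F (Suc i)\<^esub>" using x ZS linear_map_zero[OF FM FM g'(1)] by simp
      then show ?thesis unfolding k_def using ZF[OF x] cR by (simp add: a_minus_def)
    qed
    ultimately show ?thesis unfolding S_def using k by blast
  qed
  have Sc: "S c i" for i by (induction i) (auto intro: Sc0 Sc_step)
  \<comment> \<open>F i / Z i has no c-torsion: it embeds into R by \<kappa> after e if i = 0, and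
    into the free module F (i - 1) otherwise.\<close>
  have sat: "u \<in> Z i" if u: "u \<in> carrier (F i)" and cu: "c \<odot>\<^bsub>F i\<^esub> u \<in> Z i" for u i
  proof (cases i)
    case 0
    have eu: "e u \<in> carrier M" using u linear_mapD(1)[OF e] 0 by simp
    then have ku: "\<kappa> (e u) \<in> carrier R" using linear_mapD(1)[OF \<kappa>(1)] by simp
    have "c \<odot>\<^bsub>M\<^esub> e u = \<zero>\<^bsub>M\<^esub>" using cu u cR linear_mapD(3)[OF e] Z0 unfolding 0 by simp
    then have "c \<otimes>\<^bsub>R\<^esub> \<kappa> (e u) = \<zero>\<^bsub>R\<^esub>"
      using linear_mapD(3)[OF \<kappa>(1) cR eu] linear_map_zero[OF M RM \<kappa>(1)] by simp
    then have "\<kappa> (e u) = \<kappa> \<zero>\<^bsub>M\<^esub>" using creg ku linear_map_zero[OF M RM \<kappa>(1)] by simp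
    then have "e u = \<zero>\<^bsub>M\<^esub>" using eu by (intro inj_onD[OF \<kappa>(2)]) auto
    then show ?thesis using u Z0 unfolding 0 by simp
  next
    case (Suc j)
    have du: "d j u \<in> carrier (F j)" using u linear_mapD(1)[OF d] Suc by simp
    have eq: "c \<odot>\<^bsub>F j\<^esub> d j u = \<zero>\<^bsub>F j\<^esub>" using cu u cR linear_mapD(3)[OF d] ZS unfolding Suc by simp
    have "d j u i' = \<zero>\<^bsub>R\<^esub>" if i': "i' < b j" for i'
    proof (rule creg)
      show "d j u i' \<in> carrier R" using du i' unfolding F_def by auto
      have "(c \<odot>\<^bsub>F j\<^esub> d j u) i' = \<zero>\<^bsub>F j\<^esub> i'" unfolding eq ..
      then show "c \<otimes>\<^bsub>R\<^esub> d j u i' = \<zero>\<^bsub>R\<^esub>" using i' unfolding F_def by simp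
    qed
    moreover have "d j u \<in> {..<b j} \<rightarrow>\<^sub>E carrier R" using du unfolding F_def by simp
    ultimately have "d j u = \<zero>\<^bsub>F j\<^esub>"
      using PiE_arb[of "d j u" "{..<b j}"] unfolding F_def by (intro ext) (simp add: restrict_def)
    then show ?thesis using u ZS unfolding Suc by simp
  qed
  \<comment> \<open>This is where Ext^1(F i / Z i, R) = 0 is used; \<open>S c i\<close> provides the
    map \<gamma> for it.\<close>
  have extend: "\<exists>k. linear_map R (F i) (F (Suc i)) k \<and> (\<forall>x\<in>Z i. k x = f x)"
    if f: "linear_map R ((F i)\<lparr>carrier := Z i\<rparr>) (F (Suc i)) f" for i f
  proof -
    obtain g where g: "linear_map R (F i) (F i) g" "\<forall>x\<in>carrier (F i). g x \<in> Z i"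
      "\<forall>x\<in>Z i. g x = c \<odot>\<^bsub>F i\<^esub> x" using Sc[of i] unfolding S_def by (elim exE conjE)
    show ?thesis unfolding F_def
      by (rule free_module_hom_extend_free[OF R N dim loc c(1) res fin' Zsub[of i, unfolded F_def]
            sat[of _ i, unfolded F_def] g(1)[unfolded F_def] bspec[OF g(2)[unfolded F_def]]
            bspec[OF g(3)[unfolded F_def]] f[unfolded F_def]])
  qed
  have Sr_step: "S r i" if Si: "S r (Suc i)" for i
  proof -
    interpret Fi: module R "F i" by (rule FM)
    interpret Fi1: module R "F (Suc i)" by (rule FM)
    obtain g where g: "linear_map R (F (Suc i)) (F (Suc i)) g" "\<forall>x\<in>carrier (F (Suc i)). g x \<in> Z (Suc i)"
      "\<forall>x\<in>Z (Suc i). g x = r \<odot>\<^bsub>F (Suc i)\<^esub> x" using Si unfolding S_def by (elim exE conjE)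
    \<comment> \<open>r - g vanishes on the kernel of d i, so it is h after d i for some h on Z i.
      With an extension h' of h to F i, the composite of h' and d i is the required map one degree
      lower.\<close>
    define k where "k x = r \<odot>\<^bsub>F (Suc i)\<^esub> x \<ominus>\<^bsub>F (Suc i)\<^esub> g x" for x
    have k: "linear_map R (F (Suc i)) (F (Suc i)) k"
      unfolding k_def by (rule linear_map_minus[OF FM FM linear_map_smult[OF FM FM linear_map_id rR] g(1)])
    have k0: "k x = \<zero>\<^bsub>F (Suc i)\<^esub>" if "x \<in> carrier (F (Suc i))" "d i x = \<zero>\<^bsub>F i\<^esub>" for x
    proof -
      have "x \<in> Z (Suc i)" using that ZS by simp
      from bspec[OF g(3) this] show ?thesis
        unfolding k_def using that(1) rR by (simp add: a_minus_def Fi1.M.r_neg)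
    qed
    obtain h where h: "linear_map R ((F i)\<lparr>carrier := Z i\<rparr>) (F (Suc i)) h"
      "\<forall>x\<in>carrier (F (Suc i)). h (d i x) = k x"
      using linear_map_factor[OF FM FM FM d k k0] unfolding im by auto
    from extend[OF h(1)] obtain h' where h': "linear_map R (F i) (F (Suc i)) h'" "\<forall>x\<in>Z i. h' x = h x"
      by (elim exE conjE)
    have "linear_map R (F i) (F i) (\<lambda>x. d i (h' x))" by (rule linear_map_comp[OF h'(1) d])
    moreover have "\<forall>x\<in>carrier (F i). d i (h' x) \<in> Z i" using linear_mapD(1)[OF h'(1)] im by blast
    moreover have "d i (h' y) = r \<odot>\<^bsub>F i\<^esub> y" if y: "y \<in> Z i" for y
    proof -
      obtain x where x: "x \<in> carrier (F (Suc i))" "y = d i x" using y im by blast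
      have gx: "g x \<in> Z (Suc i)" using g(2) x(1) by (rule bspec)
      have "d i (h' y) = d i (k x)" using bspec[OF h'(2) y] bspec[OF h(2) x(1)] x(2) by simp
      also have "\<dots> = d i (r \<odot>\<^bsub>F (Suc i)\<^esub> x) \<ominus>\<^bsub>F i\<^esub> d i (g x)"
        unfolding k_def by (rule linear_map_diff[OF FM FM d Fi1.smult_closed[OF rR x(1)] ZF[OF gx]])
      also have "\<dots> = r \<odot>\<^bsub>F i\<^esub> y \<ominus>\<^bsub>F i\<^esub> \<zero>\<^bsub>F i\<^esub>"
        using gx ZS linear_mapD(3)[OF d rR x(1)] x(2) by simp
      also have "\<dots> = r \<odot>\<^bsub>F i\<^esub> y" using ZF[OF y] rR by (simp add: a_minus_def)
      finally show ?thesis .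
    qed
    ultimately show ?thesis unfolding S_def by blast
  qed
  obtain n where rn: "r \<in> cohom_ann_deg R n" using r unfolding cohom_ann_def by blast
  have fgM: "fin_gen R M" by (rule fin_genI[OF M G])
  have ann: "r \<in> module_ann R (hom_cohomology R b d N n)" if "fin_gen R N" for N :: "'a fg_universe"
    using rn fgM that unfolding cohom_ann_deg_def Ext[symmetric] by blast
  have dF: "linear_map R (free_module R (b (Suc i))) (free_module R (b i)) (d i)" for i
    using d unfolding F_def .
  have "\<exists>h. linear_map R M (F 0) h \<and> (\<forall>x\<in>carrier M. e (h x) = r \<odot>\<^bsub>M\<^esub> x)"
  proof (cases n)
    case 0
    \<comment> \<open>In degree 0 the augmentation e is a cocycle, corresponding to the identity of
      M. As r kills it, r M = 0 and h = 0 will do.\<close>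
    have "e (d 0 x) = \<zero>\<^bsub>M\<^esub>" if "x \<in> carrier (F (Suc 0))" for x using im[of 0] Z0 that by blast
    then have "e \<in> hom_cocycles R b d M n" using eh unfolding hom_cocycles_def 0 F_def by blast
    from hom_cohomology_annihilates[OF R M dF ann[OF fgM] this]
    have z: "(\<lambda>x\<in>carrier (F 0). r \<odot>\<^bsub>M\<^esub> e x) = (\<lambda>x\<in>carrier (F 0). \<zero>\<^bsub>M\<^esub>)"
      unfolding 0 F_def by (simp add: hom_coboundaries_def hom_module_def del: free_module_simps)
    have "r \<odot>\<^bsub>M\<^esub> y = \<zero>\<^bsub>M\<^esub>" if y: "y \<in> carrier M" for y
    proof -
      obtain x where x: "x \<in> carrier (F 0)" "y = e x" using y e_surj by blast
      then show ?thesis using fun_cong[OF z, of x] by simp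
    qed
    moreover interpret F0: module R "F 0" by (rule FM)
    have "linear_map R M (F 0) (\<lambda>_. \<zero>\<^bsub>F 0\<^esub>)" by (rule linear_mapI) simp_all
    ultimately show ?thesis
      using linear_map_zero[OF FM M e] by (intro exI[of _ "\<lambda>_. \<zero>\<^bsub>F 0\<^esub>"]) simp
  next
    case (Suc k)
    interpret Fk: module R "F k" by (rule FM)
    \<comment> \<open>The test module is a copy of the syzygy Z k and the cocycle, of degree k + 1,
      is the differential onto it. That r times this cocycle is a coboundary gives a map F k -> Z k
      equal to r on Z k, which is \<open>S r k\<close>.\<close>
    let ?Zk = "(F k)\<lparr>carrier := Z k\<rparr>" and ?\<iota> = "\<lambda>x::nat \<Rightarrow> 'a. {x}"
    have ZkM: "module R ?Zk" by (rule submodule_module[OF FM Zsub])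
    have \<iota>: "inj_on ?\<iota> (carrier ?Zk)" by simp
    define T where "T = transport_module ?\<iota> ?Zk"
    note TT = transport_module[OF ZkM \<iota>, folded T_def]
    have dk: "linear_map R (F (Suc k)) ?Zk (d k)"
      by (rule linear_map_into_subset[OF d]) (use im in blast)
    have \<iota>d: "linear_map R (F (Suc k)) T (\<lambda>x. {d k x})" by (rule linear_map_comp[OF dk TT(2)])
    have "(\<lambda>x. {d k x}) ` carrier (F (Suc k)) = carrier T"
      unfolding T_def using im[of k] by (auto simp: image_iff)
    then have fgT: "fin_gen R T"
      using \<iota>d unfolding F_def by (intro fin_gen_image_free_module[OF R TT(1)])
    let ?f = "restrict (\<lambda>x. {d k x}) (carrier (F (Suc k)))"
    have "?f \<in> module_hom R (F (Suc k)) T" by (rule module_hom_restrict[OF FM \<iota>d])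
    moreover have "?f (d (Suc k) x) = \<zero>\<^bsub>T\<^esub>" if "x \<in> carrier (F (Suc (Suc k)))" for x
    proof -
      have "d (Suc k) x \<in> Z (Suc k)" using im that by blast
      then show ?thesis unfolding TT(4) using ZS by simp
    qed
    ultimately have "?f \<in> hom_cocycles R b d T n" unfolding hom_cocycles_def Suc F_def by blast
    from hom_cohomology_annihilates[OF R TT(1) dF ann[OF fgT] this]
    obtain g0 where g0: "g0 \<in> module_hom R (F k) T"
      "(\<lambda>x\<in>carrier (F (Suc k)). r \<odot>\<^bsub>T\<^esub> ?f x) = compose (carrier (F (Suc k))) g0 (d k)"
      unfolding Suc hom_coboundaries_def F_def by auto
    have g0l: "linear_map R (F k) T g0" by (rule module_hom_linear_map[OF g0(1)])
    define g where "g x = inv_into (carrier ?Zk) ?\<iota> (g0 x)" for x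
    have g: "linear_map R (F k) ?Zk g" unfolding g_def by (rule linear_map_comp[OF g0l TT(3)])
    have "g y = r \<odot>\<^bsub>F k\<^esub> y" if y: "y \<in> Z k" for y
    proof -
      obtain x where x: "x \<in> carrier (F (Suc k))" "y = d k x" using y im by blast
      have "g0 y = r \<odot>\<^bsub>T\<^esub> {y}" using fun_cong[OF g0(2), of x] x by (simp add: compose_def)
      moreover have "{y} \<in> carrier T" unfolding T_def using y by simp
      moreover have "inv_into (carrier ?Zk) ?\<iota> {y} = y" using \<iota> y by (intro inv_into_f_f) simp_all
      ultimately show ?thesis unfolding g_def using linear_mapD(3)[OF TT(3) rR, of "{y}"] by simp
    qed
    moreover have "linear_map R (F k) (F k) g"
      by (rule linear_map_from_subset[OF g submoduleD(1)[OF FM Zsub]])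
    moreover have "\<forall>x\<in>carrier (F k). g x \<in> Z k" using linear_mapD(1)[OF g] by simp
    ultimately have "S r k" unfolding S_def by blast
    then have "S r (k - j)" for j
      by (induction j) (use Sr_step in \<open>auto simp: Suc_diff_Suc diff_Suc split: nat.splits\<close>)
    from this[of k] obtain g where g: "linear_map R (F 0) (F 0) g" "\<forall>x\<in>carrier (F 0). g x \<in> Z 0"
      "\<forall>x\<in>Z 0. g x = r \<odot>\<^bsub>F 0\<^esub> x" unfolding S_def by auto
    interpret F0: module R "F 0" by (rule FM)
    \<comment> \<open>r - g vanishes on the kernel of e, hence factors through M; and e kills g, so
      e after this factor h is multiplication by r.\<close>
    define l where "l x = r \<odot>\<^bsub>F 0\<^esub> x \<ominus>\<^bsub>F 0\<^esub> g x" for x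
    have l: "linear_map R (F 0) (F 0) l"
      unfolding l_def by (rule linear_map_minus[OF FM FM linear_map_smult[OF FM FM linear_map_id rR] g(1)])
    have l0: "l x = \<zero>\<^bsub>F 0\<^esub>" if "x \<in> carrier (F 0)" "e x = \<zero>\<^bsub>M\<^esub>" for x
    proof -
      have "x \<in> Z 0" using that Z0 by simp
      from bspec[OF g(3) this] show ?thesis
        unfolding l_def using that(1) rR by (simp add: a_minus_def F0.M.r_neg)
    qed
    obtain h where h: "linear_map R M (F 0) h" "\<forall>x\<in>carrier (F 0). h (e x) = l x"
      using linear_map_factor[OF FM M FM e l l0] unfolding e_surj by auto
    have "e (h y) = r \<odot>\<^bsub>M\<^esub> y" if y: "y \<in> carrier M" for y
    proof -
      obtain x where x: "x \<in> carrier (F 0)" "y = e x" using y e_surj by blast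
      have gx: "g x \<in> Z 0" using g(2) x(1) by (rule bspec)
      have "e (h y) = e (l x)" using bspec[OF h(2) x(1)] x(2) by simp
      also have "\<dots> = e (r \<odot>\<^bsub>F 0\<^esub> x) \<ominus>\<^bsub>M\<^esub> e (g x)"
        unfolding l_def by (rule linear_map_diff[OF FM M e F0.smult_closed[OF rR x(1)] ZF[OF gx]])
      also have "\<dots> = r \<odot>\<^bsub>M\<^esub> y \<ominus>\<^bsub>M\<^esub> \<zero>\<^bsub>M\<^esub>"
        using gx Z0 linear_mapD(3)[OF e rR x(1)] x(2) by simp
      also have "\<dots> = r \<odot>\<^bsub>M\<^esub> y" using y rR by (simp add: a_minus_def)
      finally show ?thesis .
    qed
    then show ?thesis using h(1) by blast
  qed
  then show ?thesis using e unfolding F_def by blast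
qed

text \<open>With w_i in J the images of the basis vectors, r c is the sum of the H(c)_i w_i. Here a
  w_i = s j_i with j_i in J, and H(c)_i j_i = c H(j_i)_i, so a r c = c s t with t the sum of the
  H(j_i)_i; then c is cancelled.\<close>

lemma cohom_ann_ideal_divides:
  fixes R :: "('a, 'r) ring_scheme"
  assumes R: "cring R" and N: "noetherian_ring R" and dim: "krull_dim R = 1"
    and loc: "local_ring R" and gor: "gorenstein TYPE('e) R"
    and J: "ideal J R" and c: "c \<in> J" "c \<in> nonzerodivisors R"
    and as: "a \<in> carrier R" "s \<in> carrier R"
    and div: "\<And>j. j \<in> J \<Longrightarrow> \<exists>j'\<in>J. a \<otimes>\<^bsub>R\<^esub> j = s \<otimes>\<^bsub>R\<^esub> j'"
    and r: "r \<in> cohom_ann R"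
  shows "\<exists>t\<in>carrier R. r \<otimes>\<^bsub>R\<^esub> a = s \<otimes>\<^bsub>R\<^esub> t"
proof -
  interpret cring R by fact
  interpret J: ideal J R by fact
  note RM = module_ring_module[OF R]
  let ?J = "(ring_module R)\<lparr>carrier := J\<rparr>" and ?\<iota> = "\<lambda>x::'a. {\<lambda>_::nat. x}"
  have Jsub: "submodule J R (ring_module R)" using J submodule_ring_module[OF R] by blast
  have JM: "module R ?J" by (rule submodule_module[OF RM Jsub])
  have \<iota>: "inj_on ?\<iota> (carrier ?J)" by (auto simp: inj_on_def fun_eq_iff)
  \<comment> \<open>J is copied onto the type over which \<open>cohom_ann_deg\<close>
    quantifies.\<close>
  define M where "M = transport_module ?\<iota> ?J"
  define \<kappa> where "\<kappa> = inv_into (carrier ?J) ?\<iota>"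
  note T = transport_module[OF JM \<iota>, folded M_def \<kappa>_def]
  have carM: "carrier M = ?\<iota> ` J" by (simp add: M_def)
  have \<kappa>\<iota>: "\<kappa> (?\<iota> j) = j" if "j \<in> J" for j unfolding \<kappa>_def using \<iota> that by (intro inv_into_f_f) simp_all
  have \<kappa>: "linear_map R M (ring_module R) \<kappa>"
    by (rule linear_map_from_subset[OF T(3)]) (use J.a_subset in simp)
  have \<kappa>inj: "inj_on \<kappa> (carrier M)" 
  proof (rule inj_onI)
    fix x y assume "x \<in> carrier M" "y \<in> carrier M" and eq: "\<kappa> x = \<kappa> y"
    then obtain i j where "i \<in> J" "j \<in> J" and xy: "x = ?\<iota> i" "y = ?\<iota> j" unfolding carM by blast
    then have "i = j" using eq \<kappa>\<iota>[of i] \<kappa>\<iota>[of j] by simp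
    then show "x = y" by (simp add: xy)
  qed
  have \<kappa>im: "\<kappa> ` carrier M = J" unfolding carM image_image using \<kappa>\<iota> by simp
  obtain G where G: "finite G" "spans R (ring_module R) G J" using noetherian_ideal_spans[OF R N J] by metis
  have GJ: "G \<subseteq> J" using G(2) by (simp add: spans_def)
  have "carrier M \<subseteq> B" if B: "submodule B R M" and GB: "?\<iota> ` G \<subseteq> B" for B
  proof -
    have "submodule (\<kappa> ` B) R (ring_module R)" by (rule submodule_image[OF T(1) RM \<kappa> B])
    moreover have "G \<subseteq> \<kappa> ` B"
    proof
      fix x assume "x \<in> G"
      then have "?\<iota> x \<in> B" "\<kappa> (?\<iota> x) = x" using GB GJ \<kappa>\<iota> by auto
      then show "x \<in> \<kappa> ` B" by (metis image_eqI)
    qed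
    ultimately have "J \<subseteq> \<kappa> ` B" using G(2) unfolding spans_def by blast
    note JB = this
    show ?thesis
    proof
      fix x assume x: "x \<in> carrier M"
      then have "\<kappa> x \<in> \<kappa> ` B" using \<kappa>im JB by blast
      then obtain y where y: "y \<in> B" "\<kappa> x = \<kappa> y" by blast
      have "y \<in> carrier M" using y(1) submoduleD(1)[OF T(1) B] by blast
      then show "x \<in> B" using inj_onD[OF \<kappa>inj y(2) x] y(1) by simp
    qed
  qed
  moreover have "?\<iota> ` G \<subseteq> carrier M" unfolding carM using GJ by blast
  ultimately have spM: "spans R M (?\<iota> ` G) (carrier M)" unfolding spans_def by blast
  have "c \<in> \<kappa> ` carrier M" unfolding \<kappa>im by (rule c(1))
  from cohom_ann_factors_free[OF R N dim loc gor T(1) finite_imageI[OF G(1)] spM \<kappa> \<kappa>inj c(2) this r]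
  obtain b e h where e: "linear_map R (free_module R b) M e" and h: "linear_map R M (free_module R b) h"
    and eh: "\<forall>x\<in>carrier M. e (h x) = r \<odot>\<^bsub>M\<^esub> x" by (elim exE conjE)
  define H where "H j i = h (?\<iota> j) i" for j i
  have cR: "c \<in> carrier R" using c(1) J.Icarr by blast
  have rR: "r \<in> carrier R" using r by (auto simp: cohom_ann_def cohom_ann_deg_def)
  have hl: "linear_map R ?J (free_module R b) (\<lambda>j. h (?\<iota> j))" by (rule linear_map_comp[OF T(2) h])
  have HR: "H j i \<in> carrier R" if "j \<in> J" "i < b" for j i
    using linear_mapD(1)[OF hl, of j] that unfolding H_def by auto
  have Hmul: "H (x \<otimes>\<^bsub>R\<^esub> j) i = x \<otimes>\<^bsub>R\<^esub> H j i" if "x \<in> carrier R" "j \<in> J" "i < b" for x j i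
    using linear_mapD(3)[OF hl, of x j] that unfolding H_def by simp
  have Hswap: "H c i \<otimes>\<^bsub>R\<^esub> j = c \<otimes>\<^bsub>R\<^esub> H j i" if "j \<in> J" "i < b" for j i
  proof -
    have jR: "j \<in> carrier R" using that J.Icarr by blast
    have "j \<otimes>\<^bsub>R\<^esub> H c i = H (j \<otimes>\<^bsub>R\<^esub> c) i" using Hmul jR c(1) that by simp
    also have "\<dots> = H (c \<otimes>\<^bsub>R\<^esub> j) i" using jR cR by (simp add: m_comm)
    also have "\<dots> = c \<otimes>\<^bsub>R\<^esub> H j i" using Hmul cR that by simp
    finally show ?thesis using jR HR[OF c(1) that(2)] by (simp add: m_comm)
  qed
  have \<kappa>e: "linear_map R (free_module R b) (ring_module R) (\<lambda>x. \<kappa> (e x))" by (rule linear_map_comp[OF e \<kappa>])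
  define w where "w i = \<kappa> (e (unit_vec R b i))" for i
  have wJ: "w i \<in> J" for i
    unfolding w_def \<kappa>im[symmetric] by (rule imageI[OF linear_mapD(1)[OF e unit_vec_carrier[OF R]]])
  have wR: "w i \<in> carrier (ring_module R)" for i using J.Icarr[OF wJ] by simp
  have comb: "\<kappa> (e x) = lincomb (ring_module R) w b x" if "x \<in> carrier (free_module R b)" for x
  proof (rule free_module_ext[OF R RM \<kappa>e lincomb_linear[OF R RM wR] _ that])
    fix i assume "i < b"
    then show "\<kappa> (e (unit_vec R b i)) = lincomb (ring_module R) w b (unit_vec R b i)"
      using lincomb_unit_vec[of R "ring_module R" b w i, OF R RM wR] w_def[of i] by simp
  qed
  \<comment> \<open>Induction over partial sums; t collects the terms H(j_i)_i while the factor c s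
    stays in front.\<close>
  have "k \<le> b \<Longrightarrow> \<exists>t\<in>carrier R. lincomb (ring_module R) w k (H c) \<in> carrier R \<and>
      a \<otimes>\<^bsub>R\<^esub> lincomb (ring_module R) w k (H c) = c \<otimes>\<^bsub>R\<^esub> (s \<otimes>\<^bsub>R\<^esub> t)" for k
  proof (induction k)
    case 0
    show ?case using as cR by (intro bexI[of _ "\<zero>\<^bsub>R\<^esub>"]) auto
  next
    case (Suc k)
    define L where "L = lincomb (ring_module R) w k (H c)"
    obtain t where t: "t \<in> carrier R" "L \<in> carrier R" "a \<otimes>\<^bsub>R\<^esub> L = c \<otimes>\<^bsub>R\<^esub> (s \<otimes>\<^bsub>R\<^esub> t)"
      using Suc unfolding L_def by auto
    have kb: "k < b" using Suc.prems by simp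
    obtain j where j: "j \<in> J" "a \<otimes>\<^bsub>R\<^esub> w k = s \<otimes>\<^bsub>R\<^esub> j" using div[OF wJ] by blast
    have jR: "j \<in> carrier R" and wk: "w k \<in> carrier R" using J.Icarr j(1) wJ by auto
    note Hc = HR[OF c(1) kb] and Hj = HR[OF j(1) kb]
    have "a \<otimes>\<^bsub>R\<^esub> (H c k \<otimes>\<^bsub>R\<^esub> w k) = H c k \<otimes>\<^bsub>R\<^esub> (a \<otimes>\<^bsub>R\<^esub> w k)" using as Hc wk by (simp add: m_lcomm)
    also have "\<dots> = s \<otimes>\<^bsub>R\<^esub> (H c k \<otimes>\<^bsub>R\<^esub> j)" unfolding j(2) using as Hc jR by (simp add: m_lcomm)
    also have "\<dots> = c \<otimes>\<^bsub>R\<^esub> (s \<otimes>\<^bsub>R\<^esub> H j k)" unfolding Hswap[OF j(1) kb] using as cR Hj by (simp add: m_lcomm)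
    finally have "a \<otimes>\<^bsub>R\<^esub> (L \<oplus>\<^bsub>R\<^esub> H c k \<otimes>\<^bsub>R\<^esub> w k) = c \<otimes>\<^bsub>R\<^esub> (s \<otimes>\<^bsub>R\<^esub> (t \<oplus>\<^bsub>R\<^esub> H j k))"
      using as cR t Hc Hj wk by (simp add: r_distr)
    then show ?case unfolding lincomb.simps L_def[symmetric] ring_module_simps
      using t(1,2) Hc Hj wk by (intro bexI[of _ "t \<oplus>\<^bsub>R\<^esub> H j k"] conjI) auto
  qed
  from this[of b] obtain t where t: "t \<in> carrier R"
    "a \<otimes>\<^bsub>R\<^esub> lincomb (ring_module R) w b (H c) = c \<otimes>\<^bsub>R\<^esub> (s \<otimes>\<^bsub>R\<^esub> t)" by auto
  have cM: "?\<iota> c \<in> carrier M" unfolding carM using c(1) by blast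
  have "lincomb (ring_module R) w b (H c) = \<kappa> (e (h (?\<iota> c)))"
    unfolding H_def using comb[OF linear_mapD(1)[OF h cM]] by simp
  also have "\<dots> = r \<otimes>\<^bsub>R\<^esub> c"
    using bspec[OF eh cM] linear_mapD(3)[OF \<kappa> rR cM] \<kappa>\<iota>[OF c(1)] by simp
  finally have "c \<otimes>\<^bsub>R\<^esub> (s \<otimes>\<^bsub>R\<^esub> t) = a \<otimes>\<^bsub>R\<^esub> (r \<otimes>\<^bsub>R\<^esub> c)" using t(2) by simp
  then have "c \<otimes>\<^bsub>R\<^esub> (r \<otimes>\<^bsub>R\<^esub> a \<ominus>\<^bsub>R\<^esub> s \<otimes>\<^bsub>R\<^esub> t) = \<zero>\<^bsub>R\<^esub>"
    using cR as rR t(1) by (simp add: a_minus_def r_distr r_minus m_ac r_neg)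
  then have "r \<otimes>\<^bsub>R\<^esub> a \<ominus>\<^bsub>R\<^esub> s \<otimes>\<^bsub>R\<^esub> t = \<zero>\<^bsub>R\<^esub>"
    using c(2) as rR t(1) unfolding nonzerodivisors_def by simp
  then have "r \<otimes>\<^bsub>R\<^esub> a = s \<otimes>\<^bsub>R\<^esub> t" using as rR t(1) by simp
  then show ?thesis using t(1) by blast
qed

section \<open>Fractions and integral elements\<close>

context cring
begin

lemma nonzerodivisorsD:
  assumes "s \<in> nonzerodivisors R"
  shows "s \<in> carrier R" "x \<in> carrier R \<Longrightarrow> s \<otimes> x = \<zero> \<Longrightarrow> x = \<zero>"
    "x \<in> carrier R \<Longrightarrow> y \<in> carrier R \<Longrightarrow> s \<otimes> x = s \<otimes> y \<Longrightarrow> x = y"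
proof -
  show s: "s \<in> carrier R" and *: "\<And>x. x \<in> carrier R \<Longrightarrow> s \<otimes> x = \<zero> \<Longrightarrow> x = \<zero>"
    using assms by (simp_all add: nonzerodivisors_def)
  assume xy: "x \<in> carrier R" "y \<in> carrier R" "s \<otimes> x = s \<otimes> y"
  then have "s \<otimes> (x \<ominus> y) = \<zero>" using s by (simp add: a_minus_def r_distr r_minus r_neg)
  then have "x \<ominus> y = \<zero>" using * xy by simp
  then show "x = y" using xy by simp
qed

lemma one_nonzerodivisor: "\<one> \<in> nonzerodivisors R"
  by (simp add: nonzerodivisors_def)

lemma mult_nonzerodivisor:
  assumes "s \<in> nonzerodivisors R" "t \<in> nonzerodivisors R"
  shows "s \<otimes> t \<in> nonzerodivisors R"
proof -
  note s = nonzerodivisorsD[OF assms(1)] and t = nonzerodivisorsD[OF assms(2)]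
  have "x = \<zero>" if "x \<in> carrier R" "s \<otimes> t \<otimes> x = \<zero>" for x
    using that s(1) s(2)[of "t \<otimes> x"] t(1) t(2)[of x] by (simp add: m_assoc)
  then show ?thesis using s(1) t(1) by (simp add: nonzerodivisors_def)
qed

lemma pow_nonzerodivisor:
  assumes "s \<in> nonzerodivisors R" shows "s [^] (n::nat) \<in> nonzerodivisors R"
  by (induction n) (simp_all add: one_nonzerodivisor mult_nonzerodivisor assms)

lemma frac_rel_iff:
  "((a, s), (b, t)) \<in> frac_rel R \<longleftrightarrow> a \<in> carrier R \<and> s \<in> nonzerodivisors R \<and> b \<in> carrier R \<and>
     t \<in> nonzerodivisors R \<and> a \<otimes> t = b \<otimes> s"
  by (simp add: frac_rel_def)

lemma equiv_frac_rel: "equiv (carrier R \<times> nonzerodivisors R) (frac_rel R)"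
proof (rule equivI)
  show "frac_rel R \<subseteq> (carrier R \<times> nonzerodivisors R) \<times> (carrier R \<times> nonzerodivisors R)"
    by (auto simp: frac_rel_def)
  show "refl_on (carrier R \<times> nonzerodivisors R) (frac_rel R)"
    by (auto simp: refl_on_def frac_rel_def)
  show "sym (frac_rel R)" by (auto simp: sym_def frac_rel_def)
  show "trans (frac_rel R)"
  proof (rule transI, clarify)
    fix a s b t c u
    assume "((a, s), (b, t)) \<in> frac_rel R" "((b, t), (c, u)) \<in> frac_rel R"
    then have *: "a \<in> carrier R" "s \<in> nonzerodivisors R" "b \<in> carrier R" "t \<in> nonzerodivisors R"
      "c \<in> carrier R" "u \<in> nonzerodivisors R" "a \<otimes> t = b \<otimes> s" "b \<otimes> u = c \<otimes> t"
      by (auto simp: frac_rel_iff)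
    note nz = nonzerodivisorsD[OF *(2)] nonzerodivisorsD[OF *(4)] nonzerodivisorsD[OF *(6)]
    have "t \<otimes> (a \<otimes> u) = (a \<otimes> t) \<otimes> u" using *(1,3,5) nz(1,4,7) by (simp add: m_ac)
    also have "\<dots> = (b \<otimes> u) \<otimes> s" unfolding *(7) using *(1,3,5) nz(1,4,7) by (simp add: m_ac)
    also have "\<dots> = t \<otimes> (c \<otimes> s)" unfolding *(8) using *(1,3,5) nz(1,4,7) by (simp add: m_ac)
    finally have eq: "t \<otimes> (a \<otimes> u) = t \<otimes> (c \<otimes> s)" .
    have "a \<otimes> u = c \<otimes> s"
      by (rule nz(6)[OF m_closed[OF *(1) nz(7)] m_closed[OF *(5) nz(1)] eq])
    then show "((a, s), (c, u)) \<in> frac_rel R" using * by (simp add: frac_rel_iff)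
  qed
qed

lemma mk_frac_eq_iff:
  assumes "a \<in> carrier R" "s \<in> nonzerodivisors R" "b \<in> carrier R" "t \<in> nonzerodivisors R"
  shows "mk_frac R a s = mk_frac R b t \<longleftrightarrow> a \<otimes> t = b \<otimes> s"
  unfolding mk_frac_def using assms by (subst eq_equiv_class_iff[OF equiv_frac_rel]) (auto simp: frac_rel_iff)

lemma frac_carrierE:
  assumes "p \<in> carrier (total_quotient_ring R)"
  obtains a s where "a \<in> carrier R" "s \<in> nonzerodivisors R" "p = mk_frac R a s"
  using assms by (auto simp: total_quotient_ring_def mk_frac_def elim!: quotientE)

lemma frac_carrierI:
  assumes "a \<in> carrier R" "s \<in> nonzerodivisors R"
  shows "mk_frac R a s \<in> carrier (total_quotient_ring R)"
  using assms by (auto simp: total_quotient_ring_def mk_frac_def intro: quotientI)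

lemma mem_mk_frac_iff:
  assumes "a \<in> carrier R" "s \<in> nonzerodivisors R"
  shows "(b, t) \<in> mk_frac R a s \<longleftrightarrow> b \<in> carrier R \<and> t \<in> nonzerodivisors R \<and> a \<otimes> t = b \<otimes> s"
  using assms by (simp add: mk_frac_def frac_rel_iff)

lemma UN_eq_const: "(a, b) \<in> A \<Longrightarrow> (\<And>x y. (x, y) \<in> A \<Longrightarrow> f x y = c) \<Longrightarrow> (\<Union>(x, y)\<in>A. f x y) = c"
  by auto

text \<open>Operations on fractions are unions over all pairs of representatives; independence of
  the representatives collapses the union to one value.\<close>

lemma UN_frac_const:
  assumes "a \<in> carrier R" "s \<in> nonzerodivisors R" "b \<in> carrier R" "t \<in> nonzerodivisors R"
    and "\<And>a' s' b' t'. (a', s') \<in> mk_frac R a s \<Longrightarrow> (b', t') \<in> mk_frac R b t \<Longrightarrow> f a' s' b' t' = f a s b t"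
  shows "(\<Union>(a', s')\<in>mk_frac R a s. \<Union>(b', t')\<in>mk_frac R b t. f a' s' b' t') = f a s b t"
proof -
  have as: "(a, s) \<in> mk_frac R a s" and bt: "(b, t) \<in> mk_frac R b t"
    using assms(1-4) by (simp_all add: mem_mk_frac_iff)
  have "(\<Union>(b', t')\<in>mk_frac R b t. f a' s' b' t') = f a s b t" if "(a', s') \<in> mk_frac R a s" for a' s'
    by (rule UN_eq_const[OF bt]) (use assms(5)[OF that] in auto)
  then show ?thesis by (intro UN_eq_const[OF as]) auto
qed

lemma frac_mult:
  assumes "a \<in> carrier R" "s \<in> nonzerodivisors R" "b \<in> carrier R" "t \<in> nonzerodivisors R"
  shows "mk_frac R a s \<otimes>\<^bsub>total_quotient_ring R\<^esub> mk_frac R b t = mk_frac R (a \<otimes> b) (s \<otimes> t)"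
proof -
  have "mk_frac R (a' \<otimes> b') (s' \<otimes> t') = mk_frac R (a \<otimes> b) (s \<otimes> t)"
    if "(a', s') \<in> mk_frac R a s" "(b', t') \<in> mk_frac R b t" for a' s' b' t'
  proof -
    have *: "a' \<in> carrier R" "s' \<in> nonzerodivisors R" "a \<otimes> s' = a' \<otimes> s"
      "b' \<in> carrier R" "t' \<in> nonzerodivisors R" "b \<otimes> t' = b' \<otimes> t"
      using that assms by (simp_all add: mem_mk_frac_iff)
    note c = assms(1,3) *(1,4) nonzerodivisorsD(1)[OF assms(2)] nonzerodivisorsD(1)[OF assms(4)]
      nonzerodivisorsD(1)[OF *(2)] nonzerodivisorsD(1)[OF *(5)]
    have "(a' \<otimes> b') \<otimes> (s \<otimes> t) = (a' \<otimes> s) \<otimes> (b' \<otimes> t)" using c by (simp add: m_ac)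
    also have "\<dots> = (a \<otimes> s') \<otimes> (b \<otimes> t')" using *(3,6) by simp
    also have "\<dots> = (a \<otimes> b) \<otimes> (s' \<otimes> t')" using c by (simp add: m_ac)
    finally show ?thesis using c * assms by (simp add: mk_frac_eq_iff mult_nonzerodivisor)
  qed
  from UN_frac_const[OF assms, of "\<lambda>a s b t. mk_frac R (a \<otimes> b) (s \<otimes> t)", OF this]
  show ?thesis by (simp add: total_quotient_ring_def)
qed

lemma frac_add:
  assumes "a \<in> carrier R" "s \<in> nonzerodivisors R" "b \<in> carrier R" "t \<in> nonzerodivisors R"
  shows "mk_frac R a s \<oplus>\<^bsub>total_quotient_ring R\<^esub> mk_frac R b t = mk_frac R (a \<otimes> t \<oplus> b \<otimes> s) (s \<otimes> t)"
proof -
  have "mk_frac R (a' \<otimes> t' \<oplus> b' \<otimes> s') (s' \<otimes> t') = mk_frac R (a \<otimes> t \<oplus> b \<otimes> s) (s \<otimes> t)"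
    if "(a', s') \<in> mk_frac R a s" "(b', t') \<in> mk_frac R b t" for a' s' b' t'
  proof -
    have *: "a' \<in> carrier R" "s' \<in> nonzerodivisors R" "a \<otimes> s' = a' \<otimes> s"
      "b' \<in> carrier R" "t' \<in> nonzerodivisors R" "b \<otimes> t' = b' \<otimes> t"
      using that assms by (simp_all add: mem_mk_frac_iff)
    note c = assms(1,3) *(1,4) nonzerodivisorsD(1)[OF assms(2)] nonzerodivisorsD(1)[OF assms(4)]
      nonzerodivisorsD(1)[OF *(2)] nonzerodivisorsD(1)[OF *(5)]
    have "(a' \<otimes> t' \<oplus> b' \<otimes> s') \<otimes> (s \<otimes> t) = (a' \<otimes> s) \<otimes> (t \<otimes> t') \<oplus> (b' \<otimes> t) \<otimes> (s \<otimes> s')"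
      using c by (simp add: l_distr r_distr m_ac)
    also have "\<dots> = (a \<otimes> s') \<otimes> (t \<otimes> t') \<oplus> (b \<otimes> t') \<otimes> (s \<otimes> s')" using *(3,6) by simp
    also have "\<dots> = (a \<otimes> t \<oplus> b \<otimes> s) \<otimes> (s' \<otimes> t')" using c by (simp add: l_distr r_distr m_ac)
    finally show ?thesis using c * assms by (simp add: mk_frac_eq_iff mult_nonzerodivisor)
  qed
  from UN_frac_const[OF assms, of "\<lambda>a s b t. mk_frac R (a \<otimes> t \<oplus> b \<otimes> s) (s \<otimes> t)", OF this]
  show ?thesis by (simp add: total_quotient_ring_def)
qed

lemma frac_zero_one:
  "\<zero>\<^bsub>total_quotient_ring R\<^esub> = mk_frac R \<zero> \<one>" "\<one>\<^bsub>total_quotient_ring R\<^esub> = mk_frac R \<one> \<one>"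
  by (simp_all add: total_quotient_ring_def)

text \<open>The equations of \<open>ring.eval\<close> are available only for rings, so this precedes
  any evaluation at a fraction.\<close>

lemma total_quotient_ring_is_ring: "ring (total_quotient_ring R)"
proof -
  let ?Q = "total_quotient_ring R"
  note simps = frac_zero_one frac_mult frac_add mk_frac_eq_iff mult_nonzerodivisor one_nonzerodivisor
    nonzerodivisorsD(1) frac_carrierI
  show ?thesis
  proof (rule ringI)
    show "abelian_group ?Q"
    proof (rule abelian_groupI)
      fix p assume "p \<in> carrier ?Q"
      then obtain a s where p: "a \<in> carrier R" "s \<in> nonzerodivisors R" "p = mk_frac R a s"
        by (rule frac_carrierE)
      show "\<zero>\<^bsub>?Q\<^esub> \<oplus>\<^bsub>?Q\<^esub> p = p" using p by (simp add: simps)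
      have "mk_frac R (\<ominus> a) s \<oplus>\<^bsub>?Q\<^esub> p = \<zero>\<^bsub>?Q\<^esub>"
        using p by (simp add: simps l_minus l_neg)
      then show "\<exists>y\<in>carrier ?Q. y \<oplus>\<^bsub>?Q\<^esub> p = \<zero>\<^bsub>?Q\<^esub>" using p
        by (intro bexI[of _ "mk_frac R (\<ominus> a) s"]) (simp_all add: frac_carrierI)
      fix q assume "q \<in> carrier ?Q"
      then obtain b t where q: "b \<in> carrier R" "t \<in> nonzerodivisors R" "q = mk_frac R b t"
        by (rule frac_carrierE)
      show "p \<oplus>\<^bsub>?Q\<^esub> q \<in> carrier ?Q" using p q by (simp add: simps)
      show "p \<oplus>\<^bsub>?Q\<^esub> q = q \<oplus>\<^bsub>?Q\<^esub> p" using p q by (simp add: simps a_comm m_comm)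
      fix u assume "u \<in> carrier ?Q"
      then obtain c v where u: "c \<in> carrier R" "v \<in> nonzerodivisors R" "u = mk_frac R c v"
        by (rule frac_carrierE)
      show "p \<oplus>\<^bsub>?Q\<^esub> q \<oplus>\<^bsub>?Q\<^esub> u = p \<oplus>\<^bsub>?Q\<^esub> (q \<oplus>\<^bsub>?Q\<^esub> u)"
        using p q u by (simp add: simps l_distr r_distr m_ac a_ac)
    qed (simp add: simps)
    show "monoid ?Q"
    proof (rule monoidI)
      fix p assume "p \<in> carrier ?Q"
      then obtain a s where p: "a \<in> carrier R" "s \<in> nonzerodivisors R" "p = mk_frac R a s"
        by (rule frac_carrierE)
      show "\<one>\<^bsub>?Q\<^esub> \<otimes>\<^bsub>?Q\<^esub> p = p" "p \<otimes>\<^bsub>?Q\<^esub> \<one>\<^bsub>?Q\<^esub> = p" using p by (simp_all add: simps)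
      fix q assume "q \<in> carrier ?Q"
      then obtain b t where q: "b \<in> carrier R" "t \<in> nonzerodivisors R" "q = mk_frac R b t"
        by (rule frac_carrierE)
      show "p \<otimes>\<^bsub>?Q\<^esub> q \<in> carrier ?Q" using p q by (simp add: simps)
      fix u assume "u \<in> carrier ?Q"
      then obtain c v where u: "c \<in> carrier R" "v \<in> nonzerodivisors R" "u = mk_frac R c v"
        by (rule frac_carrierE)
      show "p \<otimes>\<^bsub>?Q\<^esub> q \<otimes>\<^bsub>?Q\<^esub> u = p \<otimes>\<^bsub>?Q\<^esub> (q \<otimes>\<^bsub>?Q\<^esub> u)" using p q u by (simp add: simps m_ac)
    qed (simp add: simps)
    fix p q u assume "p \<in> carrier ?Q" "q \<in> carrier ?Q" "u \<in> carrier ?Q"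
    then obtain a s b t c v where p: "a \<in> carrier R" "s \<in> nonzerodivisors R" "p = mk_frac R a s"
      and q: "b \<in> carrier R" "t \<in> nonzerodivisors R" "q = mk_frac R b t"
      and u: "c \<in> carrier R" "v \<in> nonzerodivisors R" "u = mk_frac R c v"
      by (metis frac_carrierE)
    show "(p \<oplus>\<^bsub>?Q\<^esub> q) \<otimes>\<^bsub>?Q\<^esub> u = p \<otimes>\<^bsub>?Q\<^esub> u \<oplus>\<^bsub>?Q\<^esub> q \<otimes>\<^bsub>?Q\<^esub> u"
      using p q u by (simp add: simps l_distr r_distr m_ac a_ac)
    show "u \<otimes>\<^bsub>?Q\<^esub> (p \<oplus>\<^bsub>?Q\<^esub> q) = u \<otimes>\<^bsub>?Q\<^esub> p \<oplus>\<^bsub>?Q\<^esub> u \<otimes>\<^bsub>?Q\<^esub> q"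
      using p q u by (simp add: simps l_distr r_distr m_ac a_ac)
  qed
qed

lemma frac_pow:
  assumes "a \<in> carrier R" "s \<in> nonzerodivisors R"
  shows "mk_frac R a s [^]\<^bsub>total_quotient_ring R\<^esub> (n::nat) = mk_frac R (a [^] n) (s [^] n)"
proof -
  interpret Q: ring "total_quotient_ring R" by (rule total_quotient_ring_is_ring)
  show ?thesis
    by (induction n) (simp_all add: frac_zero_one(2) frac_mult assms pow_nonzerodivisor)
qed

end

section \<open>Integral fractions and the ideals they stabilize\<close>

text \<open>For a fraction \<open>a / s\<close>, the ideal \<open>power_ideal R a s d\<close> is \<open>s\<^bsup>d-1\<^esup> R[1, a/s, \<dots>, (a/s)\<^bsup>d-1\<^esup>]\<close>.\<close>

primrec power_ideal :: "('a, 'r) ring_scheme \<Rightarrow> 'a \<Rightarrow> 'a \<Rightarrow> nat \<Rightarrow> 'a set" where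
  "power_ideal R a s 0 = {\<zero>\<^bsub>R\<^esub>}"
| "power_ideal R a s (Suc d) =
     {b \<otimes>\<^bsub>R\<^esub> a [^]\<^bsub>R\<^esub> d \<oplus>\<^bsub>R\<^esub> s \<otimes>\<^bsub>R\<^esub> g | b g. b \<in> carrier R \<and> g \<in> power_ideal R a s d}"

context cring
begin

lemma power_idealI:
  assumes "b \<in> carrier R" "g \<in> power_ideal R a s d" "x = b \<otimes> a [^] d \<oplus> s \<otimes> g"
  shows "x \<in> power_ideal R a s (Suc d)"
  using assms by auto

lemma power_ideal_ideal:
  assumes "a \<in> carrier R" "s \<in> carrier R"
  shows "ideal (power_ideal R a s d) R"
proof (induction d)
  case 0
  show ?case using zeroideal by simp
next
  case (Suc d)
  interpret I: ideal "power_ideal R a s d" R by (rule Suc.IH)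
  have "submodule (power_ideal R a s (Suc d)) R (ring_module R)"
  proof (rule submoduleI'[OF module_ring_module[OF is_cring]])
    show "power_ideal R a s (Suc d) \<subseteq> carrier (ring_module R)"
      using assms I.Icarr by auto
    show "\<zero>\<^bsub>ring_module R\<^esub> \<in> power_ideal R a s (Suc d)"
      by (rule power_idealI[OF zero_closed I.zero_closed]) (use assms in simp)
  next
    fix x y assume "x \<in> power_ideal R a s (Suc d)" "y \<in> power_ideal R a s (Suc d)"
    then obtain b g b' g' where *: "b \<in> carrier R" "g \<in> power_ideal R a s d" "x = b \<otimes> a [^] d \<oplus> s \<otimes> g"
      "b' \<in> carrier R" "g' \<in> power_ideal R a s d" "y = b' \<otimes> a [^] d \<oplus> s \<otimes> g'" by auto
    have "g \<in> carrier R" "g' \<in> carrier R" using * I.Icarr by auto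
    then show "x \<oplus>\<^bsub>ring_module R\<^esub> y \<in> power_ideal R a s (Suc d)"
      using * assms by (intro power_idealI[of "b \<oplus> b'" "g \<oplus> g'"]) (auto simp: l_distr r_distr a_ac)
  next
    fix r x assume r: "r \<in> carrier R" and "x \<in> power_ideal R a s (Suc d)"
    then obtain b g where *: "b \<in> carrier R" "g \<in> power_ideal R a s d" "x = b \<otimes> a [^] d \<oplus> s \<otimes> g" by auto
    have "g \<in> carrier R" using * I.Icarr by auto
    then show "r \<odot>\<^bsub>ring_module R\<^esub> x \<in> power_ideal R a s (Suc d)"
      using * assms r I.I_l_closed
      by (intro power_idealI[of "r \<otimes> b" "r \<otimes> g"]) (auto simp: r_distr m_assoc m_lcomm[of r s])
  qed
  then show ?case using submodule_ring_module[OF is_cring] by blast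
qed

text \<open>This element is 1 scaled by s^d; for a nonzerodivisor s it is the nonzerodivisor in the
  ideal that \<open>cohom_ann_ideal_divides\<close> asks for.\<close>

lemma power_ideal_pow:
  assumes "a \<in> carrier R" "s \<in> carrier R"
  shows "s [^] d \<in> power_ideal R a s (Suc d)"
proof (induction d)
  case 0
  show ?case using assms by (intro power_idealI[of \<one> \<zero>]) simp_all
next
  case (Suc d)
  then show ?case using assms by (intro power_idealI[of \<zero> "s [^] d" _ _ "Suc d"]) (simp_all add: m_comm)
qed

text \<open>Multiplication by a raises both the degree in a/s and the scaling power of s by
  one.\<close>

lemma power_ideal_shift:
  assumes "a \<in> carrier R" "s \<in> carrier R" "g \<in> power_ideal R a s d"
  shows "a \<otimes> g \<in> power_ideal R a s (Suc d)"
  using assms(3)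
proof (induction d arbitrary: g)
  case 0
  then show ?case using assms(1,2) by (intro power_idealI[of \<zero> \<zero>]) simp_all
next
  case (Suc d)
  then obtain b h where *: "b \<in> carrier R" "h \<in> power_ideal R a s d" "g = b \<otimes> a [^] d \<oplus> s \<otimes> h" by auto
  have hR: "h \<in> carrier R" using ideal.Icarr[OF power_ideal_ideal[OF assms(1,2)] *(2)] .
  show ?case
    using * hR assms(1,2) Suc.IH[OF *(2)]
    by (intro power_idealI[of b "a \<otimes> h" _ _ "Suc d"]) (simp_all add: r_distr m_ac)
qed

text \<open>The hypothesis on a^d is an integral equation of degree d for a/s. It makes the module
  spanned by 1, ..., (a/s)^(d-1) closed under multiplication by a/s, which is stated here without
  fractions.\<close>

lemma power_ideal_stable:
  assumes "a \<in> carrier R" "s \<in> carrier R" "g0 \<in> power_ideal R a s d" "a [^] d = s \<otimes> g0"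
    and "j \<in> power_ideal R a s d"
  shows "\<exists>j'\<in>power_ideal R a s d. a \<otimes> j = s \<otimes> j'"
proof (cases d)
  case 0
  then show ?thesis using assms by auto
next
  case (Suc k)
  interpret I: ideal "power_ideal R a s d" R by (rule power_ideal_ideal[OF assms(1,2)])
  obtain b g where *: "b \<in> carrier R" "g \<in> power_ideal R a s k" "j = b \<otimes> a [^] k \<oplus> s \<otimes> g"
    using assms(5) unfolding Suc by auto
  have gR: "g \<in> carrier R" using ideal.Icarr[OF power_ideal_ideal[OF assms(1,2)] *(2)] .
  have g0R: "g0 \<in> carrier R" using I.Icarr assms(3) .
  have "a \<otimes> j = b \<otimes> a [^] d \<oplus> s \<otimes> (a \<otimes> g)"
    unfolding *(3) Suc using *(1) gR assms(1,2) by (simp add: r_distr m_ac)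
  also have "\<dots> = s \<otimes> (b \<otimes> g0 \<oplus> a \<otimes> g)"
    unfolding assms(4) using *(1) gR g0R assms(1,2) by (simp add: r_distr m_ac)
  finally have "a \<otimes> j = s \<otimes> (b \<otimes> g0 \<oplus> a \<otimes> g)" .
  moreover have "b \<otimes> g0 \<oplus> a \<otimes> g \<in> power_ideal R a s d"
    using I.I_l_closed[OF assms(3) *(1)] power_ideal_shift[OF assms(1,2) *(2)] unfolding Suc[symmetric]
    by (rule I.a_closed)
  ultimately show ?thesis by blast
qed

text \<open>\<open>power_ideal\<close> follows the recursion of \<open>ring.eval\<close>, whose
  lists begin with the leading coefficient. Writing s g over s^n instead of g over s^(n-1) covers
  the empty list too.\<close>

lemma eval_fraction:
  assumes a: "a \<in> carrier R" and s: "s \<in> nonzerodivisors R" and "set p \<subseteq> to_frac R ` carrier R"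
  shows "\<exists>g\<in>power_ideal R a s (length p).
    ring.eval (total_quotient_ring R) p (mk_frac R a s) = mk_frac R (s \<otimes> g) (s [^] length p)"
  using assms(3)
proof (induction p)
  case Nil
  show ?case
    using nonzerodivisorsD(1)[OF s] ring.eval.simps(1)[OF total_quotient_ring_is_ring]
    by (simp add: frac_zero_one)
next
  case (Cons f p)
  let ?Q = "total_quotient_ring R" and ?n = "length p"
  have sR: "s \<in> carrier R" by (rule nonzerodivisorsD(1)[OF s])
  obtain b where b: "b \<in> carrier R" "f = mk_frac R b \<one>" using Cons.prems by (auto simp: to_frac_def)
  obtain g where g: "g \<in> power_ideal R a s ?n"
    "ring.eval ?Q p (mk_frac R a s) = mk_frac R (s \<otimes> g) (s [^] ?n)" using Cons by auto
  have gR: "g \<in> carrier R" using ideal.Icarr[OF power_ideal_ideal[OF a sR] g(1)] .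
  note simps = frac_mult frac_add frac_pow mk_frac_eq_iff mult_nonzerodivisor pow_nonzerodivisor
    one_nonzerodivisor
  let ?A = "a [^] ?n" and ?S = "s [^] ?n"
  have c: "?A \<in> carrier R" "?S \<in> carrier R" using a sR by auto
  have "ring.eval ?Q (f # p) (mk_frac R a s) =
      f \<otimes>\<^bsub>?Q\<^esub> mk_frac R a s [^]\<^bsub>?Q\<^esub> ?n \<oplus>\<^bsub>?Q\<^esub> ring.eval ?Q p (mk_frac R a s)"
    using ring.eval.simps(2)[OF total_quotient_ring_is_ring] by simp
  also have "\<dots> = mk_frac R ((b \<otimes> ?A) \<otimes> ?S \<oplus> (s \<otimes> g) \<otimes> ?S) (?S \<otimes> ?S)"
    unfolding b(2) g(2) using a s sR b(1) gR c by (simp add: simps)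
  \<comment> \<open>One power \<open>?S\<close> is cancelled, and numerator and denominator are
    multiplied by s to reach the exponent of the longer list.\<close>
  also have "\<dots> = mk_frac R (s \<otimes> (b \<otimes> ?A \<oplus> s \<otimes> g)) (?S \<otimes> s)"
    using a s sR b(1) gR c by (simp add: simps l_distr r_distr m_ac)
  finally have "ring.eval ?Q (f # p) (mk_frac R a s) =
    mk_frac R (s \<otimes> (b \<otimes> ?A \<oplus> s \<otimes> g)) (s [^] length (f # p))" by simp
  moreover have "b \<otimes> ?A \<oplus> s \<otimes> g \<in> power_ideal R a s (length (f # p))"
    unfolding length_Cons by (rule power_idealI[OF b(1) g(1) refl])
  ultimately show ?case by blast
qed

text \<open>A monic polynomial is split into its leading term and the remaining list, whose length
  is the degree d. Clearing s^d from the equation leaves a^d = - s g.\<close>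

lemma integral_fraction:
  assumes a: "a \<in> carrier R" and s: "s \<in> nonzerodivisors R"
    and int: "integral_over (total_quotient_ring R) (to_frac R ` carrier R) (mk_frac R a s)"
  shows "\<exists>d. \<exists>g\<in>power_ideal R a s d. a [^] d = s \<otimes> g"
proof -
  let ?Q = "total_quotient_ring R"
  interpret Q: ring ?Q by (rule total_quotient_ring_is_ring)
  have sR: "s \<in> carrier R" by (rule nonzerodivisorsD(1)[OF s])
  obtain p where p: "p \<in> carrier ((to_frac R ` carrier R)[X]\<^bsub>?Q\<^esub>)" "p \<noteq> []" "lead_coeff p = \<one>\<^bsub>?Q\<^esub>"
    "Q.eval p (mk_frac R a s) = \<zero>\<^bsub>?Q\<^esub>" using int unfolding integral_over_def by blast
  obtain f p' where fp: "p = f # p'" using p(2) by (cases p) auto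
  have f: "f = mk_frac R \<one> \<one>" using p(3) by (simp add: fp frac_zero_one)
  have "set p \<subseteq> to_frac R ` carrier R"
    using p(1,2) unfolding univ_poly_def polynomial_def by auto
  then obtain g where g: "g \<in> power_ideal R a s (length p')"
    "Q.eval p' (mk_frac R a s) = mk_frac R (s \<otimes> g) (s [^] length p')"
    using eval_fraction[OF a s, of p'] unfolding fp by auto
  interpret I: ideal "power_ideal R a s (length p')" R by (rule power_ideal_ideal[OF a sR])
  have gR: "g \<in> carrier R" using I.Icarr g(1) .
  let ?A = "a [^] length p'" and ?S = "s [^] length p'"
  have S: "?S \<in> nonzerodivisors R" by (rule pow_nonzerodivisor[OF s])
  have c: "?A \<in> carrier R" "?S \<in> carrier R" using a sR by auto
  note simps = frac_mult frac_add frac_pow mk_frac_eq_iff mult_nonzerodivisor one_nonzerodivisor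
  have "f \<otimes>\<^bsub>?Q\<^esub> mk_frac R a s [^]\<^bsub>?Q\<^esub> length p' \<oplus>\<^bsub>?Q\<^esub> mk_frac R (s \<otimes> g) ?S = mk_frac R \<zero> \<one>"
    using p(4) g(2) unfolding fp by (simp add: frac_zero_one)
  then have "?A \<otimes> ?S \<oplus> (s \<otimes> g) \<otimes> ?S = \<zero>"
    unfolding f using a s S sR gR c by (simp add: simps)
  then have "?S \<otimes> (?A \<oplus> s \<otimes> g) = \<zero>" using sR gR c by (simp add: r_distr m_ac)
  then have "?A \<oplus> s \<otimes> g = \<zero>"
    by (rule nonzerodivisorsD(2)[OF S a_closed[OF c(1) m_closed[OF sR gR]]])
  then have "?A = \<ominus> (s \<otimes> g)" using sR gR c by (simp add: minus_equality)
  then have "?A = s \<otimes> (\<ominus> g)" using sR gR by (simp add: r_minus)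
  then show ?thesis using I.a_inv_closed[OF g(1)] by blast
qed

end

theorem mainTheorem3:
  fixes R :: "('a, 'r) ring_scheme"
  assumes "cring R"
    and "noetherian_ring R"
    and "local_ring R"
    and "krull_dim R = 1"
    and "gorenstein TYPE('e) R"
    and "fin_gen R (normalization_module R)"
  shows "cohom_ann R \<subseteq> conductor R"
proof
  fix r assume r: "r \<in> cohom_ann R"
  interpret cring R by fact
  let ?Q = "total_quotient_ring R"
  have rR: "r \<in> carrier R" using r by (auto simp: cohom_ann_def cohom_ann_deg_def)
  \<comment> \<open>A local ring has a proper ideal, so it is nonzero; this excludes d = 0
    below.\<close>
  have one: "\<one>\<^bsub>R\<^esub> \<noteq> \<zero>\<^bsub>R\<^esub>"
  proof
    assume "\<one>\<^bsub>R\<^esub> = \<zero>\<^bsub>R\<^esub>"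
    obtain m where "maximalideal m R" using assms(3) unfolding local_ring_def by blast
    then interpret m: maximalideal m R .
    have "\<one>\<^bsub>R\<^esub> \<in> m" unfolding \<open>\<one>\<^bsub>R\<^esub> = \<zero>\<^bsub>R\<^esub>\<close> by (rule m.zero_closed)
    then show False using m.one_imp_carrier m.I_notcarr by simp
  qed
  have "to_frac R r \<otimes>\<^bsub>?Q\<^esub> q \<in> to_frac R ` carrier R" if q: "q \<in> normalization R" for q
  proof -
    have qQ: "q \<in> carrier ?Q" and int: "integral_over ?Q (to_frac R ` carrier R) q"
      using q by (simp_all add: normalization_def)
    obtain a s where as: "a \<in> carrier R" "s \<in> nonzerodivisors R" and q_eq: "q = mk_frac R a s"
      using qQ by (rule frac_carrierE)
    have sR: "s \<in> carrier R" by (rule nonzerodivisorsD(1)[OF as(2)])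
    obtain d g where g: "g \<in> power_ideal R a s d" "a [^]\<^bsub>R\<^esub> d = s \<otimes>\<^bsub>R\<^esub> g"
      using integral_fraction[OF as int[unfolded q_eq]] by blast
    \<comment> \<open>For d = 0 the ideal is zero, and the equation would read 1 = s 0.\<close>
    have "d \<noteq> 0" using g one sR by (intro notI) simp
    then obtain k where d: "d = Suc k" by (cases d) auto
    \<comment> \<open>With d = k + 1 the ideal contains s^k, which plays the role of c.\<close>
    have "s [^]\<^bsub>R\<^esub> k \<in> power_ideal R a s d" unfolding d by (rule power_ideal_pow[OF as(1) sR])
    from cohom_ann_ideal_divides[OF assms(1,2,4,3,5) power_ideal_ideal[OF as(1) sR] this
        pow_nonzerodivisor[OF as(2)] as(1) sR power_ideal_stable[OF as(1) sR g] r]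
    obtain t where t: "t \<in> carrier R" "r \<otimes>\<^bsub>R\<^esub> a = s \<otimes>\<^bsub>R\<^esub> t" by blast
    have "to_frac R r \<otimes>\<^bsub>?Q\<^esub> q = mk_frac R (r \<otimes>\<^bsub>R\<^esub> a) s"
      unfolding to_frac_def q_eq using rR as sR by (simp add: frac_mult one_nonzerodivisor)
    also have "\<dots> = to_frac R t"
      unfolding to_frac_def using rR as sR t by (simp add: mk_frac_eq_iff one_nonzerodivisor m_comm)
    finally show ?thesis using t(1) by blast
  qed
  then show "r \<in> conductor R" using rR by (simp add: conductor_def)
qed

end
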